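(* Let $p\in(2/5,1)$ and let $T_p$ be the Bell functional $$T_{p}(\mathrm{P}) = \langle B_{0,1}\rangle - \langle B_{0,0} \rangle + \frac{1-p}{p}\big(\langle B_{1,0}\rangle - \langle B_{1,1} \rangle\big) + \langle A_{0}B_{0}\rangle+\langle A_0B_{1} \rangle + \frac{1-p}{p}\big( \langle A_{1}B_{0}\rangle - \langle A_1 B_{1} \rangle\big)$$ on behaviors $\mathrm{P}=(\mathrm{p}(a,b|x,y))_{a,b,x,y\in\{0,1\}}$. Then the following properties hold. 1. For all non-signaling local behaviors $\mathrm{P}$, $T_p(\mathrm{P})\le 2(|2p-1|+1-p)/p$. 2. For all one-way signaling local behaviors $\mathrm{P}\in\mathbb{S}_{(p,p),(1/2,1/2)}$, $T_p(\mathrm{P})\le 2\max\Big\{p,\Big|-p+2\frac{(1-p)^2}{p}\Big|\Big\}+2(1-p)$. 3. For all non-signaling quantum behaviors $\mathrm{P}$, $T_p(\mathrm{P})\le 2\sqrt2\sqrt{\frac{p}{3p-1}}$. 4. Up to local isometries, there is a unique non-signaling quantum strategy whose behavior $\mathrm{P}$ achieves $T_p(\mathrm{P})=2\sqrt2\sqrt{\frac{p}{3p-1}}$. It is the two-qubit strategy with state $\rho=|\psi_\theta\rangle\langle\psi_\theta|$, $|\psi_\theta\rangle=\cos(\theta)|00\rangle+\sin(\theta)|11\rangle$, and observables $$A_0=\sigma_X,\quad A_1=\sigma_Z,\quad B_0=\cos(\phi)\,\sigma_Z+\sin(\phi)\,\sigma_X,\quad B_1=-\cos(\phi)\,\sigma_Z+\sin(\phi)\,\sigma_X,$$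 where $$\theta=\tfrac12\arctan\big[f_1/g_1\big]-\pi/2,\qquad \phi=\arctan\big[f_2/g_2\big],$$ $$f_1=\frac{\sqrt{p(-2+5p)}}{1-3p},\quad g_1=\frac{1-2p}{-1+3p},\quad f_2=-\sqrt{\frac{-2+5p}{-2+6p}},\quad g_2=\sqrt{\frac{p}{-2+6p}}$$ when $p\in(2/5,1/2)\cup(1/2,1)$, and $\theta=\phi=-\pi/4$ when $p=1/2$.
   Context: A behavior is a family of conditional probabilities $\mathrm{P}=(\mathrm{p}(a,b|x,y))$ with $a,b,x,y\in\{0,1\}$, $\mathrm{p}(a,b|x,y)\ge0$, $\sum_{a,b}\mathrm{p}(a,b|x,y)=1$ for all $x,y$. Correlators: $\langle B_{x,y}\rangle=\sum_{a,b}(-1)^b\mathrm{p}(a,b|x,y)$ and $\langle A_xB_y\rangle=\sum_{a,b}(-1)^{a+b}\mathrm{p}(a,b|x,y)$. Non-signaling local behavior: $\mathrm{p}(a,b|x,y)=\sum_\lambda \mathrm{p}(\lambda)\,\mathrm{p}(a|x,\lambda)\,\mathrm{p}(b|y,\lambda)$ for some distribution $\mathrm{p}(\lambda)$ of a hidden variable and conditional distributions $\mathrm{p}(a|x,\lambda)$, $\mathrm{p}(b|y,\lambda)$. The polytope $\mathbb{S}_{(p,q),(r,s)}$, for $p,q,r,s\in[0,1]$: the set of behaviors of the form $$\mathrm{p}(a,b|x,y)=\sum_\lambda \mathrm{p}_\Lambda(\lambda)\sum_{\tilde x,\tilde y\in\{0,1\}}\mathrm{p}_{\tilde Y|Y}(\tilde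 y|y)\,\mathrm{p}_{\tilde X|X}(\tilde x|x)\,\mathrm{p}_A(a|x,\tilde y,\lambda)\,\mathrm{p}_B(b|\tilde x,y,\lambda),$$ where $\mathrm{p}_\Lambda$ is a distribution, $\mathrm{p}_A,\mathrm{p}_B$ are arbitrary conditional distributions, and the channels are fixed by $\mathrm{p}_{\tilde X|X}(0|0)=p$, $\mathrm{p}_{\tilde X|X}(1|1)=q$, $\mathrm{p}_{\tilde Y|Y}(0|0)=r$, $\mathrm{p}_{\tilde Y|Y}(1|1)=s$. Non-signaling quantum strategy: Hilbert spaces $\mathcal H_{Q_A},\mathcal H_{Q_B}$, a density operator $\rho$ on $\mathcal H_{Q_A}\otimes\mathcal H_{Q_B}$, and projective measurements $\{M_{a|x}\}_{a\in\{0,1\}}$ on $\mathcal H_{Q_A}$ and $\{N_{b|y}\}_{b\in\{0,1\}}$ on $\mathcal H_{Q_B}$ for $x,y\in\{0,1\}$ (measurements are assumed projective throughout). Its behavior, called a non-signaling quantum behavior, is $\mathrm{p}(a,b|x,y)=\mathrm{Tr}[(M_{a|x}\otimes N_{b|y})\rho]$. The observables are $A_x=M_{0|x}-M_{1|x}$, $B_y=N_{0|y}-N_{1|y}$. $\sigma_X,\sigma_Z$ are the Pauli matrices. "Up to local isometries, there is a unique strategy" means (self-testing): the stated two-qubit strategy achieves the value, and for every non-signaling quantum strategy $(\rho,A_x,B_y)$ achieving the value and every purification $|\Psi\rangle\in\mathcal H_{Q_A}\otimes\mathcal H_{Q_B}\otimes\mathcal H_E$ of $\rho$, there are isometries $V_A:\mathcal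 H_{Q_A}\to\mathbb C^2\otimes\mathcal H_{A'}$ and $V_B:\mathcal H_{Q_B}\to\mathbb C^2\otimes\mathcal H_{B'}$ and a unit vector $|\xi\rangle\in\mathcal H_{A'}\otimes\mathcal H_{B'}\otimes\mathcal H_E$ such that, up to reordering tensor factors, for all $S\in\{\mathbb 1,A_0,A_1\}$ and $R\in\{\mathbb 1,B_0,B_1\}$, $(V_A\otimes V_B\otimes \mathbb 1_E)(S\otimes R\otimes\mathbb 1_E)|\Psi\rangle=\big[(\bar S\otimes\bar R)|\psi_\theta\rangle\big]\otimes|\xi\rangle$, where $\bar S,\bar R$ are the corresponding operators of the stated two-qubit strategy.
   Formalization: For p in (2/5,1/2), arctan[f1/g1] in θ is taken in (0,π) rather than on the principal branch, shifting θ by π/2; with the principal branch the stated strategy does not attain the maximum (at p=0.45 it gives about 0.71 instead of 3.21). *)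

theory Defs
  imports "HOL-Probability.Probability" "HOL-Library.Z2"
begin

section \<open>Behaviors and the Bell functional\<close>

text \<open>
  Inputs and outputs range over the two-element type \<^typ>\<open>bit\<close>, whose elements are 0 and 1.
  The entry \<open>P a b x y\<close> of a behavior is the conditional probability p(a,b|x,y).
\<close>

type_synonym behavior = "bit \<Rightarrow> bit \<Rightarrow> bit \<Rightarrow> bit \<Rightarrow> real"

definition behavior :: "behavior \<Rightarrow> bool" where
  "behavior P \<longleftrightarrow> (\<forall>x y. (\<forall>a b. 0 \<le> P a b x y) \<and> (\<Sum>a\<in>{0,1}. \<Sum>b\<in>{0,1}. P a b x y) = 1)"

definition sgn_bit :: "bit \<Rightarrow> real" where
  "sgn_bit b = (if b = 0 then 1 else -1)"

text \<open>In \<open>corr_AB\<close> the sum \<open>a + b\<close> is taken modulo 2, which does not affect the sign.\<close>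

definition corr_B :: "behavior \<Rightarrow> bit \<Rightarrow> bit \<Rightarrow> real" where
  "corr_B P x y = (\<Sum>a\<in>{0,1}. \<Sum>b\<in>{0,1}. sgn_bit b * P a b x y)"

definition corr_AB :: "behavior \<Rightarrow> bit \<Rightarrow> bit \<Rightarrow> real" where
  "corr_AB P x y = (\<Sum>a\<in>{0,1}. \<Sum>b\<in>{0,1}. sgn_bit (a + b) * P a b x y)"

definition T :: "real \<Rightarrow> behavior \<Rightarrow> real" where
  "T p P =
     corr_B P 0 1 - corr_B P 0 0 + (1 - p) / p * (corr_B P 1 0 - corr_B P 1 1)
     + corr_AB P 0 0 + corr_AB P 0 1 + (1 - p) / p * (corr_AB P 1 0 - corr_AB P 1 1)"


section \<open>Local behaviors\<close>

text \<open>
  The support of a discrete distribution is countable, so taking the hidden variable in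
  \<^typ>\<open>nat\<close> is no restriction.
\<close>

definition local_behaviors :: "behavior set" where
  "local_behaviors = {P. behavior P \<and>
     (\<exists>(pL :: nat pmf) (pA :: bit \<Rightarrow> nat \<Rightarrow> bit pmf) (pB :: bit \<Rightarrow> nat \<Rightarrow> bit pmf).
        \<forall>a b x y. P a b x y =
          (\<Sum>\<^sub>\<infinity>l. pmf pL l * pmf (pA x l) a * pmf (pB y l) b))}"

text \<open>
  \<open>channel p q u v\<close> is the probability of output \<open>u\<close> given input \<open>v\<close>, for the binary channel
  that transmits 0 faithfully with probability \<open>p\<close> and 1 with probability \<open>q\<close>.
\<close>

definition channel :: "real \<Rightarrow> real \<Rightarrow> bit \<Rightarrow> bit \<Rightarrow> real" where
  "channel p q u v =
     (if v = 0 then (if u = 0 then p else 1 - p) else (if u = 1 then q else 1 - q))"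

definition signaling_local_behaviors :: "real \<times> real \<Rightarrow> real \<times> real \<Rightarrow> behavior set" where
  "signaling_local_behaviors = (\<lambda>(p, q) (r, s). {P. behavior P \<and>
     (\<exists>(pL :: nat pmf) (pA :: bit \<Rightarrow> bit \<Rightarrow> nat \<Rightarrow> bit pmf) (pB :: bit \<Rightarrow> bit \<Rightarrow> nat \<Rightarrow> bit pmf).
        \<forall>a b x y. P a b x y =
          (\<Sum>\<^sub>\<infinity>l. pmf pL l *
             (\<Sum>x'\<in>{0,1}. \<Sum>y'\<in>{0,1}.
                channel r s y' y * channel p q x' x * pmf (pA x y' l) a * pmf (pB x' y l) b)))})"


section \<open>Hilbert spaces\<close>

text \<open>
  Complex Hilbert spaces are represented as spaces of square-summable families over an arbitrary
  index type. Every nonzero Hilbert space is of this form, of finite or infinite dimension, the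
  index type being an orthonormal basis; the tensor product is then the space over the product
  of the index types. The space of complex pairs is \<open>bit ell2\<close>.
\<close>

typedef 'a ell2 = "{f :: 'a \<Rightarrow> complex. (\<lambda>i. (cmod (f i))\<^sup>2) summable_on UNIV}"
  morphisms coord Abs_ell2
  by (rule exI[of _ "\<lambda>_. 0"]) simp

setup_lifting type_definition_ell2

lemma coord_eqI: "(\<And>i. coord x i = coord y i) \<Longrightarrow> x = y"
  by (metis coord_inject ext)

lemma summable_coord: "(\<lambda>i. (cmod (coord x i))\<^sup>2) summable_on UNIV"
  using coord[of x] by simp

lemma cmod_add_sq_le: "(cmod (a + b))\<^sup>2 \<le> 2 * (cmod a)\<^sup>2 + 2 * (cmod b)\<^sup>2"
proof -
  have "(cmod (a + b))\<^sup>2 \<le> (cmod a + cmod b)\<^sup>2"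
    by (simp add: norm_triangle_ineq power_mono)
  moreover have "0 \<le> (cmod a - cmod b)\<^sup>2"
    by simp
  ultimately show ?thesis
    by (simp add: power2_eq_square algebra_simps)
qed

lemma cmod_mult_le: "cmod (a * b) \<le> (cmod a)\<^sup>2 + (cmod b)\<^sup>2"
proof -
  have "0 \<le> (cmod a - cmod b)\<^sup>2"
    by simp
  then have "2 * (cmod a * cmod b) \<le> (cmod a)\<^sup>2 + (cmod b)\<^sup>2"
    by (simp add: power2_eq_square algebra_simps)
  then show ?thesis
    unfolding norm_mult using mult_nonneg_nonneg[OF norm_ge_zero[of a] norm_ge_zero[of b]] by linarith
qed

instantiation ell2 :: (type) real_vector
begin

lift_definition zero_ell2 :: "'a ell2" is "\<lambda>_. 0" by simp

lift_definition plus_ell2 :: "'a ell2 \<Rightarrow> 'a ell2 \<Rightarrow> 'a ell2" is "\<lambda>f g i. f i + g i"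
proof -
  fix f g :: "'a \<Rightarrow> complex"
  assume f: "(\<lambda>i. (cmod (f i))\<^sup>2) summable_on UNIV" and g: "(\<lambda>i. (cmod (g i))\<^sup>2) summable_on UNIV"
  show "(\<lambda>i. (cmod (f i + g i))\<^sup>2) summable_on UNIV"
    by (rule summable_on_comparison_test[OF summable_on_add[OF
          summable_on_cmult_right[OF f, of 2] summable_on_cmult_right[OF g, of 2]]])
      (auto simp: cmod_add_sq_le)
qed

lift_definition uminus_ell2 :: "'a ell2 \<Rightarrow> 'a ell2" is "\<lambda>f i. - f i" by simp

definition minus_ell2 :: "'a ell2 \<Rightarrow> 'a ell2 \<Rightarrow> 'a ell2" where
  "minus_ell2 x y = x + - y"

lift_definition scaleR_ell2 :: "real \<Rightarrow> 'a ell2 \<Rightarrow> 'a ell2" is "\<lambda>r f i. r *\<^sub>R f i"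
  by (simp add: power_mult_distrib summable_on_cmult_right)

instance
  by standard (rule minus_ell2_def | (transfer; simp add: algebra_simps))+

end

lift_definition scaleC :: "complex \<Rightarrow> 'a ell2 \<Rightarrow> 'a ell2" (infixr \<open>*\<^sub>C\<close> 75) is
  "\<lambda>c f i. c * f i"
  by (simp add: norm_mult power_mult_distrib summable_on_cmult_right)

lemma coord_simps [simp]:
  "coord 0 i = 0"
  "coord (x + y) i = coord x i + coord y i"
  "coord (- x) i = - coord x i"
  "coord (x - y) i = coord x i - coord y i"
  "coord (r *\<^sub>R x) i = r *\<^sub>R coord x i"
  "coord (c *\<^sub>C x) i = c * coord x i"
  by (simp_all only: zero_ell2.rep_eq plus_ell2.rep_eq uminus_ell2.rep_eq scaleR_ell2.rep_eq
      minus_ell2_def[of x y] scaleC.rep_eq) simp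

definition cinner :: "'a ell2 \<Rightarrow> 'a ell2 \<Rightarrow> complex" where
  "cinner x y = (\<Sum>\<^sub>\<infinity>i. cnj (coord x i) * coord y i)"

lemma cinner_summable: "(\<lambda>i. cnj (coord x i) * coord y i) summable_on UNIV"
proof (rule abs_summable_summable, rule Infinite_Sum.abs_summable_on_comparison_test')
  show "(\<lambda>i. (cmod (coord x i))\<^sup>2 + (cmod (coord y i))\<^sup>2) summable_on UNIV"
    by (intro summable_on_add summable_coord)
  show "norm (cnj (coord x i) * coord y i) \<le> (cmod (coord x i))\<^sup>2 + (cmod (coord y i))\<^sup>2" for i
    using cmod_mult_le[of "cnj (coord x i)" "coord y i"] by simp
qed

lemma cinner_add_left: "cinner (x + y) z = cinner x z + cinner y z"
  unfolding cinner_def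
  by (subst infsum_add[symmetric]) (simp_all add: cinner_summable distrib_right)

lemma cinner_scaleC_left: "cinner (c *\<^sub>C x) y = cnj c * cinner x y"
  unfolding cinner_def
  by (subst infsum_cmult_right'[symmetric]) (simp add: mult.assoc)

lemma cinner_commute: "cinner y x = cnj (cinner x y)"
  unfolding cinner_def by (subst infsum_cnj[symmetric]) (simp add: mult.commute)

lemma scaleR_scaleC: "r *\<^sub>R x = complex_of_real r *\<^sub>C x"
  by (rule coord_eqI) (simp add: scaleR_conv_of_real)

lemma cinner_self: "cinner x x = complex_of_real (\<Sum>\<^sub>\<infinity>i. (cmod (coord x i))\<^sup>2)"
proof -
  have "cinner x x = (\<Sum>\<^sub>\<infinity>i. complex_of_real ((cmod (coord x i))\<^sup>2))"
    unfolding cinner_def by (rule infsum_cong) (metis complex_norm_square mult.commute)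
  also have "\<dots> = complex_of_real (\<Sum>\<^sub>\<infinity>i. (cmod (coord x i))\<^sup>2)"
    using has_sum_of_real[OF has_sum_infsum[OF summable_coord[of x]], where ?'a = complex]
    by (rule infsumI)
  finally show ?thesis .
qed

lemma cinner_self_eq_0: "(\<Sum>\<^sub>\<infinity>i. (cmod (coord x i))\<^sup>2) = 0 \<longleftrightarrow> x = 0"
proof
  assume "(\<Sum>\<^sub>\<infinity>i. (cmod (coord x i))\<^sup>2) = 0"
  then have "(cmod (coord x i))\<^sup>2 = 0" for i
    using nonneg_infsum_le_0D[of "\<lambda>i. (cmod (coord x i))\<^sup>2" UNIV i]
    by (simp add: summable_coord)
  then show "x = 0" by (intro coord_eqI) simp
qed simp

instantiation ell2 :: (type) real_inner
begin

definition inner_ell2 :: "'a ell2 \<Rightarrow> 'a ell2 \<Rightarrow> real" where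
  "inner_ell2 x y = Re (cinner x y)"

definition norm_ell2 :: "'a ell2 \<Rightarrow> real" where
  "norm_ell2 x = sqrt (Re (cinner x x))"

definition sgn_ell2 :: "'a ell2 \<Rightarrow> 'a ell2" where
  "sgn_ell2 x = inverse (norm x) *\<^sub>R x"

definition dist_ell2 :: "'a ell2 \<Rightarrow> 'a ell2 \<Rightarrow> real" where
  "dist_ell2 x y = norm (x - y)"

definition uniformity_ell2 :: "('a ell2 \<times> 'a ell2) filter" where
  "uniformity_ell2 = (INF e\<in>{0 <..}. principal {(x, y). dist x y < e})"

definition open_ell2 :: "'a ell2 set \<Rightarrow> bool" where
  "open_ell2 U \<longleftrightarrow> (\<forall>x\<in>U. \<forall>\<^sub>F (x', y) in uniformity. x' = x \<longrightarrow> y \<in> U)"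

instance
proof
  fix x y z :: "'a ell2" and r :: real
  show "inner x y = inner y x"
    by (simp add: inner_ell2_def cinner_commute[of y x])
  show "inner (x + y) z = inner x z + inner y z"
    by (simp add: inner_ell2_def cinner_add_left)
  show "inner (r *\<^sub>R x) y = r * inner x y"
    by (simp add: inner_ell2_def scaleR_scaleC cinner_scaleC_left)
  show "0 \<le> inner x x"
    by (simp add: inner_ell2_def cinner_self infsum_nonneg)
  show "inner x x = 0 \<longleftrightarrow> x = 0"
    by (simp add: inner_ell2_def cinner_self cinner_self_eq_0)
  show "norm x = sqrt (inner x x)"
    by (simp add: inner_ell2_def norm_ell2_def)
qed (rule sgn_ell2_def dist_ell2_def uniformity_ell2_def open_ell2_def)+

end

lift_definition ket :: "'a \<Rightarrow> 'a ell2" is "\<lambda>i j. if j = i then 1 else 0"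
proof -
  fix i :: 'a
  have *: "(\<lambda>j. (cmod (if j = i then 1 else 0))\<^sup>2) summable_on {i}" by simp
  show "(\<lambda>j. (cmod (if j = i then 1 else 0))\<^sup>2) summable_on UNIV"
    by (rule summable_on_cong_neutral[THEN iffD1, OF _ _ _ *]) auto
qed

definition bounded_clinear :: "('a ell2 \<Rightarrow> 'b ell2) \<Rightarrow> bool" where
  "bounded_clinear S \<longleftrightarrow> bounded_linear S \<and> (\<forall>c x. S (c *\<^sub>C x) = c *\<^sub>C S x)"

definition isometry :: "('a ell2 \<Rightarrow> 'b ell2) \<Rightarrow> bool" where
  "isometry V \<longleftrightarrow> bounded_clinear V \<and> (\<forall>x. norm (V x) = norm x)"

definition projector :: "('a ell2 \<Rightarrow> 'a ell2) \<Rightarrow> bool" where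
  "projector M \<longleftrightarrow> bounded_clinear M \<and> (\<forall>x. M (M x) = M x)
     \<and> (\<forall>x y. cinner x (M y) = cinner (M x) y)"


section \<open>Tensor products\<close>

lemma summable_tensor:
  assumes "(\<lambda>i. (cmod (f i))\<^sup>2) summable_on UNIV" "(\<lambda>j. (cmod (g j))\<^sup>2) summable_on UNIV"
  shows "(\<lambda>ij. (cmod (case ij of (i, j) \<Rightarrow> f i * g j))\<^sup>2) summable_on UNIV"
proof -
  have "(\<lambda>ij. (cmod (case ij of (i, j) \<Rightarrow> f i * g j))\<^sup>2) summable_on (SIGMA i:UNIV. UNIV)"
  proof (rule summable_on_SigmaI)
    fix i
    show "((\<lambda>j. (cmod (case (i, j) of (i, j) \<Rightarrow> f i * g j))\<^sup>2)
            has_sum (cmod (f i))\<^sup>2 * (\<Sum>\<^sub>\<infinity>j. (cmod (g j))\<^sup>2)) UNIV"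
      using has_sum_cmult_right[OF has_sum_infsum[OF assms(2)], of "(cmod (f i))\<^sup>2"]
      by (simp add: norm_mult power_mult_distrib)
  next
    show "(\<lambda>i. (cmod (f i))\<^sup>2 * (\<Sum>\<^sub>\<infinity>j. (cmod (g j))\<^sup>2)) summable_on UNIV"
      by (rule summable_on_cmult_left[OF assms(1)])
  qed simp
  then show ?thesis by simp
qed

lift_definition tensor :: "'a ell2 \<Rightarrow> 'b ell2 \<Rightarrow> ('a \<times> 'b) ell2" (infixr \<open>\<otimes>\<^sub>v\<close> 70) is
  "\<lambda>f g (i, j). f i * g j"
  by (rule summable_tensor)

text \<open>
  The product \<open>S \<otimes>\<^sub>o R\<close> of bounded operators is the unique bounded operator that maps
  \<open>x \<otimes>\<^sub>v y\<close> to \<open>S x \<otimes>\<^sub>v R y\<close>; see \<open>tensor_op_unique\<close> below for existence and uniqueness.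
\<close>

definition tensor_op ::
  "('a ell2 \<Rightarrow> 'c ell2) \<Rightarrow> ('b ell2 \<Rightarrow> 'd ell2) \<Rightarrow> ('a \<times> 'b) ell2 \<Rightarrow> ('c \<times> 'd) ell2"
  (infixr \<open>\<otimes>\<^sub>o\<close> 70) where
  "S \<otimes>\<^sub>o R = (THE U. bounded_clinear U \<and> (\<forall>x y. U (x \<otimes>\<^sub>v y) = S x \<otimes>\<^sub>v R y))"

text \<open>Relabelling of the orthonormal basis, for bijective \<open>f\<close>.\<close>

definition reindex :: "('b \<Rightarrow> 'a) \<Rightarrow> 'a ell2 \<Rightarrow> 'b ell2" where
  "reindex f x = Abs_ell2 (\<lambda>i. coord x (f i))"

lemma norm_sq_has_sum: "((\<lambda>i. (cmod (coord x i))\<^sup>2) has_sum (norm x)\<^sup>2) UNIV"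
proof -
  have "(norm x)\<^sup>2 = (\<Sum>\<^sub>\<infinity>i. (cmod (coord x i))\<^sup>2)"
    by (simp add: norm_ell2_def cinner_self infsum_nonneg)
  then show ?thesis
    using has_sum_infsum[OF summable_coord[of x]] by simp
qed

lemma norm_sq_eqI: "((\<lambda>i. (cmod (coord x i))\<^sup>2) has_sum s) UNIV \<Longrightarrow> (norm x)\<^sup>2 = s"
  by (rule has_sum_unique[OF norm_sq_has_sum])

lemma coord_Abs:
  assumes "(\<lambda>i. (cmod (f i))\<^sup>2) summable_on UNIV"
  shows "coord (Abs_ell2 f) = f"
  using assms by (simp add: Abs_ell2_inverse)

lemma coord_tensor [simp]: "coord (x \<otimes>\<^sub>v y) (i, j) = coord x i * coord y j"
  by (simp add: tensor.rep_eq)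

lemma coord_ket: "coord (ket i) j = (if j = i then 1 else 0)"
  by (simp add: ket.rep_eq)

lemma ket_tensor: "ket i \<otimes>\<^sub>v ket j = ket (i, j)"
  by (rule coord_eqI) (auto simp: coord_ket split: prod.split if_splits)

lemma coord_sum: "coord (\<Sum>i\<in>F. g i) j = (\<Sum>i\<in>F. coord (g i) j)"
  by (induction F rule: infinite_finite_induct) simp_all

lemma ell2_has_sum_ket: "((\<lambda>i. coord x i *\<^sub>C ket i) has_sum x) UNIV"
proof -
  define s where "s F = (\<Sum>i\<in>F. coord x i *\<^sub>C ket i)" for F
  have s: "coord (s F) j = (if j \<in> F then coord x j else 0)" if "finite F" for F j
    using that by (simp add: s_def coord_sum coord_ket if_distrib cong: if_cong)
  have norm_diff: "(norm (s F - x))\<^sup>2 = (norm x)\<^sup>2 - (\<Sum>i\<in>F. (cmod (coord x i))\<^sup>2)"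
    if F: "finite F" for F
  proof -
    have "((\<lambda>i. (cmod (coord x i))\<^sup>2) has_sum ((norm x)\<^sup>2 - (\<Sum>i\<in>F. (cmod (coord x i))\<^sup>2))) (UNIV - F)"
      by (rule has_sum_Diff[OF norm_sq_has_sum has_sum_finite[OF F]]) simp
    also have "?this \<longleftrightarrow> ((\<lambda>i. (cmod (coord (s F - x) i))\<^sup>2) has_sum
        ((norm x)\<^sup>2 - (\<Sum>i\<in>F. (cmod (coord x i))\<^sup>2))) UNIV"
      by (rule has_sum_cong_neutral) (auto simp: s F)
    finally show ?thesis
      by (rule norm_sq_eqI)
  qed
  have "((\<lambda>F. (norm x)\<^sup>2 - (\<Sum>i\<in>F. (cmod (coord x i))\<^sup>2)) \<longlongrightarrow> (norm x)\<^sup>2 - (norm x)\<^sup>2)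
          (finite_subsets_at_top UNIV)"
    by (rule tendsto_diff[OF tendsto_const norm_sq_has_sum[unfolded has_sum_def]])
  moreover have "\<forall>\<^sub>F F in finite_subsets_at_top UNIV.
      (norm x)\<^sup>2 - (\<Sum>i\<in>F. (cmod (coord x i))\<^sup>2) = (norm (s F - x))\<^sup>2"
    by (rule eventually_finite_subsets_at_top_weakI) (simp only: norm_diff)
  ultimately have "((\<lambda>F. (norm (s F - x))\<^sup>2) \<longlongrightarrow> (norm x)\<^sup>2 - (norm x)\<^sup>2)
      (finite_subsets_at_top UNIV)"
    by (rule Lim_transform_eventually)
  then have "((\<lambda>F. (norm (s F - x))\<^sup>2) \<longlongrightarrow> 0) (finite_subsets_at_top UNIV)"
    by (simp only: diff_self)
  then have "((\<lambda>F. sqrt ((norm (s F - x))\<^sup>2)) \<longlongrightarrow> sqrt 0) (finite_subsets_at_top UNIV)"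
    by (rule tendsto_real_sqrt)
  then have "((\<lambda>F. norm (s F - x)) \<longlongrightarrow> 0) (finite_subsets_at_top UNIV)"
    by simp
  then show ?thesis
    unfolding has_sum_def s_def by (simp add: LIM_zero_iff tendsto_norm_zero_iff)
qed

lemma bounded_clinear_eqI:
  assumes S: "bounded_clinear S" and R: "bounded_clinear R"
    and eq: "\<And>i. S (ket i) = R (ket i)"
  shows "S = R"
proof
  fix x
  have hS: "((\<lambda>i. S (coord x i *\<^sub>C ket i)) has_sum S x) UNIV"
    using S unfolding bounded_clinear_def by (blast intro: has_sum_bounded_linear[OF _ ell2_has_sum_ket])
  have hR: "((\<lambda>i. R (coord x i *\<^sub>C ket i)) has_sum R x) UNIV"
    using R unfolding bounded_clinear_def by (blast intro: has_sum_bounded_linear[OF _ ell2_has_sum_ket])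
  have "(\<lambda>i. R (coord x i *\<^sub>C ket i)) = (\<lambda>i. S (coord x i *\<^sub>C ket i))"
    using S R eq by (simp add: bounded_clinear_def)
  with hR have "((\<lambda>i. S (coord x i *\<^sub>C ket i)) has_sum R x) UNIV"
    by (simp only:)
  then show "S x = R x"
    by (rule has_sum_unique[OF hS])
qed

lemma summable_reindex:
  assumes "bij f"
  shows "(\<lambda>i. (cmod (coord x (f i)))\<^sup>2) summable_on UNIV"
  using summable_on_reindex_bij_betw[OF assms, of "\<lambda>i. (cmod (coord x i))\<^sup>2"] summable_coord[of x] by simp

lemma coord_reindex: "bij f \<Longrightarrow> coord (reindex f x) i = coord x (f i)"
  unfolding reindex_def by (subst coord_Abs[OF summable_reindex]) simp_all

lemma norm_reindex:
  assumes "bij f"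
  shows "norm (reindex f x) = norm x"
proof -
  have "((\<lambda>i. (cmod (coord (reindex f x) i))\<^sup>2) has_sum (norm x)\<^sup>2) UNIV"
    unfolding coord_reindex[OF assms]
    using has_sum_reindex_bij_betw[OF assms, of "\<lambda>i. (cmod (coord x i))\<^sup>2"] norm_sq_has_sum[of x] by simp
  then have "(norm (reindex f x))\<^sup>2 = (norm x)\<^sup>2"
    by (rule norm_sq_eqI)
  then show ?thesis by simp
qed

lemma bounded_clinearI:
  assumes "\<And>x y. S (x + y) = S x + S y" "\<And>c x. S (c *\<^sub>C x) = c *\<^sub>C S x"
    "\<And>x. norm (S x) \<le> norm x * K"
  shows "bounded_clinear S"
  unfolding bounded_clinear_def
  using assms by (auto intro!: bounded_linear_intro[where K = K] simp: scaleR_scaleC)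

lemma bounded_clinear_reindex: "bij f \<Longrightarrow> bounded_clinear (reindex f)"
  by (rule bounded_clinearI[where K = 1]) (auto intro: coord_eqI simp: coord_reindex norm_reindex)

lemma bounded_clinear_compose:
  "bounded_clinear S \<Longrightarrow> bounded_clinear R \<Longrightarrow> bounded_clinear (\<lambda>x. S (R x))"
  by (auto simp: bounded_clinear_def bounded_linear_compose)

lemma tensor_op_left_exists:
  fixes S :: "'a ell2 \<Rightarrow> 'c ell2"
  assumes S: "bounded_clinear S"
  shows "\<exists>U. bounded_clinear U \<and> (\<forall>x (y :: 'b ell2). U (x \<otimes>\<^sub>v y) = S x \<otimes>\<^sub>v y)"
proof -
  define col :: "('a \<times> 'b) ell2 \<Rightarrow> 'b \<Rightarrow> 'a ell2"
    where "col h j = Abs_ell2 (\<lambda>i. coord h (i, j))" for h j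
  have col: "coord (col h j) i = coord h (i, j)" for h j i
  proof -
    have "(\<lambda>ij. (cmod (coord h ij))\<^sup>2) summable_on (\<lambda>i. (i, j)) ` UNIV"
      by (rule summable_on_subset_banach[OF summable_coord]) simp
    then have "(\<lambda>i. (cmod (coord h (i, j)))\<^sup>2) summable_on UNIV"
      by (subst (asm) summable_on_reindex) (auto simp: inj_on_def o_def)
    then show ?thesis by (simp add: col_def coord_Abs)
  qed
  have swap: "bij_betw prod.swap UNIV UNIV"
    by simp
  have cols: "((\<lambda>j. (norm (col h j))\<^sup>2) has_sum (norm h)\<^sup>2) UNIV" for h
  proof (rule has_sum_SigmaD)
    show "((\<lambda>ji. (cmod (coord h (prod.swap ji)))\<^sup>2) has_sum (norm h)\<^sup>2) (SIGMA j:UNIV. UNIV)"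
      using has_sum_reindex_bij_betw[OF swap, of "\<lambda>ij. (cmod (coord h ij))\<^sup>2"] norm_sq_has_sum[of h]
      by simp
    show "((\<lambda>i. (cmod (coord h (prod.swap (j, i))))\<^sup>2) has_sum (norm (col h j))\<^sup>2) UNIV" for j
      using norm_sq_has_sum[of "col h j"] by (simp add: col)
  qed
  have col_add: "col (g + h) j = col g j + col h j" for g h j
    by (rule coord_eqI) (simp add: col)
  have col_scaleC: "col (c *\<^sub>C h) j = c *\<^sub>C col h j" for c h j
    by (rule coord_eqI) (simp add: col)
  have col_tensor: "col (x \<otimes>\<^sub>v y) j = coord y j *\<^sub>C x" for x y j
    by (rule coord_eqI) (simp add: col)
  obtain K where K: "\<And>x. norm (S x) \<le> norm x * K"
    using S bounded_linear.bounded unfolding bounded_clinear_def by blast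
  have K2: "(norm (S x))\<^sup>2 \<le> K\<^sup>2 * (norm x)\<^sup>2" for x
    using power_mono[OF K norm_ge_zero, of x 2] by (simp add: power_mult_distrib mult.commute)
  define u where "u h = (\<lambda>(k, j). coord (S (col h j)) k)" for h
  define U where "U h = Abs_ell2 (u h)" for h
  have sum_S: "(\<lambda>j. (norm (S (col h j)))\<^sup>2) summable_on UNIV" for h
    by (rule summable_on_comparison_test[OF summable_on_cmult_right[OF has_sum_imp_summable[OF cols[of h]], of "K\<^sup>2"]])
      (simp_all add: K2)
  have u: "((\<lambda>kj. (cmod (u h kj))\<^sup>2) has_sum (\<Sum>\<^sub>\<infinity>j. (norm (S (col h j)))\<^sup>2)) UNIV" for h
  proof -
    have inner: "((\<lambda>k. (cmod (u h (prod.swap (j, k))))\<^sup>2) has_sum (norm (S (col h j)))\<^sup>2) UNIV" for j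
      using norm_sq_has_sum[of "S (col h j)"] by (simp add: u_def)
    have "((\<lambda>jk. (cmod (u h (prod.swap jk)))\<^sup>2) has_sum (\<Sum>\<^sub>\<infinity>j. (norm (S (col h j)))\<^sup>2))
            (SIGMA j:UNIV. UNIV)"
      by (rule has_sum_SigmaI[OF inner has_sum_infsum[OF sum_S]],
          rule summable_on_SigmaI[OF inner sum_S]) simp
    then show ?thesis
      using has_sum_reindex_bij_betw[OF swap, of "\<lambda>kj. (cmod (u h kj))\<^sup>2"] by simp
  qed
  have U: "coord (U h) (k, j) = coord (S (col h j)) k" for h k j
    unfolding U_def by (subst coord_Abs[OF has_sum_imp_summable[OF u]]) (simp add: u_def)
  have norm_U: "norm (U h) \<le> norm h * \<bar>K\<bar>" for h
  proof (rule power2_le_imp_le)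
    have "((\<lambda>kj. (cmod (coord (U h) kj))\<^sup>2) has_sum (\<Sum>\<^sub>\<infinity>j. (norm (S (col h j)))\<^sup>2)) UNIV"
      using u[of h] unfolding U_def coord_Abs[OF has_sum_imp_summable[OF u]] .
    then have "(norm (U h))\<^sup>2 = (\<Sum>\<^sub>\<infinity>j. (norm (S (col h j)))\<^sup>2)"
      by (rule norm_sq_eqI)
    also have "\<dots> \<le> K\<^sup>2 * (norm h)\<^sup>2"
      by (rule has_sum_mono[OF has_sum_infsum[OF sum_S] has_sum_cmult_right[OF cols]]) (rule K2)
    finally show "(norm (U h))\<^sup>2 \<le> (norm h * \<bar>K\<bar>)\<^sup>2"
      by (simp add: power_mult_distrib mult.commute)
  qed simp
  have "bounded_clinear U"
  proof (rule bounded_clinearI[OF _ _ norm_U])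
    show "U (g + h) = U g + U h" for g h
    proof (rule coord_eqI)
      have "S (col g j + col h j) = S (col g j) + S (col h j)" for j
        using S by (simp add: bounded_clinear_def linear_simps)
      then show "coord (U (g + h)) kj = coord (U g + U h) kj" for kj
        by (cases kj) (simp add: U col_add)
    qed
    show "U (c *\<^sub>C h) = c *\<^sub>C U h" for c h
    proof (rule coord_eqI)
      show "coord (U (c *\<^sub>C h)) kj = coord (c *\<^sub>C U h) kj" for kj
        using S by (cases kj) (simp add: U col_scaleC bounded_clinear_def)
    qed
  qed
  moreover have "U (x \<otimes>\<^sub>v y) = S x \<otimes>\<^sub>v y" for x y
  proof (rule coord_eqI)
    show "coord (U (x \<otimes>\<^sub>v y)) kj = coord (S x \<otimes>\<^sub>v y) kj" for kj
      using S by (cases kj) (simp add: U col_tensor bounded_clinear_def)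
  qed
  ultimately show ?thesis by blast
qed

lemma tensor_swap: "reindex prod.swap (x \<otimes>\<^sub>v y) = y \<otimes>\<^sub>v x"
  by (rule coord_eqI) (auto simp: coord_reindex split: prod.split)

lemma tensor_op_unique:
  fixes S :: "'a ell2 \<Rightarrow> 'c ell2" and R :: "'b ell2 \<Rightarrow> 'd ell2"
  assumes S: "bounded_clinear S" and R: "bounded_clinear R"
  shows "\<exists>!U. bounded_clinear U \<and> (\<forall>x y. U (x \<otimes>\<^sub>v y) = S x \<otimes>\<^sub>v R y)"
proof (rule ex_ex1I)
  obtain U :: "('a \<times> 'd) ell2 \<Rightarrow> ('c \<times> 'd) ell2"
    where U: "bounded_clinear U" "\<And>x y. U (x \<otimes>\<^sub>v y) = S x \<otimes>\<^sub>v y"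
    using tensor_op_left_exists[OF S] by blast
  obtain W :: "('b \<times> 'a) ell2 \<Rightarrow> ('d \<times> 'a) ell2"
    where W: "bounded_clinear W" "\<And>x y. W (x \<otimes>\<^sub>v y) = R x \<otimes>\<^sub>v y"
    using tensor_op_left_exists[OF R] by blast
  define Z where "Z = (\<lambda>h. U (reindex prod.swap (W (reindex prod.swap h))))"
  have "bounded_clinear Z"
    unfolding Z_def
    by (rule bounded_clinear_compose[OF U(1) bounded_clinear_compose[OF _
          bounded_clinear_compose[OF W(1)]]]; simp add: bounded_clinear_reindex)
  moreover have "Z (x \<otimes>\<^sub>v y) = S x \<otimes>\<^sub>v R y" for x y
    by (simp add: Z_def tensor_swap U W)
  ultimately show "\<exists>Z. bounded_clinear Z \<and> (\<forall>x y. Z (x \<otimes>\<^sub>v y) = S x \<otimes>\<^sub>v R y)"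
    by blast
next
  fix U W
  assume U: "bounded_clinear U \<and> (\<forall>x y. U (x \<otimes>\<^sub>v y) = S x \<otimes>\<^sub>v R y)"
    and W: "bounded_clinear W \<and> (\<forall>x y. W (x \<otimes>\<^sub>v y) = S x \<otimes>\<^sub>v R y)"
  show "U = W"
  proof (rule bounded_clinear_eqI)
    show "U (ket ij) = W (ket ij)" for ij
      using U W by (cases ij) (simp flip: ket_tensor)
  qed (use U W in auto)
qed


section \<open>Quantum strategies\<close>

definition trace :: "('a ell2 \<Rightarrow> 'a ell2) \<Rightarrow> complex" where
  "trace S = (\<Sum>\<^sub>\<infinity>i. cinner (ket i) (S (ket i)))"

text \<open>
  For a positive operator the diagonal entries are nonnegative, so the condition
  \<open>trace \<rho> = 1\<close> already forces their summability, that is, that \<open>\<rho>\<close> is trace class.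
\<close>

definition density_operator :: "('a ell2 \<Rightarrow> 'a ell2) \<Rightarrow> bool" where
  "density_operator \<rho> \<longleftrightarrow>
     bounded_clinear \<rho> \<and> (\<forall>x. cinner x (\<rho> x) \<in> \<real>\<^sub>\<ge>\<^sub>0) \<and> trace \<rho> = 1"

text \<open>For two outcomes, mutual orthogonality follows from completeness.\<close>

definition projective_measurement :: "(bit \<Rightarrow> 'a ell2 \<Rightarrow> 'a ell2) \<Rightarrow> bool" where
  "projective_measurement M \<longleftrightarrow> (\<forall>a. projector (M a)) \<and> (\<forall>x. M 0 x + M 1 x = x)"

text \<open>The operators \<open>M x a\<close> and \<open>N y b\<close> correspond to outcomes a and b for inputs x and y.\<close>

definition quantum_strategy ::
  "(('a \<times> 'b) ell2 \<Rightarrow> ('a \<times> 'b) ell2) \<Rightarrow> (bit \<Rightarrow> bit \<Rightarrow> 'a ell2 \<Rightarrow> 'a ell2) \<Rightarrow>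
   (bit \<Rightarrow> bit \<Rightarrow> 'b ell2 \<Rightarrow> 'b ell2) \<Rightarrow> bool" where
  "quantum_strategy \<rho> M N \<longleftrightarrow> density_operator \<rho>
     \<and> (\<forall>x. projective_measurement (M x)) \<and> (\<forall>y. projective_measurement (N y))"

text \<open>The trace below is real (and nonnegative) for every strategy.\<close>

definition quantum_behavior ::
  "(('a \<times> 'b) ell2 \<Rightarrow> ('a \<times> 'b) ell2) \<Rightarrow> (bit \<Rightarrow> bit \<Rightarrow> 'a ell2 \<Rightarrow> 'a ell2) \<Rightarrow>
   (bit \<Rightarrow> bit \<Rightarrow> 'b ell2 \<Rightarrow> 'b ell2) \<Rightarrow> behavior" where
  "quantum_behavior \<rho> M N = (\<lambda>a b x y. Re (trace ((M x a \<otimes>\<^sub>o N y b) \<circ> \<rho>)))"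

definition observable :: "(bit \<Rightarrow> 'a ell2 \<Rightarrow> 'a ell2) \<Rightarrow> 'a ell2 \<Rightarrow> 'a ell2" where
  "observable M = (\<lambda>x. M 0 x - M 1 x)"

text \<open>The operator \<open>|x\<rangle>\<langle>x|\<close>.\<close>

definition ketbra :: "'a ell2 \<Rightarrow> 'a ell2 \<Rightarrow> 'a ell2" where
  "ketbra x = (\<lambda>y. cinner x y *\<^sub>C x)"

text \<open>
  \<open>purification \<Psi> \<rho>\<close>: the partial trace of \<open>|\<Psi>\<rangle>\<langle>\<Psi>|\<close> over the second factor is \<open>\<rho>\<close>,
  expressed through the sesquilinear forms of the two operators.
\<close>

definition purification :: "('a \<times> 'e) ell2 \<Rightarrow> ('a ell2 \<Rightarrow> 'a ell2) \<Rightarrow> bool" where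
  "purification \<Psi> \<rho> \<longleftrightarrow> (\<forall>x y. cinner x (\<rho> y) =
     (\<Sum>\<^sub>\<infinity>e. cinner (x \<otimes>\<^sub>v ket e) (ketbra \<Psi> (y \<otimes>\<^sub>v ket e))))"


section \<open>The two-qubit strategy\<close>

definition sigma_X :: "bit ell2 \<Rightarrow> bit ell2" where
  "sigma_X x = coord x 1 *\<^sub>C ket 0 + coord x 0 *\<^sub>C ket 1"

definition sigma_Z :: "bit ell2 \<Rightarrow> bit ell2" where
  "sigma_Z x = coord x 0 *\<^sub>C ket 0 - coord x 1 *\<^sub>C ket 1"

definition f1 :: "real \<Rightarrow> real" where "f1 p = sqrt (p * (-2 + 5 * p)) / (1 - 3 * p)"
definition g1 :: "real \<Rightarrow> real" where "g1 p = (1 - 2 * p) / (-1 + 3 * p)"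
definition f2 :: "real \<Rightarrow> real" where "f2 p = - sqrt ((-2 + 5 * p) / (-2 + 6 * p))"
definition g2 :: "real \<Rightarrow> real" where "g2 p = sqrt (p / (-2 + 6 * p))"

text \<open>
  The inverse of the tangent with values in \<open>(0, \<pi>)\<close>, for nonzero arguments. This is the branch
  of the arctangent needed in the formula for the angle \<open>\<theta>\<close>: it coincides with the principal
  branch for \<open>p > 1/2\<close>, where \<open>f1 p / g1 p > 0\<close>, and makes \<open>\<theta>\<close> continuous, with value \<open>- \<pi>/4\<close>,
  at \<open>p = 1/2\<close>. With the principal branch for \<open>p < 1/2\<close>, where \<open>f1 p / g1 p < 0\<close>, the angle
  would be off by \<open>\<pi>/2\<close> and the strategy below would not attain the quantum maximum.
\<close>

definition arctan_pos :: "real \<Rightarrow> real" where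
  "arctan_pos t = (if 0 < t then arctan t else arctan t + pi)"

definition theta :: "real \<Rightarrow> real" where
  "theta p = (if p = 1 / 2 then - pi / 4 else 1 / 2 * arctan_pos (f1 p / g1 p) - pi / 2)"

definition phi :: "real \<Rightarrow> real" where
  "phi p = (if p = 1 / 2 then - pi / 4 else arctan (f2 p / g2 p))"

definition psi_theta :: "real \<Rightarrow> (bit \<times> bit) ell2" where
  "psi_theta \<theta> = cos \<theta> *\<^sub>R (ket 0 \<otimes>\<^sub>v ket 0) + sin \<theta> *\<^sub>R (ket 1 \<otimes>\<^sub>v ket 1)"

definition obs_A :: "bit \<Rightarrow> bit ell2 \<Rightarrow> bit ell2" where
  "obs_A x = (if x = 0 then sigma_X else sigma_Z)"

definition obs_B :: "real \<Rightarrow> bit \<Rightarrow> bit ell2 \<Rightarrow> bit ell2" where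
  "obs_B \<phi> y = (\<lambda>v. (if y = 0 then cos \<phi> else - cos \<phi>) *\<^sub>R sigma_Z v + sin \<phi> *\<^sub>R sigma_X v)"


section \<open>Self-testing\<close>

text \<open>
  The reordering of tensor factors that groups the two qubits first:
  \<open>((Q1 \<otimes> A') \<otimes> (Q2 \<otimes> B')) \<otimes> E\<close> versus \<open>(Q1 \<otimes> Q2) \<otimes> ((A' \<otimes> B') \<otimes> E)\<close>.
\<close>

definition reorder ::
  "(('q \<times> 'r) \<times> (('a \<times> 'b) \<times> 'e)) ell2 \<Rightarrow> ((('q \<times> 'a) \<times> ('r \<times> 'b)) \<times> 'e) ell2" where
  "reorder = reindex (\<lambda>(((q, i), (r, j)), e). ((q, r), ((i, j), e)))"

definition op_or_id :: "(bit \<Rightarrow> 'a ell2 \<Rightarrow> 'a ell2) \<Rightarrow> bit option \<Rightarrow> 'a ell2 \<Rightarrow> 'a ell2" where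
  "op_or_id A k = (case k of None \<Rightarrow> id | Some x \<Rightarrow> A x)"

text \<open>
  \<open>self_test_extraction \<Psi> A B \<psi> A' B'\<close>: local isometries map \<open>\<Psi>\<close>, and the action of the
  observables \<open>A\<close>, \<open>B\<close> on it, to the two-qubit vector \<open>\<psi>\<close> and the observables \<open>A'\<close>, \<open>B'\<close>,
  tensored with a fixed unit vector \<open>\<xi>\<close>. The indices \<open>s\<close> and \<open>r\<close> select the identity
  operator or one of the two observables.

  The auxiliary space of the first party is taken over \<open>bit \<times> 'a\<close>, and similarly for the second.
  This is no restriction compared with arbitrary auxiliary spaces: the range of an isometry from
  \<open>'a ell2\<close> into \<open>bit ell2 \<otimes> H\<close> lies in \<open>bit ell2 \<otimes> H0\<close> for a closed subspace \<open>H0\<close> of \<open>H\<close>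
  whose dimension is at most twice that of \<open>'a ell2\<close>.
\<close>

definition self_test_extraction ::
  "(('a \<times> 'b) \<times> 'e) ell2 \<Rightarrow> (bit \<Rightarrow> 'a ell2 \<Rightarrow> 'a ell2) \<Rightarrow> (bit \<Rightarrow> 'b ell2 \<Rightarrow> 'b ell2) \<Rightarrow>
   (bit \<times> bit) ell2 \<Rightarrow> (bit \<Rightarrow> bit ell2 \<Rightarrow> bit ell2) \<Rightarrow> (bit \<Rightarrow> bit ell2 \<Rightarrow> bit ell2) \<Rightarrow> bool" where
  "self_test_extraction \<Psi> A B \<psi> A' B' \<longleftrightarrow>
     (\<exists>(VA :: 'a ell2 \<Rightarrow> (bit \<times> (bit \<times> 'a)) ell2) (VB :: 'b ell2 \<Rightarrow> (bit \<times> (bit \<times> 'b)) ell2)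
        (\<xi> :: (((bit \<times> 'a) \<times> (bit \<times> 'b)) \<times> 'e) ell2).
        isometry VA \<and> isometry VB \<and> norm \<xi> = 1 \<and>
        (\<forall>s r. ((VA \<otimes>\<^sub>o VB) \<otimes>\<^sub>o id) (((op_or_id A s \<otimes>\<^sub>o op_or_id B r) \<otimes>\<^sub>o id) \<Psi>) =
               reorder (((op_or_id A' s \<otimes>\<^sub>o op_or_id B' r) \<psi>) \<otimes>\<^sub>v \<xi>)))"

end

theory Submission
  imports Defs
begin

text \<open>
  Put \<open>c = (1 - p) / p\<close>, \<open>S = B\<^sub>0 + B\<^sub>1\<close> and \<open>D = B\<^sub>0 - B\<^sub>1\<close>, so that \<open>S\<^sup>2 + D\<^sup>2 = 4\<close>, \<open>S D = - D S\<close>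
  and the Bell operator is \<open>A\<^sub>0 S + c A\<^sub>1 D - (1 - c) D\<close>. With \<open>c = 2 - 2 R\<^sup>2\<close>, the number \<open>2 / R\<close> is
  the claimed quantum maximum, and \<open>2 / R\<close> minus the Bell operator equals
  \<open>L\<^sup>* L / (4 R) + (c / (2 R)) (A\<^sub>1 - R D)\<^sup>2\<close> for \<open>L = A\<^sub>0 S - 2 R - (1 - c) D\<close>.
  A strategy attaining the maximum is thus annihilated by \<open>L\<close> and \<open>A\<^sub>1 - R D\<close>. These two relations
  make \<open>R D\<close> and \<open>S / (2 sin \<phi>)\<close> behave as Bob's Pauli operators on the state, and \<open>A\<^sub>0\<close>, \<open>A\<^sub>1\<close>
  anticommute on it, so the swap isometries extract the two-qubit state.
  Mixed states are reduced to vectors by a purification, which Cholesky elimination produces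
  without square roots or the spectral theorem.
\<close>


section \<open>Bounded operators on square-summable families\<close>

text \<open>The obstacle is that the saturation relations hold on the state only: on the whole space
  \<open>Z = R D\<close> and \<open>X = S / (2 sin \<phi>)\<close> need not be involutions, so Bob's
  swap map need not be an isometry. Instead of repairing it by a polar decomposition, the proof
  splits Bob's space by the projector onto the kernel of \<open>Z\<^sup>2 - 1\<close>. The swap acts
  on that kernel, and the complement is parked behind a flag qubit, which accounts for the extra
  \<open>bit\<close> in the auxiliary space \<open>bit \<times> 'b\<close>. The algebra is written
  for two commuting families on one Hilbert space rather than for tensor products. The same locales
  can then be read globally, on the purified state, and for either party alone, the other party's
  observables being replaced by the identity. This is how identities that hold for the global state
  become statements about local isometries.\<close>

lemma cinner_add_right: "cinner x (y + z) = cinner x y + cinner x z"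
  by (metis cinner_add_left cinner_commute complex_cnj_add)

lemma cinner_scaleC_right: "cinner x (c *\<^sub>C y) = c * cinner x y"
  by (metis cinner_commute cinner_scaleC_left complex_cnj_cnj complex_cnj_mult)

lemma scaleC_minus1: "(-1) *\<^sub>C x = - x"
  by (rule coord_eqI) simp

lemma cinner_minus_left: "cinner (- x) y = - cinner x y"
  using cinner_scaleC_left[of "-1" x y] by (simp add: scaleC_minus1)

lemma cinner_minus_right: "cinner x (- y) = - cinner x y"
  using cinner_scaleC_right[of x "-1" y] by (simp add: scaleC_minus1)

lemma cinner_diff_left: "cinner (x - y) z = cinner x z - cinner y z"
  using cinner_add_left[of x "- y" z] by (simp add: cinner_minus_left)

lemma cinner_diff_right: "cinner x (y - z) = cinner x y - cinner x z"
  using cinner_add_right[of x y "- z"] by (simp add: cinner_minus_right)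

lemma cinner_scaleR_left: "cinner (r *\<^sub>R x) y = complex_of_real r * cinner x y"
  by (simp add: scaleR_scaleC cinner_scaleC_left)

lemma cinner_scaleR_right: "cinner x (r *\<^sub>R y) = complex_of_real r * cinner x y"
  by (simp add: scaleR_scaleC cinner_scaleC_right)

lemma cinner_zero_left [simp]: "cinner 0 x = 0"
  using cinner_scaleC_left[of 0 0 x] by (simp add: cinner_def)

lemma cinner_zero_right [simp]: "cinner x 0 = 0"
  by (simp add: cinner_def)

lemmas cinner_simps =
  cinner_add_left cinner_add_right cinner_diff_left cinner_diff_right cinner_minus_left
  cinner_minus_right cinner_scaleC_left cinner_scaleC_right cinner_scaleR_left cinner_scaleR_right

lemma cinner_self_norm: "cinner x x = complex_of_real ((norm x)\<^sup>2)"
  by (metis cinner_self infsumI norm_sq_has_sum)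

lemma cinner_ket_left: "cinner (ket i) x = coord x i"
proof -
  have "cinner (ket i) x = (\<Sum>\<^sub>\<infinity>j\<in>{i}. coord x j)"
    unfolding cinner_def by (rule infsum_cong_neutral) (auto simp: coord_ket)
  then show ?thesis by simp
qed

lemma cinner_ket_right: "cinner x (ket i) = cnj (coord x i)"
  by (metis cinner_commute cinner_ket_left)

lemma norm_ket [simp]: "norm (ket i) = 1"
  by (simp add: norm_ell2_def cinner_ket_left coord_ket)

lemma norm_scaleC: "norm (c *\<^sub>C x) = cmod c * norm x"
proof -
  have "cinner (c *\<^sub>C x) (c *\<^sub>C x) = complex_of_real ((cmod c)\<^sup>2) * cinner x x"
    by (simp only: cinner_scaleC_left cinner_scaleC_right complex_norm_square)
      (simp add: mult_ac)
  then have "complex_of_real ((norm (c *\<^sub>C x))\<^sup>2) = complex_of_real ((cmod c * norm x)\<^sup>2)"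
    by (simp add: cinner_self_norm power_mult_distrib)
  then have "(norm (c *\<^sub>C x))\<^sup>2 = (cmod c * norm x)\<^sup>2"
    by (simp only: of_real_eq_iff)
  then show ?thesis
    by (rule power2_eq_imp_eq) simp_all
qed

text \<open>Multiplying \<open>y\<close> by a phase makes the inner product real and nonnegative;
  the inequality for the real inner product \<open>Re (cinner x y)\<close> then applies.\<close>

lemma cinner_cauchy_schwarz: "cmod (cinner x y) \<le> norm x * norm y"
proof (cases "cinner x y = 0")
  case False
  define u where "u = cnj (cinner x y) / cmod (cinner x y)"
  have u: "cmod u = 1"
    using False by (simp add: u_def norm_divide)
  have "u * cinner x y = complex_of_real (cmod (cinner x y))"
    using False complex_norm_square[of "cinner x y"]
    by (simp add: u_def power2_eq_square mult.commute field_simps)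
  then have "cmod (cinner x y) = Re (cinner x (u *\<^sub>C y))"
    by (simp add: cinner_scaleC_right)
  also have "\<dots> \<le> norm x * norm (u *\<^sub>C y)"
    using norm_cauchy_schwarz[of x "u *\<^sub>C y"] by (simp add: inner_ell2_def)
  finally show ?thesis
    using u by (simp add: norm_scaleC)
qed simp

lemma norm_coord_le: "cmod (coord x i) \<le> norm x"
  using cinner_cauchy_schwarz[of "ket i" x] by (simp add: cinner_ket_left)

lemma bounded_linear_cinner_right: "bounded_linear (cinner x)"
  by (rule bounded_linear_intro[where K = "norm x"])
    (simp_all add: cinner_simps scaleR_conv_of_real cinner_cauchy_schwarz mult.commute[of _ "norm x"])

lemma bounded_clinear_bounded_linear: "bounded_clinear S \<Longrightarrow> bounded_linear S"
  by (simp add: bounded_clinear_def)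

lemma bounded_clinear_simps:
  assumes "bounded_clinear S"
  shows "S (x + y) = S x + S y" "S (x - y) = S x - S y" "S (- x) = - S x" "S 0 = 0"
    "S (c *\<^sub>C x) = c *\<^sub>C S x" "S (r *\<^sub>R x) = r *\<^sub>R S x"
  using assms by (auto simp: bounded_clinear_def linear_simps)

lemma bounded_clinear_id [simp]: "bounded_clinear id"
  by (rule bounded_clinearI[where K = 1]) simp_all

lemma bounded_clinear_ident [simp]: "bounded_clinear (\<lambda>x. x)"
  by (rule bounded_clinearI[where K = 1]) simp_all

lemma bounded_clinear_zero [simp]: "bounded_clinear (\<lambda>x. 0)"
  by (rule bounded_clinearI[where K = 1]) (auto intro: coord_eqI)

lemma scaleC_add_right: "c *\<^sub>C (x + y) = c *\<^sub>C x + c *\<^sub>C y"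
  and scaleC_diff_right: "c *\<^sub>C (x - y) = c *\<^sub>C x - c *\<^sub>C y"
  and scaleC_add_left: "(c + d) *\<^sub>C x = c *\<^sub>C x + d *\<^sub>C x"
  and scaleC_scaleC: "c *\<^sub>C d *\<^sub>C x = (c * d) *\<^sub>C x"
  and scaleC_zero_left [simp]: "0 *\<^sub>C x = 0"
  and scaleC_zero_right [simp]: "c *\<^sub>C 0 = 0"
  by (rule coord_eqI; simp add: algebra_simps)+

lemma bounded_clinear_add:
  assumes "bounded_clinear S" "bounded_clinear R"
  shows "bounded_clinear (\<lambda>x. S x + R x)"
  using assms by (auto simp: bounded_clinear_def bounded_linear_add scaleC_add_right)

lemma bounded_clinear_diff:
  assumes "bounded_clinear S" "bounded_clinear R"
  shows "bounded_clinear (\<lambda>x. S x - R x)"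
  using assms by (auto simp: bounded_clinear_def bounded_linear_sub scaleC_diff_right)

lemma bounded_clinear_scaleC:
  assumes "bounded_clinear S"
  shows "bounded_clinear (\<lambda>x. c *\<^sub>C S x)"
proof -
  have "bounded_clinear (\<lambda>x. c *\<^sub>C x)"
    by (rule bounded_clinearI[where K = "cmod c"])
      (simp_all add: scaleC_add_right scaleC_scaleC norm_scaleC mult.commute)
  then show ?thesis
    using bounded_clinear_compose assms by blast
qed

lemma bounded_clinear_scaleR: "bounded_clinear S \<Longrightarrow> bounded_clinear (\<lambda>x. r *\<^sub>R S x)"
  by (simp add: scaleR_scaleC bounded_clinear_scaleC)

lemma bounded_clinear_cinner_scaleC: "bounded_clinear (\<lambda>x. cinner u x *\<^sub>C v)"
proof (rule bounded_clinearI[where K = "norm u * norm v"])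
  show "norm (cinner u x *\<^sub>C v) \<le> norm x * (norm u * norm v)" for x
    using mult_right_mono[OF cinner_cauchy_schwarz[of u x] norm_ge_zero[of v]]
    by (simp add: norm_scaleC mult_ac)
qed (simp_all add: cinner_simps scaleC_add_left scaleC_scaleC)

lemma bounded_clinear_coord: "bounded_clinear (\<lambda>x. coord x i *\<^sub>C v)"
  using bounded_clinear_cinner_scaleC[of "ket i" v] by (simp add: cinner_ket_left)

lemmas bounded_clinear_intros =
  bounded_clinear_id bounded_clinear_ident bounded_clinear_zero bounded_clinear_add
  bounded_clinear_diff bounded_clinear_scaleC bounded_clinear_scaleR bounded_clinear_coord

lemma cinner_eqI_right:
  assumes "bounded_clinear S" "bounded_clinear R"
    and eq: "\<And>j. cinner u (S (ket j)) = cinner v (R (ket j))"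
  shows "cinner u (S y) = cinner v (R y)"
proof -
  have "((\<lambda>i. cinner u (S (coord y i *\<^sub>C ket i))) has_sum cinner u (S y)) UNIV"
    by (intro has_sum_bounded_linear[OF bounded_linear_cinner_right]
        has_sum_bounded_linear[OF bounded_clinear_bounded_linear[OF assms(1)]] ell2_has_sum_ket)
  moreover have "((\<lambda>i. cinner v (R (coord y i *\<^sub>C ket i))) has_sum cinner v (R y)) UNIV"
    by (intro has_sum_bounded_linear[OF bounded_linear_cinner_right]
        has_sum_bounded_linear[OF bounded_clinear_bounded_linear[OF assms(2)]] ell2_has_sum_ket)
  ultimately show ?thesis
    by (simp add: bounded_clinear_simps[OF assms(1)] bounded_clinear_simps[OF assms(2)]
        cinner_simps eq has_sum_unique)
qed

text \<open>Bounded sesquilinear forms are determined by their matrix entries: basis expansions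
  converge, so the entries fix the form first in one argument and, after conjugation, in the
  other.\<close>

lemma cinner_eqI:
  assumes "bounded_clinear S1" "bounded_clinear R1" "bounded_clinear S2" "bounded_clinear R2"
    and eq: "\<And>i j. cinner (S1 (ket i)) (R1 (ket j)) = cinner (S2 (ket i)) (R2 (ket j))"
  shows "cinner (S1 x) (R1 y) = cinner (S2 x) (R2 y)"
proof (rule cinner_eqI_right[OF assms(2,4)])
  fix j
  have "cinner (R1 (ket j)) (S1 x) = cinner (R2 (ket j)) (S2 x)"
    by (rule cinner_eqI_right[OF assms(1,3)]) (metis eq cinner_commute)
  then show "cinner (S1 x) (R1 (ket j)) = cinner (S2 x) (R2 (ket j))"
    by (metis cinner_commute)
qed

lemma bounded_clinear_eqI_tensor:
  assumes "bounded_clinear S" "bounded_clinear R" "\<And>x y. S (x \<otimes>\<^sub>v y) = R (x \<otimes>\<^sub>v y)"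
  shows "S = R"
proof (rule bounded_clinear_eqI[OF assms(1,2)])
  show "S (ket i) = R (ket i)" for i
    using assms(3) by (cases i) (simp flip: ket_tensor)
qed

lemma bounded_clinear_eqI_tensor2:
  assumes "bounded_clinear S" "bounded_clinear R"
    and "\<And>x y z. S ((x \<otimes>\<^sub>v y) \<otimes>\<^sub>v z) = R ((x \<otimes>\<^sub>v y) \<otimes>\<^sub>v z)"
  shows "S = R"
proof (rule bounded_clinear_eqI[OF assms(1,2)])
  show "S (ket i) = R (ket i)" for i
  proof (cases i)
    case (Pair jk l)
    then show ?thesis
      using assms(3) by (cases jk) (simp flip: ket_tensor)
  qed
qed

section \<open>Tensor products of vectors and operators\<close>

lemma tensor_add_left: "(x + y) \<otimes>\<^sub>v z = x \<otimes>\<^sub>v z + y \<otimes>\<^sub>v z"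
  and tensor_add_right: "z \<otimes>\<^sub>v (x + y) = z \<otimes>\<^sub>v x + z \<otimes>\<^sub>v y"
  and tensor_diff_left: "(x - y) \<otimes>\<^sub>v z = x \<otimes>\<^sub>v z - y \<otimes>\<^sub>v z"
  and tensor_diff_right: "z \<otimes>\<^sub>v (x - y) = z \<otimes>\<^sub>v x - z \<otimes>\<^sub>v y"
  and tensor_minus_left: "(- x) \<otimes>\<^sub>v z = - (x \<otimes>\<^sub>v z)"
  and tensor_minus_right: "z \<otimes>\<^sub>v (- x) = - (z \<otimes>\<^sub>v x)"
  and tensor_scaleC_left: "(c *\<^sub>C x) \<otimes>\<^sub>v z = c *\<^sub>C (x \<otimes>\<^sub>v z)"
  and tensor_scaleC_right: "z \<otimes>\<^sub>v (c *\<^sub>C x) = c *\<^sub>C (z \<otimes>\<^sub>v x)"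
  and tensor_scaleR_left: "(r *\<^sub>R x) \<otimes>\<^sub>v z = r *\<^sub>R (x \<otimes>\<^sub>v z)"
  and tensor_scaleR_right: "z \<otimes>\<^sub>v (r *\<^sub>R x) = r *\<^sub>R (z \<otimes>\<^sub>v x)"
  and tensor_zero_left: "0 \<otimes>\<^sub>v z = 0"
  and tensor_zero_right: "z \<otimes>\<^sub>v 0 = 0"
  by (rule coord_eqI; simp add: algebra_simps split_paired_all tensor.rep_eq split: prod.split)+

lemmas tensor_simps =
  tensor_add_left tensor_add_right tensor_diff_left tensor_diff_right tensor_minus_left
  tensor_minus_right tensor_scaleC_left tensor_scaleC_right tensor_scaleR_left
  tensor_scaleR_right tensor_zero_left tensor_zero_right

lemma cinner_tensor: "cinner (x \<otimes>\<^sub>v y) (x' \<otimes>\<^sub>v y') = cinner x x' * cinner y y'"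
proof -
  have "cinner (x \<otimes>\<^sub>v y) (x' \<otimes>\<^sub>v y') = (\<Sum>\<^sub>\<infinity>(i, j)\<in>UNIV \<times> UNIV.
      (cnj (coord x i) * coord x' i) * (cnj (coord y j) * coord y' j))"
    unfolding cinner_def by (simp add: split_def tensor.rep_eq mult_ac)
  also have "\<dots> = (\<Sum>\<^sub>\<infinity>i. \<Sum>\<^sub>\<infinity>j.
      (cnj (coord x i) * coord x' i) * (cnj (coord y j) * coord y' j))"
    using infsum_Sigma'_banach[of "\<lambda>i j. (cnj (coord x i) * coord x' i) * (cnj (coord y j) * coord y' j)"
        UNIV "\<lambda>_. UNIV"] cinner_summable[of "x \<otimes>\<^sub>v y" "x' \<otimes>\<^sub>v y'"]
    by (simp add: split_def tensor.rep_eq mult_ac)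
  also have "\<dots> = cinner x x' * cinner y y'"
    unfolding cinner_def by (simp add: infsum_cmult_right' infsum_cmult_left')
  finally show ?thesis .
qed

lemma norm_tensor: "norm (x \<otimes>\<^sub>v y) = norm x * norm y"
proof -
  have "complex_of_real ((norm (x \<otimes>\<^sub>v y))\<^sup>2) = complex_of_real ((norm x * norm y)\<^sup>2)"
    by (simp only: power_mult_distrib of_real_mult cinner_tensor flip: cinner_self_norm)
  then have "(norm (x \<otimes>\<^sub>v y))\<^sup>2 = (norm x * norm y)\<^sup>2"
    by (simp only: of_real_eq_iff)
  then show ?thesis
    by (rule power2_eq_imp_eq) simp_all
qed

lemma bounded_clinear_tensor_right: "bounded_clinear S \<Longrightarrow> bounded_clinear (\<lambda>x. z \<otimes>\<^sub>v S x)"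
  by (rule bounded_clinear_compose[of "\<lambda>x. z \<otimes>\<^sub>v x" S],
      rule bounded_clinearI[where K = "norm z"]) (simp_all add: tensor_simps norm_tensor)

lemma tensor_op:
  assumes "bounded_clinear S" "bounded_clinear R"
  shows bounded_clinear_tensor_op: "bounded_clinear (S \<otimes>\<^sub>o R)"
    and tensor_op_tensor: "(S \<otimes>\<^sub>o R) (x \<otimes>\<^sub>v y) = S x \<otimes>\<^sub>v R y"
  using theI'[OF tensor_op_unique[OF assms]] unfolding tensor_op_def by blast+

lemma tensor_op_eqI:
  assumes "bounded_clinear S" "bounded_clinear R" "bounded_clinear U"
    and "\<And>x y. U (x \<otimes>\<^sub>v y) = S x \<otimes>\<^sub>v R y"
  shows "S \<otimes>\<^sub>o R = U"
  by (rule bounded_clinear_eqI_tensor) (use assms in \<open>simp_all add: tensor_op\<close>)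

lemma tensor_op_id: "id \<otimes>\<^sub>o id = id"
  by (rule tensor_op_eqI) simp_all

lemma tensor_op_self_adjoint:
  assumes "bounded_clinear S" "bounded_clinear R"
    and "\<And>x y. cinner x (S y) = cinner (S x) y" "\<And>x y. cinner x (R y) = cinner (R x) y"
  shows "cinner x ((S \<otimes>\<^sub>o R) y) = cinner ((S \<otimes>\<^sub>o R) x) y"
proof (rule cinner_eqI[of "\<lambda>x. x" _ "S \<otimes>\<^sub>o R" "\<lambda>x. x"])
  show "cinner (ket i) ((S \<otimes>\<^sub>o R) (ket j)) = cinner ((S \<otimes>\<^sub>o R) (ket i)) (ket j)" for i j
    by (cases i; cases j) (simp add: tensor_op assms cinner_tensor flip: ket_tensor)
qed (simp_all add: tensor_op assms)

text \<open>This is \<open>h\<close> contracted with \<open>ket j\<close> in its second factor: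
  column \<open>j\<close> of \<open>h\<close> read as a matrix. Operators on the first factor act
  column by column, which reduces tensor identities to a single factor.\<close>

definition slice :: "('a \<times> 'b) ell2 \<Rightarrow> 'b \<Rightarrow> 'a ell2" where
  "slice h j = Abs_ell2 (\<lambda>i. coord h (i, j))"

lemma coord_slice: "coord (slice h j) i = coord h (i, j)"
proof -
  have "(\<lambda>ij. (cmod (coord h ij))\<^sup>2) summable_on (\<lambda>i. (i, j)) ` UNIV"
    by (rule summable_on_subset_banach[OF summable_coord]) simp
  then have "(\<lambda>i. (cmod (coord h (i, j)))\<^sup>2) summable_on UNIV"
    by (subst (asm) summable_on_reindex) (auto simp: inj_on_def o_def)
  then show ?thesis by (simp add: slice_def coord_Abs)
qed

lemma cinner_tensor_ket: "cinner (x \<otimes>\<^sub>v ket j) h = cinner x (slice h j)"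
proof -
  have "cinner (x \<otimes>\<^sub>v ket j) h
      = (\<Sum>\<^sub>\<infinity>ij\<in>(\<lambda>i. (i, j)) ` UNIV. cnj (coord x (fst ij)) * coord h ij)"
    unfolding cinner_def
    by (rule infsum_cong_neutral) (auto simp: coord_ket split: if_splits)
  also have "\<dots> = cinner x (slice h j)"
    unfolding cinner_def by (subst infsum_reindex) (auto simp: inj_on_def o_def coord_slice)
  finally show ?thesis .
qed

text \<open>Cauchy-Schwarz for \<open>h\<close> and
  \<open>slice h j \<otimes>\<^sub>v ket j\<close>, whose inner product is the squared norm of the
  slice.\<close>

lemma norm_slice_le: "norm (slice h j) \<le> norm h"
proof -
  have "(norm (slice h j))\<^sup>2 = cmod (cinner (slice h j \<otimes>\<^sub>v ket j) h)"
    by (simp add: cinner_tensor_ket cinner_self_norm norm_power)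
  also have "\<dots> \<le> norm (slice h j) * norm h"
    using cinner_cauchy_schwarz[of "slice h j \<otimes>\<^sub>v ket j" h] by (simp add: norm_tensor)
  finally show ?thesis
    by (cases "norm (slice h j) = 0") (simp_all add: power2_eq_square)
qed

lemma bounded_clinear_slice: "bounded_clinear (\<lambda>h. slice h j)"
  by (rule bounded_clinearI[where K = 1])
    (auto intro: coord_eqI simp: coord_slice norm_slice_le)

lemma slice_tensor: "slice (x \<otimes>\<^sub>v y) j = coord y j *\<^sub>C x"
  by (rule coord_eqI) (simp add: coord_slice)

lemma slice_tensor_op:
  assumes "bounded_clinear S"
  shows "slice ((S \<otimes>\<^sub>o id) h) j = S (slice h j)"
proof -
  have "(\<lambda>h. slice ((S \<otimes>\<^sub>o id) h) j) = (\<lambda>h. S (slice h j))"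
    by (rule bounded_clinear_eqI_tensor)
      (use assms in \<open>simp_all add: bounded_clinear_compose[OF bounded_clinear_slice] tensor_op
        bounded_clinear_compose[OF _ bounded_clinear_slice] slice_tensor bounded_clinear_simps\<close>)
  then show ?thesis by meson
qed

lemma slice_eqI: "(\<And>j. slice g j = slice h j) \<Longrightarrow> g = h"
  by (rule coord_eqI) (metis coord_slice surj_pair)


section \<open>Completeness and kernel projectors\<close>

lemma norm_le_finite_sums:
  assumes "\<And>F. finite F \<Longrightarrow> (\<Sum>i\<in>F. (cmod (coord x i))\<^sup>2) \<le> b\<^sup>2" "0 \<le> b"
  shows "norm x \<le> b"
proof -
  have "(norm x)\<^sup>2 \<le> b\<^sup>2"
    by (rule has_sum_le_finite_sums[OF norm_sq_has_sum]) (use assms(1) in auto)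
  then show ?thesis
    using assms(2) by (rule power2_le_imp_le)
qed

lemma sum_coord_le_norm: "finite F \<Longrightarrow> (\<Sum>i\<in>F. (cmod (coord x i))\<^sup>2) \<le> (norm x)\<^sup>2"
  by (rule finite_sum_le_has_sum[OF norm_sq_has_sum]) auto

text \<open>Completeness lets \<open>kernel_projector_exists\<close> take a limit of operator
  powers. The coordinates converge to some \<open>f\<close>; bounds on finite partial sums survive
  the limit and give both square-summability of \<open>f\<close> and convergence in norm.\<close>

instance ell2 :: (type) complete_space
proof
  fix X :: "nat \<Rightarrow> 'a ell2"
  assume X: "Cauchy X"
  obtain B where B: "\<And>n. norm (X n) \<le> B"
    using cauchy_imp_bounded[OF X] by (auto simp: bounded_iff)
  have "0 \<le> B"
    using B[of 0] norm_ge_zero order_trans by blast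
  have "Cauchy (\<lambda>n. coord (X n) i)" for i
  proof (rule CauchyI)
    fix e :: real
    assume "0 < e"
    then obtain M where M: "\<forall>m\<ge>M. \<forall>n\<ge>M. norm (X m - X n) < e"
      using CauchyD[OF X] by blast
    then show "\<exists>M. \<forall>m\<ge>M. \<forall>n\<ge>M. norm (coord (X m) i - coord (X n) i) < e"
      by (metis coord_simps(4) le_less_trans norm_coord_le)
  qed
  then have "\<exists>l. (\<lambda>n. coord (X n) i) \<longlonglongrightarrow> l" for i
    by (simp add: Cauchy_convergent_iff convergent_def)
  then obtain f where f: "\<And>i. (\<lambda>n. coord (X n) i) \<longlonglongrightarrow> f i"
    by metis
  \<comment> \<open>Used twice: with \<open>c\<close> constantly 0 for square-summability, and with
    \<open>c = coord (X m)\<close> for the distance to the limit.\<close>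
  have f_le: "(\<Sum>i\<in>F. (cmod (c i - f i))\<^sup>2) \<le> b"
    if "\<And>n. n \<ge> N \<Longrightarrow> (\<Sum>i\<in>F. (cmod (c i - coord (X n) i))\<^sup>2) \<le> b" for F b c N
  proof (rule tendsto_upperbound)
    show "(\<lambda>n. \<Sum>i\<in>F. (cmod (c i - coord (X n) i))\<^sup>2) \<longlonglongrightarrow> (\<Sum>i\<in>F. (cmod (c i - f i))\<^sup>2)"
      by (intro tendsto_sum tendsto_power tendsto_norm tendsto_diff tendsto_const f)
    show "\<forall>\<^sub>F n in sequentially. (\<Sum>i\<in>F. (cmod (c i - coord (X n) i))\<^sup>2) \<le> b"
      using that by (auto simp: eventually_sequentially)
  qed simp
  have "(\<Sum>i\<in>F. (cmod (f i))\<^sup>2) \<le> B\<^sup>2" if "finite F" for F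
  proof -
    have "(\<Sum>i\<in>F. (cmod (0 - f i))\<^sup>2) \<le> B\<^sup>2"
      by (rule f_le[of 0])
        (use sum_coord_le_norm[OF that] power_mono[OF B norm_ge_zero] order_trans in fastforce)
    then show ?thesis by simp
  qed
  then have "(\<lambda>i. (cmod (f i))\<^sup>2) summable_on UNIV"
    by (intro nonneg_bounded_partial_sums_imp_summable_on[where C = "B\<^sup>2"])
      (auto intro: eventually_finite_subsets_at_top_weakI)
  then have coord_f: "coord (Abs_ell2 f) = f"
    by (rule coord_Abs)
  have "X \<longlonglongrightarrow> Abs_ell2 f"
  proof (rule LIMSEQ_I)
    fix e :: real
    assume "0 < e"
    then obtain M where M: "\<And>m n. m \<ge> M \<Longrightarrow> n \<ge> M \<Longrightarrow> norm (X m - X n) < e / 2"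
      using CauchyD[OF X, of "e / 2"] by auto
    have "norm (X m - Abs_ell2 f) \<le> e / 2" if "m \<ge> M" for m
    proof (rule norm_le_finite_sums)
      fix F :: "'a set"
      assume "finite F"
      have "(\<Sum>i\<in>F. (cmod (coord (X m) i - f i))\<^sup>2) \<le> (e / 2)\<^sup>2"
      proof (rule f_le[of M])
        fix n
        assume "n \<ge> M"
        then have "(norm (X m - X n))\<^sup>2 \<le> (e / 2)\<^sup>2"
          using M[OF that] by (intro power_mono) (auto intro: less_imp_le)
        then show "(\<Sum>i\<in>F. (cmod (coord (X m) i - coord (X n) i))\<^sup>2) \<le> (e / 2)\<^sup>2"
          using sum_coord_le_norm[OF \<open>finite F\<close>, of "X m - X n"] by simp
      qed
      then show "(\<Sum>i\<in>F. (cmod (coord (X m - Abs_ell2 f) i))\<^sup>2) \<le> (e / 2)\<^sup>2"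
        by (simp add: coord_f)
    qed (use \<open>0 < e\<close> in simp)
    then have "norm (X m - Abs_ell2 f) < e" if "m \<ge> M" for m
      using that \<open>0 < e\<close> by (smt (verit) field_sum_of_halves)
    then show "\<exists>no. \<forall>n\<ge>no. norm (X n - Abs_ell2 f) < e"
      by blast
  qed
  then show "convergent X"
    by (rule convergentI)
qed

lemma bounded_clinear_funpow:
  fixes Q :: "'a ell2 \<Rightarrow> 'a ell2"
  assumes "bounded_clinear Q"
  shows "bounded_clinear (Q ^^ n)"
proof (induction n)
  case (Suc n)
  then show ?case
    using assms by (simp add: comp_def bounded_clinear_compose)
qed (simp add: id_def)

text \<open>With \<open>a n\<close> the squared norm of \<open>(Q ^^ n) x\<close>, self-adjointness
  turns the squared distance of two even powers into
  \<open>a (2 * m) - 2 * a (m + n) + a (2 * n)\<close>. As \<open>a\<close> decreases to a limit,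
  the sequence is Cauchy. Even powers avoid the alternating sign that an eigenvalue -1 of
  \<open>Q\<close> would produce.\<close>

lemma self_adjoint_contraction_powers_converge:
  assumes Q: "bounded_clinear Q" and sa: "\<And>x y. cinner x (Q y) = cinner (Q x) y"
    and contr: "\<And>x. norm (Q x) \<le> norm x"
  shows "convergent (\<lambda>n. (Q ^^ (2 * n)) x)"
proof -
  have shift: "cinner ((Q ^^ m) u) ((Q ^^ n) v) = cinner u ((Q ^^ (m + n)) v)" for m n u v
  proof (induction m arbitrary: n)
    case (Suc m)
    show ?case
      using Suc[of "Suc n"] by (simp add: sa[symmetric])
  qed simp
  define a where "a n = (norm ((Q ^^ n) x))\<^sup>2" for n
  have cin: "cinner ((Q ^^ m) x) ((Q ^^ n) x) = complex_of_real (a ((m + n) div 2))"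
    if "even (m + n)" for m n
  proof -
    have "cinner ((Q ^^ m) x) ((Q ^^ n) x) = cinner x ((Q ^^ (m + n)) x)"
      by (rule shift)
    also have "\<dots> = cinner ((Q ^^ ((m + n) div 2)) x) ((Q ^^ ((m + n) div 2)) x)"
      unfolding shift using that by (metis even_two_times_div_two mult_2)
    finally show ?thesis
      by (simp add: cinner_self_norm a_def)
  qed
  have "decseq a"
    by (rule decseq_SucI) (simp add: a_def contr power_mono)
  moreover have "a n \<ge> 0" for n
    by (simp add: a_def)
  ultimately obtain L where L: "a \<longlonglongrightarrow> L"
    using decseq_convergent by blast
  have dist_sq: "(norm ((Q ^^ (2 * m)) x - (Q ^^ (2 * n)) x))\<^sup>2
      = a (2 * m) - 2 * a (m + n) + a (2 * n)" for m n
  proof -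
    have "complex_of_real ((norm ((Q ^^ (2 * m)) x - (Q ^^ (2 * n)) x))\<^sup>2)
        = complex_of_real (a (2 * m) - 2 * a (m + n) + a (2 * n))"
      unfolding cinner_self_norm[symmetric]
      by (simp add: cinner_simps cin add.commute)
    then show ?thesis by (simp only: of_real_eq_iff)
  qed
  have "Cauchy (\<lambda>n. (Q ^^ (2 * n)) x)"
  proof (rule CauchyI)
    fix e :: real
    assume "0 < e"
    then obtain M where M: "\<And>n. n \<ge> M \<Longrightarrow> \<bar>a n - L\<bar> < e\<^sup>2 / 4"
      using LIMSEQ_D[OF L, of "e\<^sup>2 / 4"] by auto
    have "norm ((Q ^^ (2 * m)) x - (Q ^^ (2 * n)) x) < e" if "m \<ge> M" "n \<ge> M" for m n
    proof (rule power_less_imp_less_base)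
      show "(norm ((Q ^^ (2 * m)) x - (Q ^^ (2 * n)) x))\<^sup>2 < e\<^sup>2"
        using M[of "2 * m"] M[of "m + n"] M[of "2 * n"] that unfolding dist_sq by linarith
    qed (use \<open>0 < e\<close> in simp)
    then show "\<exists>M. \<forall>m\<ge>M. \<forall>n\<ge>M. norm ((Q ^^ (2 * m)) x - (Q ^^ (2 * n)) x) < e"
      by blast
  qed
  then show ?thesis
    by (rule Cauchy_convergent)
qed

lemma tendsto_scaleC: "X \<longlonglongrightarrow> x \<Longrightarrow> (\<lambda>n. c *\<^sub>C X n) \<longlonglongrightarrow> c *\<^sub>C x"
  using bounded_linear.tendsto[OF bounded_clinear_bounded_linear[OF
        bounded_clinear_scaleC[OF bounded_clinear_ident]]] by blast

lemma tendsto_cinner: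
  assumes "X \<longlonglongrightarrow> x"
  shows "(\<lambda>n. cinner u (X n)) \<longlonglongrightarrow> cinner u x" "(\<lambda>n. cinner (X n) u) \<longlonglongrightarrow> cinner x u"
proof -
  show *: "(\<lambda>n. cinner u (X n)) \<longlonglongrightarrow> cinner u x"
    by (rule bounded_linear.tendsto[OF bounded_linear_cinner_right assms])
  show "(\<lambda>n. cinner (X n) u) \<longlonglongrightarrow> cinner x u"
    using tendsto_cnj[OF *] by (simp only: flip: cinner_commute)
qed

text \<open>The operator \<open>Q = 1 - t w\<^sup>2\<close> fixes the kernel of \<open>w\<close> and
  strictly shrinks every vector outside it, so its even powers converge to the projector onto that
  kernel.\<close>

lemma kernel_projector_exists:
  assumes w: "bounded_clinear w" and sa: "\<And>x y. cinner x (w y) = cinner (w x) y"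
  shows "\<exists>P. projector P \<and> (\<forall>x. w (P x) = 0) \<and> (\<forall>x. w x = 0 \<longrightarrow> P x = x)"
proof -
  obtain K where "0 < K" and K: "\<And>x. norm (w x) \<le> norm x * K"
    using bounded_linear.pos_bounded[OF bounded_clinear_bounded_linear[OF w]] by blast
  \<comment> \<open>This step size makes the second-order term
    \<open>t\<^sup>2 * (norm (w (w x)))\<^sup>2\<close> at most
    \<open>t * (norm (w x))\<^sup>2\<close>, half of the first-order decrease.\<close>
  define t where "t = 1 / K\<^sup>2"
  define Q where "Q x = x - t *\<^sub>R w (w x)" for x
  have Q: "bounded_clinear Q"
    unfolding Q_def by (intro bounded_clinear_intros bounded_clinear_compose[OF w w])
  have Q_sa: "cinner x (Q y) = cinner (Q x) y" for x y
    by (simp add: Q_def cinner_simps sa)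
  have norm_Q: "(norm (Q x))\<^sup>2 \<le> (norm x)\<^sup>2 - t * (norm (w x))\<^sup>2" for x
  proof -
    have "complex_of_real ((norm (Q x))\<^sup>2)
        = complex_of_real ((norm x)\<^sup>2 - 2 * t * (norm (w x))\<^sup>2 + t\<^sup>2 * (norm (w (w x)))\<^sup>2)"
      unfolding cinner_self_norm[symmetric]
      by (simp add: Q_def cinner_simps sa[of x "w x"])
        (simp add: sa[of "w x" x, symmetric] sa[of x] cinner_self_norm algebra_simps power2_eq_square)
    then have "(norm (Q x))\<^sup>2 = (norm x)\<^sup>2 - 2 * t * (norm (w x))\<^sup>2 + t\<^sup>2 * (norm (w (w x)))\<^sup>2"
      by (simp only: of_real_eq_iff)
    moreover have "t\<^sup>2 * (norm (w (w x)))\<^sup>2 \<le> t\<^sup>2 * (norm (w x) * K)\<^sup>2"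
      by (intro mult_left_mono power_mono K) auto
    moreover have "t\<^sup>2 * (norm (w x) * K)\<^sup>2 = t * (norm (w x))\<^sup>2"
      using \<open>0 < K\<close> by (simp add: t_def power2_eq_square field_simps)
    ultimately show ?thesis by linarith
  qed
  have "0 < t"
    using \<open>0 < K\<close> by (simp add: t_def)
  then have "(norm (Q x))\<^sup>2 \<le> (norm x)\<^sup>2" for x
    using norm_Q[of x] mult_nonneg_nonneg[of t "(norm (w x))\<^sup>2"] by (smt (verit) zero_le_power2)
  then have contr: "norm (Q x) \<le> norm x" for x
    by (rule power2_le_imp_le) simp
  define P where "P x = lim (\<lambda>n. (Q ^^ (2 * n)) x)" for x
  have P: "(\<lambda>n. (Q ^^ (2 * n)) x) \<longlonglongrightarrow> P x" for x
    unfolding P_def using self_adjoint_contraction_powers_converge[OF Q Q_sa contr]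
    by (rule convergent_LIMSEQ_iff[THEN iffD1])
  have norm_pow: "norm ((Q ^^ n) x) \<le> norm x" for n x
  proof (induction n)
    case (Suc n)
    then show ?case
      using contr[of "(Q ^^ n) x"] by simp
  qed simp
  note pow = bounded_clinear_simps[OF bounded_clinear_funpow[OF Q]]
  have bc: "bounded_clinear P"
  proof (rule bounded_clinearI[where K = 1])
    show "P (x + y) = P x + P y" for x y
      by (rule LIMSEQ_unique[OF P]) (unfold pow, intro tendsto_add P)
    show "P (c *\<^sub>C x) = c *\<^sub>C P x" for c x
      by (rule LIMSEQ_unique[OF P]) (unfold pow, intro tendsto_scaleC P)
    show "norm (P x) \<le> norm x * 1" for x
      by (rule tendsto_upperbound[OF tendsto_norm[OF P]]) (simp_all add: norm_pow)
  qed
  have pow_sa: "cinner x ((Q ^^ n) y) = cinner ((Q ^^ n) x) y" for n x y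
  proof (induction n arbitrary: x)
    case (Suc n)
    have "cinner x ((Q ^^ Suc n) y) = cinner (Q x) ((Q ^^ n) y)"
      by (simp add: Q_sa)
    also have "\<dots> = cinner ((Q ^^ Suc n) x) y"
      unfolding Suc by (simp add: funpow_swap1)
    finally show ?case .
  qed simp
  have P_sa: "cinner x (P y) = cinner (P x) y" for x y
    by (rule LIMSEQ_unique[OF tendsto_cinner(1)[OF P]])
      (unfold pow_sa, rule tendsto_cinner(2)[OF P])
  \<comment> \<open>Shifting the sequence of even powers by one index applies \<open>Q\<close> twice
    and leaves the limit unchanged.\<close>
  have QQP: "Q (Q (P x)) = P x" for x
  proof (rule LIMSEQ_unique)
    show "(\<lambda>n. (Q ^^ (2 * Suc n)) x) \<longlonglongrightarrow> P x"
      by (rule LIMSEQ_Suc[OF P])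
    have "(\<lambda>n. Q (Q ((Q ^^ (2 * n)) x))) \<longlonglongrightarrow> Q (Q (P x))"
      by (intro bounded_linear.tendsto[OF bounded_clinear_bounded_linear[OF Q]] P)
    then show "(\<lambda>n. (Q ^^ (2 * Suc n)) x) \<longlonglongrightarrow> Q (Q (P x))"
      by simp
  qed
  have "w (P x) = 0" for x
  proof -
    have "norm (P x) \<le> norm (Q (P x))"
      using contr[of "Q (P x)"] by (simp add: QQP)
    then have "(norm (P x))\<^sup>2 \<le> (norm (Q (P x)))\<^sup>2"
      by (intro power_mono) auto
    then have "t * (norm (w (P x)))\<^sup>2 \<le> 0"
      using norm_Q[of "P x"] by linarith
    then show ?thesis
      using \<open>0 < t\<close> by (simp add: mult_le_0_iff)
  qed
  moreover have P_fix: "P x = x" if "w x = 0" for x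
  proof -
    have "Q x = x"
      using that w by (simp add: Q_def bounded_clinear_simps)
    then have "(Q ^^ n) x = x" for n
      by (induction n) simp_all
    then have "(\<lambda>n. (Q ^^ (2 * n)) x) \<longlonglongrightarrow> x"
      by simp
    then show ?thesis
      by (rule LIMSEQ_unique[OF P])
  qed
  \<comment> \<open>Idempotence: \<open>P x\<close> lies in the kernel of \<open>w\<close>, and
    \<open>P\<close> fixes that kernel.\<close>
  ultimately show ?thesis
    using bc P_sa by (intro exI[of _ P]) (simp add: projector_def)
qed


section \<open>Purification of density operators\<close>

definition positive_op :: "('a ell2 \<Rightarrow> 'a ell2) \<Rightarrow> bool" where
  "positive_op \<rho> \<longleftrightarrow> bounded_clinear \<rho> \<and> (\<forall>x. cinner x (\<rho> x) \<in> \<real>\<^sub>\<ge>\<^sub>0)"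

definition qform :: "('a ell2 \<Rightarrow> 'a ell2) \<Rightarrow> 'a ell2 \<Rightarrow> real" where
  "qform \<rho> x = Re (cinner x (\<rho> x))"

lemma positive_op_qform:
  assumes "positive_op \<rho>"
  shows "cinner x (\<rho> x) = complex_of_real (qform \<rho> x)" "0 \<le> qform \<rho> x"
proof -
  have "cinner x (\<rho> x) \<in> \<real>\<^sub>\<ge>\<^sub>0"
    using assms by (simp add: positive_op_def)
  then show "cinner x (\<rho> x) = complex_of_real (qform \<rho> x)" "0 \<le> qform \<rho> x"
    by (simp_all add: qform_def complex_nonneg_Reals_iff complex_eq_iff)
qed

text \<open>Polarization: reality of the form at \<open>x + y\<close> relates the imaginary parts of
  the two off-diagonal entries, reality at \<open>x + \<i> *\<^sub>C y\<close> their real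
  parts.\<close>

lemma positive_op_hermitian:
  assumes "positive_op \<rho>"
  shows "cinner x (\<rho> y) = cinner (\<rho> x) y"
proof -
  have bc: "bounded_clinear \<rho>"
    using assms by (simp add: positive_op_def)
  note q = positive_op_qform(1)[OF assms]
  have "Im (cinner x (\<rho> y) + cinner y (\<rho> x)) = 0"
    using q[of "x + y"] by (simp add: bounded_clinear_simps[OF bc] cinner_simps q complex_eq_iff)
  moreover have "Re (cinner x (\<rho> y) - cinner y (\<rho> x)) = 0"
    using q[of "x + \<i> *\<^sub>C y"]
    by (simp add: bounded_clinear_simps[OF bc] cinner_simps q complex_eq_iff)
  ultimately have "cinner x (\<rho> y) = cnj (cinner y (\<rho> x))"
    by (simp add: complex_eq_iff)
  then show ?thesis
    by (metis cinner_commute)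
qed

text \<open>Evaluating the form at \<open>x - l *\<^sub>C y\<close> with
  \<open>l = t * cnj (cinner x (\<rho> y))\<close> gives a polynomial in the real number
  \<open>t\<close> that is nowhere negative. Its minimum gives the bound; if
  \<open>qform \<rho> y = 0\<close> it is linear, and a large \<open>t\<close> shows that the slope
  is 0.\<close>

lemma positive_op_cauchy_schwarz:
  assumes "positive_op \<rho>"
  shows "(cmod (cinner x (\<rho> y)))\<^sup>2 \<le> qform \<rho> x * qform \<rho> y"
proof -
  have bc: "bounded_clinear \<rho>"
    using assms by (simp add: positive_op_def)
  note q = positive_op_qform[OF assms]
  define m where "m = (cmod (cinner x (\<rho> y)))\<^sup>2"
  have ineq: "0 \<le> qform \<rho> x - 2 * t * m + t\<^sup>2 * m * qform \<rho> y" for t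
  proof -
    define l where "l = complex_of_real t * cnj (cinner x (\<rho> y))"
    have mm: "cnj (cinner x (\<rho> y)) * cinner x (\<rho> y) = complex_of_real m"
      by (metis complex_norm_square m_def mult.commute)
    have yx: "cinner y (\<rho> x) = cnj (cinner x (\<rho> y))"
      by (metis cinner_commute positive_op_hermitian[OF assms])
    have "complex_of_real (qform \<rho> (x - l *\<^sub>C y))
        = complex_of_real (qform \<rho> x) - l * cinner x (\<rho> y) - cnj l * cinner y (\<rho> x)
          + cnj l * l * complex_of_real (qform \<rho> y)"
      by (simp add: bounded_clinear_simps[OF bc] cinner_simps algebra_simps flip: q(1))
    also have "l * cinner x (\<rho> y) = complex_of_real (t * m)"
      by (simp add: l_def mm mult.assoc)
    also have "cnj l * cinner y (\<rho> x) = complex_of_real (t * m)"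
      using mm by (simp add: l_def yx mult.assoc mult.commute)
    also have "cnj l * l = complex_of_real (t\<^sup>2 * m)"
      using mm by (simp add: l_def power2_eq_square mult_ac)
    finally have "complex_of_real (qform \<rho> (x - l *\<^sub>C y))
        = complex_of_real (qform \<rho> x - 2 * t * m + t\<^sup>2 * m * qform \<rho> y)"
      by simp
    then have "qform \<rho> (x - l *\<^sub>C y) = qform \<rho> x - 2 * t * m + t\<^sup>2 * m * qform \<rho> y"
      by (simp only: of_real_eq_iff)
    then show ?thesis
      using q(2)[of "x - l *\<^sub>C y"] by simp
  qed
  have "0 \<le> m"
    by (simp add: m_def)
  show ?thesis
    unfolding m_def[symmetric]
  proof (cases "qform \<rho> y = 0")
    case True
    have "m = 0"
    proof (rule ccontr)
      assume "m \<noteq> 0"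
      then show False
        using ineq[of "(qform \<rho> x + 1) / m"] q(2)[of x] True by simp
    qed
    then show "m \<le> qform \<rho> x * qform \<rho> y"
      using True by simp
  next
    case False
    then have "0 < qform \<rho> y"
      using q(2)[of y] by simp
    then show "m \<le> qform \<rho> x * qform \<rho> y"
      using ineq[of "1 / qform \<rho> y"] by (simp add: field_simps power2_eq_square)
  qed
qed

text \<open>Cauchy-Schwarz for the form, tested against \<open>x = \<rho> y\<close>.\<close>

lemma positive_op_kernel:
  assumes "positive_op \<rho>" "qform \<rho> y = 0"
  shows "\<rho> y = 0"
proof -
  have "(cmod (cinner (\<rho> y) (\<rho> y)))\<^sup>2 \<le> 0"
    using positive_op_cauchy_schwarz[OF assms(1), of "\<rho> y" y] assms(2) by simp
  then show ?thesis
    by (simp add: cinner_self_norm)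
qed

text \<open>One step of Cholesky elimination: \<open>\<rho>\<close> minus the rank-one operator that clears
  row and column \<open>i\<close>. If the pivot \<open>qform \<rho> (ket i)\<close> is 0, then so is the pivot vector.\<close>

definition pivot :: "('a ell2 \<Rightarrow> 'a ell2) \<Rightarrow> 'a \<Rightarrow> 'a ell2" where
  "pivot \<rho> i = (1 / sqrt (qform \<rho> (ket i))) *\<^sub>R \<rho> (ket i)"

definition eliminate :: "('a ell2 \<Rightarrow> 'a ell2) \<Rightarrow> 'a \<Rightarrow> 'a ell2 \<Rightarrow> 'a ell2" where
  "eliminate \<rho> i = (\<lambda>x. \<rho> x - ketbra (pivot \<rho> i) x)"

lemma cinner_eliminate:
  "cinner x (eliminate \<rho> i y)
     = cinner x (\<rho> y) - cinner (pivot \<rho> i) y * cinner x (pivot \<rho> i)"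
  by (simp add: eliminate_def ketbra_def cinner_simps)

lemma qform_eliminate:
  "qform (eliminate \<rho> i) x = qform \<rho> x - (cmod (cinner (pivot \<rho> i) x))\<^sup>2"
proof -
  have "cinner (pivot \<rho> i) x * cinner x (pivot \<rho> i)
      = complex_of_real ((cmod (cinner (pivot \<rho> i) x))\<^sup>2)"
    by (metis cinner_commute complex_norm_square)
  then show ?thesis
    unfolding qform_def cinner_eliminate by simp
qed

text \<open>Cauchy-Schwarz for the form of \<open>\<rho>\<close>, between \<open>ket i\<close> and
  \<open>x\<close>, says that the subtracted rank-one term does not exceed
  \<open>qform \<rho> x\<close>.\<close>

lemma positive_op_eliminate:
  assumes "positive_op \<rho>"
  shows "positive_op (eliminate \<rho> i)"
proof -
  note q = positive_op_qform[OF assms]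
  have bc: "bounded_clinear (eliminate \<rho> i)"
    unfolding eliminate_def ketbra_def
    using assms by (simp add: positive_op_def bounded_clinear_diff bounded_clinear_cinner_scaleC)
  have "(cmod (cinner (pivot \<rho> i) x))\<^sup>2 \<le> qform \<rho> x" for x
  proof (cases "qform \<rho> (ket i) = 0")
    case True
    then show ?thesis
      by (simp add: pivot_def q)
  next
    case False
    have "cinner (pivot \<rho> i) x = complex_of_real (1 / sqrt (qform \<rho> (ket i))) * cinner (ket i) (\<rho> x)"
      by (simp add: pivot_def cinner_simps positive_op_hermitian[OF assms])
    then have "(cmod (cinner (pivot \<rho> i) x))\<^sup>2 = (cmod (cinner (ket i) (\<rho> x)))\<^sup>2 / qform \<rho> (ket i)"
      using q(2)[of "ket i"] by (simp add: norm_mult norm_divide power_divide)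
    also have "\<dots> \<le> qform \<rho> x"
      using positive_op_cauchy_schwarz[OF assms, of "ket i" x] q(2)[of "ket i"] False
      by (simp add: field_simps)
    finally show ?thesis .
  qed
  moreover have "cinner x (eliminate \<rho> i x)
      = complex_of_real (qform \<rho> x - (cmod (cinner (pivot \<rho> i) x))\<^sup>2)" for x
    unfolding cinner_eliminate q of_real_diff complex_norm_square by (metis cinner_commute)
  ultimately have "cinner x (eliminate \<rho> i x) \<in> \<real>\<^sub>\<ge>\<^sub>0" for x
    by (simp only: nonneg_Reals_of_real_iff diff_ge_0_iff_ge)
  then show ?thesis
    using bc by (simp add: positive_op_def)
qed

text \<open>The rank-one term is normalised to reproduce the diagonal entry at \<open>i\<close>, so
  the new diagonal entry is 0; positivity then kills the whole column.\<close>

lemma eliminate_pivot: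
  assumes "positive_op \<rho>"
  shows "eliminate \<rho> i (ket i) = 0"
proof (rule positive_op_kernel[OF positive_op_eliminate[OF assms]])
  note q = positive_op_qform[OF assms]
  have "cinner (\<rho> (ket i)) (ket i) = complex_of_real (qform \<rho> (ket i))"
    by (metis q(1) positive_op_hermitian[OF assms])
  then have "(cmod (cinner (pivot \<rho> i) (ket i)))\<^sup>2 = qform \<rho> (ket i)"
    using q(2)[of "ket i"]
    by (simp add: pivot_def cinner_scaleR_left norm_mult norm_divide power_divide)
      (simp add: power2_eq_square)
  then show "qform (eliminate \<rho> i) (ket i) = 0"
    by (simp add: qform_eliminate)
qed

lemma eliminate_kernel:
  assumes "positive_op \<rho>" "\<rho> (ket j) = 0"
  shows "eliminate \<rho> i (ket j) = 0"
proof -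
  have "cinner (pivot \<rho> i) (ket j) = 0"
    using assms by (simp add: pivot_def cinner_scaleR_left flip: positive_op_hermitian)
  then show ?thesis
    by (simp add: eliminate_def ketbra_def assms(2))
qed

text \<open>The remainder after clearing the indices \<open>f 0\<close>, ...,
  \<open>f (n - 1)\<close>. Repetitions in \<open>f\<close> are harmless: the column of a cleared
  index is 0, and so is its pivot vector.\<close>

primrec cholesky :: "('a ell2 \<Rightarrow> 'a ell2) \<Rightarrow> (nat \<Rightarrow> 'a) \<Rightarrow> nat \<Rightarrow> 'a ell2 \<Rightarrow> 'a ell2" where
  "cholesky \<rho> f 0 = \<rho>"
| "cholesky \<rho> f (Suc n) = eliminate (cholesky \<rho> f n) (f n)"

lemma positive_op_cholesky: "positive_op \<rho> \<Longrightarrow> positive_op (cholesky \<rho> f n)"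
  by (induction n) (simp_all add: positive_op_eliminate)

lemma cholesky_kernel:
  assumes "positive_op \<rho>"
  shows "\<rho> (ket j) = 0 \<or> j \<in> f ` {..<n} \<Longrightarrow> cholesky \<rho> f n (ket j) = 0"
proof (induction n)
  case (Suc n)
  then show ?case
    using eliminate_pivot[OF positive_op_cholesky[OF assms]]
      eliminate_kernel[OF positive_op_cholesky[OF assms]]
    by (auto simp: lessThan_Suc)
qed simp

lemma cinner_cholesky:
  "cinner x (cholesky \<rho> f n y) = cinner x (\<rho> y)
     - (\<Sum>k<n. cinner (pivot (cholesky \<rho> f k) (f k)) y * cinner x (pivot (cholesky \<rho> f k) (f k)))"
  by (induction n) (simp_all add: cinner_eliminate)

lemma qform_cholesky_decreasing: "qform (cholesky \<rho> f n) x \<le> qform \<rho> x"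
proof (induction n)
  case (Suc n)
  then show ?case
    by (simp add: qform_eliminate) (smt (verit) zero_le_power2)
qed simp

text \<open>Up to a vector \<open>u\<close> of small norm, \<open>x\<close> combines finitely many
  basis vectors. After enough steps the remainder annihilates these, so its form at \<open>x\<close>
  equals its form at \<open>u\<close>, which is at most \<open>qform \<rho> u\<close> because
  elimination only decreases the form.\<close>

lemma qform_cholesky_tendsto_0:
  assumes pos: "positive_op \<rho>" and supp: "\<And>j. \<rho> (ket j) \<noteq> 0 \<Longrightarrow> j \<in> range f"
  shows "(\<lambda>n. qform (cholesky \<rho> f n) x) \<longlonglongrightarrow> 0"
proof (rule LIMSEQ_I)
  fix e :: real
  assume "0 < e"
  have "bounded_clinear \<rho>"
    using pos by (simp add: positive_op_def)
  then obtain K where "0 < K" and K: "\<And>x. norm (\<rho> x) \<le> norm x * K"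
    using bounded_linear.pos_bounded bounded_clinear_bounded_linear by blast
  have qK: "qform \<rho> u \<le> K * (norm u)\<^sup>2" for u
  proof -
    have "qform \<rho> u \<le> cmod (cinner u (\<rho> u))"
      by (simp add: qform_def complex_Re_le_cmod)
    also have "\<dots> \<le> norm u * norm (\<rho> u)"
      by (rule cinner_cauchy_schwarz)
    also have "\<dots> \<le> norm u * (norm u * K)"
      by (intro mult_left_mono K) simp
    finally show ?thesis
      by (simp add: power2_eq_square mult_ac)
  qed
  \<comment> \<open>Chosen so that \<open>norm u < d\<close> yields
    \<open>K * (norm u)\<^sup>2 < e\<close>.\<close>
  define d where "d = sqrt (e / K)"
  have "0 < d"
    using \<open>0 < e\<close> \<open>0 < K\<close> by (simp add: d_def)
  define s where "s F = (\<Sum>i\<in>F. coord x i *\<^sub>C ket i)" for F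
  have "(s \<longlongrightarrow> x) (finite_subsets_at_top UNIV)"
    using ell2_has_sum_ket[of x] unfolding has_sum_def s_def .
  then have "\<forall>\<^sub>F F in finite_subsets_at_top UNIV. dist (s F) x < d"
    using \<open>0 < d\<close> by (rule tendstoD)
  then obtain F where F: "finite F" "dist (s F) x < d"
    by (auto simp: eventually_finite_subsets_at_top)
  define u where "u = x - s F"
  have "norm u < d"
    using F by (simp add: u_def dist_norm norm_minus_commute)
  then have "(norm u)\<^sup>2 < d\<^sup>2"
    by (intro power_strict_mono) auto
  also have "d\<^sup>2 = e / K"
    using \<open>0 < e\<close> \<open>0 < K\<close> by (simp add: d_def)
  finally have qu: "qform \<rho> u < e"
    using qK[of u] \<open>0 < K\<close> by (simp add: field_simps)
  have "\<exists>N. \<forall>n\<ge>N. cholesky \<rho> f n (ket i) = 0" for i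
  proof (cases "\<rho> (ket i) = 0")
    case True
    then show ?thesis
      using cholesky_kernel[OF pos] by blast
  next
    case False
    then obtain k where "i = f k"
      using supp by blast
    then have "\<forall>n\<ge>Suc k. cholesky \<rho> f n (ket i) = 0"
      by (auto intro!: cholesky_kernel[OF pos])
    then show ?thesis by blast
  qed
  then obtain N where N: "\<And>i n. n \<ge> N i \<Longrightarrow> cholesky \<rho> f n (ket i) = 0"
    by metis
  \<comment> \<open>The sum of the thresholds \<open>N i\<close> serves as a common threshold for
    all \<open>i \<in> F\<close>.\<close>
  have "norm (qform (cholesky \<rho> f n) x - 0) < e" if n: "n \<ge> (\<Sum>i\<in>F. N i)" for n
  proof -
    let ?r = "cholesky \<rho> f n"
    have pos_r: "positive_op ?r"
      by (rule positive_op_cholesky[OF pos])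
    then have bc: "bounded_clinear ?r"
      by (simp add: positive_op_def)
    have "?r (ket i) = 0" if "i \<in> F" for i
      using member_le_sum[OF that, of N] F(1) n by (intro N) simp
    then have "?r (s F) = 0"
      unfolding s_def
      by (simp add: bounded_clinear_simps[OF bc]
          linear_sum[OF bounded_linear.linear[OF bounded_clinear_bounded_linear[OF bc]]])
    then have rx: "?r x = ?r u"
      by (simp add: u_def bounded_clinear_simps[OF bc])
    have "cinner x (?r x) = cinner u (?r u)"
      by (metis rx positive_op_hermitian[OF pos_r])
    then have "qform ?r x = qform ?r u"
      by (simp add: qform_def)
    then show ?thesis
      using qform_cholesky_decreasing[of \<rho> f n u] qu positive_op_qform(2)[OF pos_r, of x] by simp
  qed
  then show "\<exists>no. \<forall>n\<ge>no. norm (qform (cholesky \<rho> f n) x - 0) < e"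
    by blast
qed

section \<open>From the elimination to a purifying vector\<close>

lemma density_operator_imp_positive_op: "density_operator \<rho> \<Longrightarrow> positive_op \<rho>"
  by (simp add: density_operator_def positive_op_def)

lemma density_operator_diagonal:
  assumes "density_operator \<rho>"
  shows "((\<lambda>i. qform \<rho> (ket i)) has_sum 1) UNIV"
proof -
  have tr: "trace \<rho> = 1"
    using assms by (simp add: density_operator_def)
  have eq: "(\<lambda>i. cinner (ket i) (\<rho> (ket i))) = (\<lambda>i. complex_of_real (qform \<rho> (ket i)))"
    using positive_op_qform(1)[OF density_operator_imp_positive_op[OF assms]] by auto
  \<comment> \<open>A divergent \<open>infsum\<close> has the default value 0, so trace 1 forces
    convergence.\<close>
  have "((\<lambda>i. cinner (ket i) (\<rho> (ket i))) has_sum 1) UNIV"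
    using tr infsum_not_exists unfolding trace_def by (metis has_sum_infsum zero_neq_one)
  then have "((\<lambda>i. complex_of_real (qform \<rho> (ket i))) has_sum complex_of_real 1) UNIV"
    by (simp add: eq)
  then show ?thesis
    by (simp only: has_sum_of_real_iff)
qed

text \<open>The pivot vectors \<open>v k\<close> decompose \<open>\<rho>\<close>, as a form, into
  the rank-one operators \<open>ketbra (v k)\<close>; taken as the slices of \<open>\<Psi>\<close>,
  they purify it. A finite trace leaves only countably many nonzero columns, so \<open>nat\<close>
  can index both the elimination and the purifying system.\<close>

lemma purification_exists:
  assumes "density_operator \<rho>"
  shows "\<exists>\<Psi> :: ('a \<times> nat) ell2. purification \<Psi> \<rho>"
proof -
  have pos: "positive_op \<rho>"
    by (rule density_operator_imp_positive_op[OF assms])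
  note q = positive_op_qform[OF pos]
  have "countable {i. qform \<rho> (ket i) \<noteq> 0}"
    using summable_countable_real[OF has_sum_imp_summable[OF density_operator_diagonal[OF assms]]]
    by simp
  moreover have "{i. \<rho> (ket i) \<noteq> 0} \<subseteq> {i. qform \<rho> (ket i) \<noteq> 0}"
    using positive_op_kernel[OF pos] by auto
  ultimately have "countable {i. \<rho> (ket i) \<noteq> 0}"
    by (rule countable_subset[rotated])
  then have "\<exists>f :: nat \<Rightarrow> 'a. {i. \<rho> (ket i) \<noteq> 0} \<subseteq> range f"
    by (metis empty_subsetI order_refl range_from_nat_into)
  then obtain f :: "nat \<Rightarrow> 'a" where f: "\<And>j. \<rho> (ket j) \<noteq> 0 \<Longrightarrow> j \<in> range f"
    by blast
  define v where "v k = pivot (cholesky \<rho> f k) (f k)" for k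
  \<comment> \<open>Cauchy-Schwarz bounds the entries of the remainder by its diagonal forms, which
    tend to 0.\<close>
  have sums: "(\<lambda>k. cinner (v k) y * cinner x (v k)) sums cinner x (\<rho> y)" for x y
  proof -
    have "(\<lambda>n. (cmod (cinner x (cholesky \<rho> f n y)))\<^sup>2) \<longlonglongrightarrow> 0"
    proof (rule tendsto_sandwich[OF _ _ tendsto_const])
      show "(\<lambda>n. qform (cholesky \<rho> f n) x * qform (cholesky \<rho> f n) y) \<longlonglongrightarrow> 0"
        using tendsto_mult[OF qform_cholesky_tendsto_0[OF pos f] qform_cholesky_tendsto_0[OF pos f]]
        by simp
    qed (simp_all add: positive_op_cauchy_schwarz[OF positive_op_cholesky[OF pos]])
    then have "(\<lambda>n. sqrt ((cmod (cinner x (cholesky \<rho> f n y)))\<^sup>2)) \<longlonglongrightarrow> sqrt 0"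
      by (rule tendsto_real_sqrt)
    then have "(\<lambda>n. cinner x (cholesky \<rho> f n y)) \<longlonglongrightarrow> 0"
      by (simp add: tendsto_norm_zero_iff)
    then have "(\<lambda>n. cinner x (\<rho> y) - cinner x (cholesky \<rho> f n y)) \<longlonglongrightarrow> cinner x (\<rho> y) - 0"
      by (intro tendsto_diff tendsto_const)
    then show ?thesis
      by (simp add: sums_def cinner_cholesky v_def)
  qed
  have has_sum_sq: "((\<lambda>k. (cmod (cinner (v k) x))\<^sup>2) has_sum qform \<rho> x) UNIV" for x
  proof -
    have "(\<lambda>k. complex_of_real ((cmod (cinner (v k) x))\<^sup>2)) sums complex_of_real (qform \<rho> x)"
      using sums[of x x]
      by (simp only: complex_norm_square cinner_commute[of x] q)
    then have "(\<lambda>k. (cmod (cinner (v k) x))\<^sup>2) sums qform \<rho> x"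
      by (simp only: sums_of_real_iff)
    then show ?thesis
      by (intro sums_nonneg_imp_has_sum) auto
  qed
  \<comment> \<open>Absolute convergence turns the series in the order of \<open>k\<close> into the
    unordered sum that \<open>purification\<close> asks for.\<close>
  have has_sum: "((\<lambda>k. cinner (v k) y * cinner x (v k)) has_sum cinner x (\<rho> y)) UNIV" for x y
  proof -
    have "(\<lambda>k. norm (cinner (v k) y * cinner x (v k))) summable_on UNIV"
    proof (rule Infinite_Sum.abs_summable_on_comparison_test')
      show "(\<lambda>k. (cmod (cinner (v k) y))\<^sup>2 + (cmod (cinner (v k) x))\<^sup>2) summable_on UNIV"
        by (intro summable_on_add has_sum_imp_summable[OF has_sum_sq])
      show "norm (cinner (v k) y * cinner x (v k))
          \<le> (cmod (cinner (v k) y))\<^sup>2 + (cmod (cinner (v k) x))\<^sup>2" for k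
        using cmod_mult_le[of "cinner (v k) y" "cinner x (v k)"]
        by (metis cinner_commute complex_mod_cnj)
    qed
    then have "(\<lambda>k. cinner (v k) y * cinner x (v k)) summable_on UNIV"
      by (rule abs_summable_summable)
    then show ?thesis
      using has_sum_imp_sums[OF has_sum_infsum] sums sums_unique2 by (metis has_sum_infsum)
  qed
  define \<Psi> where "\<Psi> = Abs_ell2 (\<lambda>(i, k). coord (v k) i)"
  \<comment> \<open>The inner sums over \<open>k\<close> are the diagonal entries of
    \<open>\<rho>\<close>, which are summable by the trace condition; hence \<open>\<Psi>\<close> is
    a vector.\<close>
  have "(\<lambda>ik. (cmod (case ik of (i, k) \<Rightarrow> coord (v k) i))\<^sup>2) summable_on (SIGMA i:UNIV. UNIV)"
  proof (rule summable_on_SigmaI)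
    show "((\<lambda>k. (cmod (case (i, k) of (i, k) \<Rightarrow> coord (v k) i))\<^sup>2) has_sum qform \<rho> (ket i)) UNIV" for i
      using has_sum_sq[of "ket i"] by (simp add: cinner_ket_right)
    show "(\<lambda>i. qform \<rho> (ket i)) summable_on UNIV"
      using density_operator_diagonal[OF assms] by (rule has_sum_imp_summable)
  qed simp
  then have "coord \<Psi> = (\<lambda>(i, k). coord (v k) i)"
    unfolding \<Psi>_def by (intro coord_Abs) simp
  then have slice: "slice \<Psi> k = v k" for k
    by (intro coord_eqI) (simp add: coord_slice)
  have "purification \<Psi> \<rho>"
    unfolding purification_def
  proof (intro allI)
    fix x y
    have "cinner (x \<otimes>\<^sub>v ket k) (ketbra \<Psi> (y \<otimes>\<^sub>v ket k)) = cinner (v k) y * cinner x (v k)" for k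
      by (simp add: ketbra_def cinner_scaleC_right cinner_tensor_ket slice)
        (metis cinner_commute cinner_tensor_ket slice)
    then show "cinner x (\<rho> y) = (\<Sum>\<^sub>\<infinity>e. cinner (x \<otimes>\<^sub>v ket e) (ketbra \<Psi> (y \<otimes>\<^sub>v ket e)))"
      using infsumI[OF has_sum, of y x] by simp
  qed
  then show ?thesis by blast
qed

text \<open>Self-adjointness moves \<open>K\<close> into the left argument, where
  \<open>purification\<close> applies entry by entry; the iterated sum over \<open>i\<close> and
  \<open>e\<close> is then a sum over the product basis.\<close>

lemma trace_purification:
  assumes K: "bounded_clinear K" "\<And>x y. cinner x (K y) = cinner (K x) y"
    and "purification \<Psi> \<rho>"
  shows "trace (K \<circ> \<rho>) = cinner \<Psi> ((K \<otimes>\<^sub>o id) \<Psi>)"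
proof -
  have pu: "cinner x (\<rho> y) = (\<Sum>\<^sub>\<infinity>e. cinner (x \<otimes>\<^sub>v ket e) (ketbra \<Psi> (y \<otimes>\<^sub>v ket e)))" for x y
    using assms(3) by (simp add: purification_def)
  have entry: "cinner (K (ket i) \<otimes>\<^sub>v ket e) (ketbra \<Psi> (ket i \<otimes>\<^sub>v ket e))
      = cnj (coord \<Psi> (i, e)) * coord ((K \<otimes>\<^sub>o id) \<Psi>) (i, e)" for i e
  proof -
    have "cinner (K (ket i) \<otimes>\<^sub>v ket e) \<Psi> = cinner ((K \<otimes>\<^sub>o id) (ket (i, e))) \<Psi>"
      using tensor_op_tensor[OF K(1) bounded_clinear_id, of "ket i" "ket e"]
      by (simp add: ket_tensor)
    also have "\<dots> = coord ((K \<otimes>\<^sub>o id) \<Psi>) (i, e)"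
      by (simp add: tensor_op_self_adjoint[OF K(1) bounded_clinear_id K(2), symmetric] cinner_ket_left)
    finally show ?thesis
      by (simp add: ketbra_def cinner_scaleC_right ket_tensor cinner_ket_right)
  qed
  have "trace (K \<circ> \<rho>) = (\<Sum>\<^sub>\<infinity>i. \<Sum>\<^sub>\<infinity>e. cnj (coord \<Psi> (i, e)) * coord ((K \<otimes>\<^sub>o id) \<Psi>) (i, e))"
    unfolding trace_def by (simp add: K(2) pu entry)
  also have "\<dots> = cinner \<Psi> ((K \<otimes>\<^sub>o id) \<Psi>)"
    using infsum_Sigma'_banach[of "\<lambda>i e. cnj (coord \<Psi> (i, e)) * coord ((K \<otimes>\<^sub>o id) \<Psi>) (i, e)"
        UNIV "\<lambda>_. UNIV"] cinner_summable[of \<Psi> "(K \<otimes>\<^sub>o id) \<Psi>"]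
    by (simp add: cinner_def split_def)
  finally show ?thesis .
qed

lemma norm_purification:
  assumes "density_operator \<rho>" "purification \<Psi> \<rho>"
  shows "norm \<Psi> = 1"
proof -
  have "cinner \<Psi> \<Psi> = trace (id \<circ> \<rho>)"
    using trace_purification[OF bounded_clinear_id _ assms(2)] by (simp add: tensor_op_id)
  then have "complex_of_real ((norm \<Psi>)\<^sup>2) = complex_of_real 1"
    using assms(1) by (simp add: density_operator_def cinner_self_norm)
  then have "(norm \<Psi>)\<^sup>2 = 1"
    by (simp only: of_real_eq_iff)
  then show ?thesis
    by (simp add: power2_eq_1_iff) (metis norm_ge_zero not_one_le_zero neg_0_le_iff_le)
qed


section \<open>The sum-of-squares decomposition and its saturation\<close>

text \<open>Symmetric involutions model observables with outcomes 1 and -1. Symmetry is stated for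
  \<open>inner\<close>, the real part of \<open>cinner\<close>, since only real expectation values
  and norms enter.\<close>

locale commuting_observables =
  fixes A B :: "bit \<Rightarrow> 'h ell2 \<Rightarrow> 'h ell2"
  assumes A: "bounded_clinear (A x)" and B: "bounded_clinear (B y)"
    and A_involution [simp]: "A x (A x v) = v" and B_involution [simp]: "B y (B y v) = v"
    and A_symmetric: "inner u (A x v) = inner (A x u) v"
    and B_symmetric: "inner u (B y v) = inner (B y u) v"
    and A_B: "A x (B y v) = B y (A x v)"
begin

definition S :: "'h ell2 \<Rightarrow> 'h ell2" where "S v = B 0 v + B 1 v"
definition D :: "'h ell2 \<Rightarrow> 'h ell2" where "D v = B 0 v - B 1 v"

lemmas A_simps = bounded_clinear_simps[OF A] and B_simps = bounded_clinear_simps[OF B]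

lemma S: "bounded_clinear S" and D: "bounded_clinear D"
  unfolding S_def[abs_def] D_def[abs_def] by (intro bounded_clinear_add bounded_clinear_diff B)+

lemmas S_simps = bounded_clinear_simps[OF S] and D_simps = bounded_clinear_simps[OF D]

lemma A_S: "A x (S v) = S (A x v)" and A_D: "A x (D v) = D (A x v)"
  by (simp_all add: S_def D_def A_simps A_B)

lemma D_S: "D (S v) = - S (D v)"
  by (simp add: S_def D_def B_simps)

lemma S_S: "S (S v) = 4 *\<^sub>R v - D (D v)"
proof -
  have "4 *\<^sub>R v = v + v + v + v"
    by (metis mult_2 numeral_Bit0 scaleR_2 scaleR_left.add add.assoc)
  then show ?thesis
    by (simp add: S_def D_def B_simps)
qed

lemma S_symmetric: "inner u (S v) = inner (S u) v" and D_symmetric: "inner u (D v) = inner (D u) v"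
  by (simp_all add: S_def D_def inner_simps B_symmetric)

text \<open>For a non-signaling strategy Bob's marginals do not depend on Alice's input, so the four
  marginal terms of \<open>T\<close> collapse to \<open>- (1 - c)\<close> times the expectation of
  \<open>D\<close>.\<close>

definition bell_value :: "real \<Rightarrow> 'h ell2 \<Rightarrow> real" where
  "bell_value c v = inner v (A 0 (S v)) + c * inner v (A 1 (D v)) - (1 - c) * inner v (D v)"

text \<open>Expanding the squares with \<open>S\<^sup>2 = 4 - D\<^sup>2\<close> leaves a multiple of
  the identity, the Bell operator, and \<open>D\<^sup>2\<close> with the coefficient
  \<open>c (c - 2 + 2 R\<^sup>2) / (4 R)\<close>, which the relation between \<open>c\<close> and
  \<open>R\<close> cancels.\<close>

lemma bell_sos:
  assumes "0 < R" and c: "c = 2 - 2 * R\<^sup>2"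
  shows "2 / R * (norm v)\<^sup>2 - bell_value c v
    = (norm (A 0 (S v) - (2 * R) *\<^sub>R v - (1 - c) *\<^sub>R D v))\<^sup>2 / (4 * R)
      + c / (2 * R) * (norm (A 1 v - R *\<^sub>R D v))\<^sup>2"
proof -
  define n d2 x y z where "n = inner v v" "d2 = inner (D v) (D v)" "x = inner v (A 0 (S v))"
    "y = inner v (A 1 (D v))" "z = inner v (D v)"
  note defs = this
  have s2: "inner (A 0 (S v)) (A 0 (S v)) = 4 * n - d2"
  proof -
    have "inner (A 0 (S v)) (A 0 (S v)) = inner v (S (S v))"
      by (simp add: A_symmetric S_symmetric)
    then show ?thesis
      by (simp add: S_S inner_simps defs D_symmetric)
  qed
  \<comment> \<open>\<open>S\<close> and \<open>D\<close> anticommute and \<open>A 0\<close>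
    commutes with both, so this term equals its own negative.\<close>
  have cross: "inner (A 0 (S v)) (D v) = 0"
  proof -
    have "inner (A 0 (S v)) (D v) = inner v (S (A 0 (D v)))"
      by (simp add: A_symmetric S_symmetric)
    also have "\<dots> = - inner v (D (A 0 (S v)))"
      by (simp add: A_S A_D D_S)
    also have "\<dots> = - inner (A 0 (S v)) (D v)"
      by (simp add: D_symmetric inner_commute)
    finally show ?thesis by simp
  qed
  have "inner (A 1 v) (D v) = y" "inner (A 1 v) (A 1 v) = n"
    by (simp_all add: defs A_symmetric)
  then have L1: "(norm (A 1 v - R *\<^sub>R D v))\<^sup>2 = n - 2 * R * y + R\<^sup>2 * d2"
    unfolding power2_norm_eq_inner
    by (simp add: inner_simps inner_commute[of "D v" "A 1 v"] flip: defs(2))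
      (simp add: power2_eq_square algebra_simps)
  have L2: "(norm (A 0 (S v) - (2 * R) *\<^sub>R v - (1 - c) *\<^sub>R D v))\<^sup>2
      = 4 * n - d2 + 4 * R\<^sup>2 * n + (1 - c)\<^sup>2 * d2 - 4 * R * x + 4 * R * (1 - c) * z"
    unfolding power2_norm_eq_inner
    by (simp add: inner_simps s2 cross inner_commute[of "D v" v]
        inner_commute[of "D v" "A 0 (S v)"] inner_commute[of "A 0 (S v)" v]
        flip: defs)
      (simp add: power2_eq_square algebra_simps)
  have "2 / R * n - (x + c * y - (1 - c) * z)
      = (4 * n - d2 + 4 * R\<^sup>2 * n + (1 - c)\<^sup>2 * d2 - 4 * R * x + 4 * R * (1 - c) * z) / (4 * R)
        + c / (2 * R) * (n - 2 * R * y + R\<^sup>2 * d2)"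
    using \<open>0 < R\<close> unfolding c by (simp add: field_simps) algebra
  then show ?thesis
    unfolding bell_value_def L1 L2 by (simp add: defs power2_norm_eq_inner)
qed

lemma bell_value_le:
  assumes "0 < R" "R < 1" "c = 2 - 2 * R\<^sup>2"
  shows "bell_value c v \<le> 2 / R * (norm v)\<^sup>2"
proof -
  have "0 \<le> c"
    using assms by (simp add: power_le_one)
  then have "0 \<le> (norm (A 0 (S v) - (2 * R) *\<^sub>R v - (1 - c) *\<^sub>R D v))\<^sup>2 / (4 * R)
      + c / (2 * R) * (norm (A 1 v - R *\<^sub>R D v))\<^sup>2"
    using assms(1) by (intro add_nonneg_nonneg mult_nonneg_nonneg divide_nonneg_nonneg) auto
  then show ?thesis
    using bell_sos[OF assms(1,3), of v] by linarith
qed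

lemma bell_value_saturated:
  assumes "0 < R" "R < 1" "c = 2 - 2 * R\<^sup>2" "bell_value c v = 2 / R * (norm v)\<^sup>2"
  shows "A 1 v = R *\<^sub>R D v" "A 0 (S v) = (2 * R) *\<^sub>R v + (1 - c) *\<^sub>R D v"
proof -
  \<comment> \<open>Strictness of \<open>R < 1\<close> matters: with weight 0 the second square
    would not be forced to vanish.\<close>
  have "0 < c"
    using assms by (simp add: power_less_one_iff abs_square_less_1)
  define a b where "a = (norm (A 0 (S v) - (2 * R) *\<^sub>R v - (1 - c) *\<^sub>R D v))\<^sup>2"
    and "b = (norm (A 1 v - R *\<^sub>R D v))\<^sup>2"
  have ab: "a / (4 * R) + c / (2 * R) * b = 0" and "0 \<le> a" "0 \<le> b"
    using bell_sos[OF assms(1,3), of v] assms(4) by (simp_all add: a_def b_def)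
  then have "a / (4 * R) = 0" "c / (2 * R) * b = 0"
    using \<open>0 < c\<close> \<open>0 < R\<close> add_nonneg_eq_0_iff[of "a / (4 * R)" "c / (2 * R) * b"] by auto
  then have "a = 0" "b = 0"
    using \<open>0 < c\<close> \<open>0 < R\<close> by auto
  then show "A 1 v = R *\<^sub>R D v" "A 0 (S v) = (2 * R) *\<^sub>R v + (1 - c) *\<^sub>R D v"
    by (simp_all add: a_def b_def algebra_simps)
qed

text \<open>The two components, in the computational basis, of Alice's swap isometry.\<close>

definition E :: "bit \<Rightarrow> 'h ell2 \<Rightarrow> 'h ell2" where
  "E q v = (1 / 2) *\<^sub>R (if q = 0 then v + A 1 v else A 0 (v - A 1 v))"

lemma norm_A: "norm (A x v) = norm v"
  by (simp add: norm_eq_sqrt_inner A_symmetric)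

lemma E: "bounded_clinear (E q)"
  unfolding E_def[abs_def]
  by (cases q) (simp_all add: bounded_clinear_intros A bounded_clinear_compose[OF A])

lemma norm_E: "(norm (E 0 v))\<^sup>2 + (norm (E 1 v))\<^sup>2 = (norm v)\<^sup>2"
proof -
  have "inner (A 1 v) (A 1 v) = inner v v"
    by (simp add: A_symmetric)
  then have "(norm ((1 / 2) *\<^sub>R (v + A 1 v)))\<^sup>2 + (norm ((1 / 2) *\<^sub>R (v - A 1 v)))\<^sup>2 = (norm v)\<^sup>2"
    unfolding power2_norm_eq_inner by (simp add: inner_simps inner_commute[of "A 1 v" v] field_simps)
  then show ?thesis
    by (simp add: E_def norm_A)
qed

end

text \<open>Row \<open>q\<close>, column \<open>q'\<close> of the target operator in the
  computational basis: the identity, \<open>sigma_X\<close> or \<open>sigma_Z\<close>.\<close>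

definition alice_matrix :: "bit option \<Rightarrow> bit \<Rightarrow> bit \<Rightarrow> real" where
  "alice_matrix s q q' = (case s of None \<Rightarrow> (if q = q' then 1 else 0)
     | Some x \<Rightarrow> if x = 0 then (if q = q' then 0 else 1) else (if q = q' then sgn_bit q else 0))"

definition bob_matrix :: "real \<Rightarrow> bit option \<Rightarrow> bit \<Rightarrow> bit \<Rightarrow> real" where
  "bob_matrix \<phi> s q q' = (case s of None \<Rightarrow> (if q = q' then 1 else 0)
     | Some y \<Rightarrow> if q = q' then sgn_bit y * cos \<phi> * sgn_bit q else sin \<phi>)"

locale bob_frame = commuting_observables A B for A B :: "bit \<Rightarrow> 'a ell2 \<Rightarrow> 'a ell2" +
  fixes R \<phi> :: real
  assumes R_cos: "2 * R * cos \<phi> = 1" and sin_nonzero: "sin \<phi> \<noteq> 0"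
begin

text \<open>In the two-qubit strategy \<open>D\<close> is \<open>2 cos \<phi>\<close> times
  \<open>sigma_Z\<close> and \<open>S\<close> is \<open>2 sin \<phi>\<close> times
  \<open>sigma_X\<close>. As \<open>R = 1 / (2 cos \<phi>)\<close>, both rescalings are normalised
  to give the Pauli operators there.\<close>

definition Z :: "'a ell2 \<Rightarrow> 'a ell2" where "Z v = R *\<^sub>R D v"
definition X :: "'a ell2 \<Rightarrow> 'a ell2" where "X v = (1 / (2 * sin \<phi>)) *\<^sub>R S v"

lemma R_nonzero: "R \<noteq> 0"
  using R_cos by auto

lemma Z: "bounded_clinear Z" and X: "bounded_clinear X"
  unfolding Z_def[abs_def] X_def[abs_def] by (intro bounded_clinear_scaleR S D)+

lemmas Z_simps = bounded_clinear_simps[OF Z] and X_simps = bounded_clinear_simps[OF X]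

lemma A_Z: "A x (Z v) = Z (A x v)" and A_X: "A x (X v) = X (A x v)"
  by (simp_all add: Z_def X_def A_simps A_D A_S)

lemma Z_X: "Z (X v) = - X (Z v)"
  by (simp add: Z_def X_def S_simps D_simps D_S)

lemma B_eq: "B y v = (sgn_bit y * cos \<phi>) *\<^sub>R Z v + sin \<phi> *\<^sub>R X v"
proof -
  have "(sgn_bit y * cos \<phi>) *\<^sub>R Z v = (sgn_bit y / 2) *\<^sub>R D v"
    using R_cos by (simp add: Z_def mult_ac)
  moreover have "sin \<phi> *\<^sub>R X v = (1 / 2) *\<^sub>R S v"
    using sin_nonzero by (simp add: X_def)
  moreover have "B y v = (sgn_bit y / 2) *\<^sub>R D v + (1 / 2) *\<^sub>R S v"
  proof (cases y)
    case zero
    have "B 0 v = (1 / 2) *\<^sub>R (B 0 v + B 0 v)"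
      by simp
    then show ?thesis
      by (simp add: zero sgn_bit_def D_def S_def flip: scaleR_add_right)
  next
    case one
    have "B 1 v = (1 / 2) *\<^sub>R (S v - D v)"
      by (simp add: S_def D_def)
    then show ?thesis
      by (simp add: one sgn_bit_def scaleR_diff_right)
  qed
  ultimately show ?thesis by simp
qed

text \<open>On \<open>v\<close> one has \<open>D\<^sup>2 = 4 cos\<^sup>2 \<phi>\<close>, so
  \<open>S\<^sup>2 = 4 - D\<^sup>2\<close> equals \<open>4 sin\<^sup>2 \<phi>\<close> there.\<close>

lemma X_X:
  assumes "Z (Z v) = v"
  shows "X (X v) = v"
proof -
  have "R\<^sup>2 *\<^sub>R D (D v) = v"
    using assms by (simp add: Z_def D_simps power2_eq_square)
  moreover have "D (D v) = (1 / R\<^sup>2) *\<^sub>R R\<^sup>2 *\<^sub>R D (D v)"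
    using R_nonzero by simp
  ultimately have "D (D v) = (1 / R\<^sup>2) *\<^sub>R v"
    by simp
  moreover have "1 / R\<^sup>2 = 4 * (cos \<phi>)\<^sup>2"
  proof -
    have "(2 * R * cos \<phi>)\<^sup>2 = 1"
      by (simp add: R_cos)
    then show ?thesis
      using R_nonzero by (simp add: power_mult_distrib field_simps)
  qed
  ultimately have "S (S v) = (4 * (sin \<phi>)\<^sup>2) *\<^sub>R v"
    by (simp add: S_S sin_squared_eq flip: scaleR_diff_left)
  then show ?thesis
    using sin_nonzero by (simp add: X_def S_simps power2_eq_square)
qed

text \<open>The components of Bob's swap map, isometric only where \<open>Z\<^sup>2 = 1\<close>.\<close>

definition F :: "bit \<Rightarrow> 'a ell2 \<Rightarrow> 'a ell2" where
  "F r v = (1 / 2) *\<^sub>R (if r = 0 then v + Z v else X (v - Z v))"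

lemma F: "bounded_clinear (F r)"
  unfolding F_def[abs_def]
  by (cases r) (simp_all add: bounded_clinear_intros Z bounded_clinear_compose[OF X])

lemma Z_symmetric: "inner u (Z v) = inner (Z u) v" and X_symmetric: "inner u (X v) = inner (X u) v"
  by (simp_all add: Z_def X_def S_symmetric D_symmetric)

lemma norm_F:
  assumes "Z (Z v) = v"
  shows "(norm (F 0 v))\<^sup>2 + (norm (F 1 v))\<^sup>2 = (norm v)\<^sup>2"
proof -
  have "inner (Z v) (Z v) = inner v v"
    by (simp add: assms flip: Z_symmetric)
  moreover have "inner (X (v - Z v)) (X (v - Z v)) = inner (v - Z v) (v - Z v)"
    by (simp add: X_X Z_simps assms flip: X_symmetric)
  ultimately show ?thesis
    by (simp add: F_def power2_norm_eq_inner inner_simps inner_commute[of "Z v" v] field_simps)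
qed

end

text \<open>The equations for \<open>2 \<theta>\<close> are those under which
  \<open>psi_theta \<theta>\<close> itself satisfies \<open>sat2\<close>; \<open>sat1\<close> and
  \<open>sat2\<close> are the conclusions of \<open>bell_value_saturated\<close>.\<close>

locale saturated = bob_frame A B R \<phi> for A B :: "bit \<Rightarrow> 'a ell2 \<Rightarrow> 'a ell2" and R \<phi> +
  fixes c \<theta> :: real and \<Psi> :: "'a ell2"
  assumes cos_2\<theta>: "cos (2 * \<theta>) = - (1 - c) * cos \<phi> / R"
    and sin_2\<theta>: "sin (2 * \<theta>) = sin \<phi> / R"
    and sat1: "A 1 \<Psi> = R *\<^sub>R D \<Psi>"
    and sat2: "A 0 (S \<Psi>) = (2 * R) *\<^sub>R \<Psi> + (1 - c) *\<^sub>R D \<Psi>"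
begin

lemma A1_\<Psi>: "A 1 \<Psi> = Z \<Psi>"
  by (simp add: sat1 Z_def)

text \<open>On the state \<open>Z\<close> can be traded for \<open>A 1\<close>; as the two commute,
  Alice's involution becomes one of Bob's.\<close>

lemma Z_Z_\<Psi>: "Z (Z \<Psi>) = \<Psi>"
  by (metis A1_\<Psi> A_Z A_involution)

text \<open>This is \<open>sat2\<close> multiplied by \<open>A 0\<close> and rescaled; the equations
  for \<open>2 \<theta>\<close> turn its coefficients into a sine and a cosine.\<close>

lemma sin_X_\<Psi>: "sin (2 * \<theta>) *\<^sub>R X \<Psi> = A 0 \<Psi> - cos (2 * \<theta>) *\<^sub>R Z (A 0 \<Psi>)"
proof -
  have "S \<Psi> = A 0 (A 0 (S \<Psi>))"
    by simp
  also have "\<dots> = (2 * R) *\<^sub>R A 0 \<Psi> + (1 - c) *\<^sub>R D (A 0 \<Psi>)"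
    unfolding sat2 by (simp add: A_simps A_D)
  finally have S\<Psi>: "S \<Psi> = (2 * R) *\<^sub>R A 0 \<Psi> + (1 - c) *\<^sub>R D (A 0 \<Psi>)" .
  have "sin (2 * \<theta>) *\<^sub>R X \<Psi> = (1 / (2 * R)) *\<^sub>R S \<Psi>"
    using sin_nonzero by (simp add: sin_2\<theta> X_def)
  also have "\<dots> = A 0 \<Psi> + ((1 - c) / (2 * R)) *\<^sub>R D (A 0 \<Psi>)"
    unfolding S\<Psi> using R_nonzero by (simp add: scaleR_add_right)
  also have "(1 - c) / (2 * R) = - cos (2 * \<theta>) * R"
  proof -
    have "cos \<phi> = 1 / (2 * R)"
      using R_cos R_nonzero by (simp add: field_simps)
    then show ?thesis
      unfolding cos_2\<theta> using R_nonzero by (simp add: field_simps)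
  qed
  finally show ?thesis
    by (simp add: Z_def)
qed

lemma sin_2\<theta>_nonzero: "sin (2 * \<theta>) \<noteq> 0"
  using sin_nonzero R_nonzero by (simp add: sin_2\<theta>)

lemma cos_\<theta>_nonzero: "cos \<theta> \<noteq> 0"
  using sin_2\<theta>_nonzero by (auto simp: sin_double)

text \<open>The previous identity is inverted by \<open>1 + cos (2 \<theta>) Z\<close>: on
  \<open>A 0 \<Psi>\<close>, where \<open>Z\<^sup>2 = 1\<close>, its product with
  \<open>1 - cos (2 \<theta>) Z\<close> is the number
  \<open>sin\<^sup>2 (2 \<theta>)\<close>.\<close>

lemma sin_A0_\<Psi>: "sin (2 * \<theta>) *\<^sub>R A 0 \<Psi> = X \<Psi> + cos (2 * \<theta>) *\<^sub>R Z (X \<Psi>)"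
proof -
  let ?s = "sin (2 * \<theta>)" and ?c = "cos (2 * \<theta>)"
  have ZZ: "Z (Z (A 0 \<Psi>)) = A 0 \<Psi>"
    by (simp add: Z_Z_\<Psi> flip: A_Z)
  have "?s *\<^sub>R (X \<Psi> + ?c *\<^sub>R Z (X \<Psi>)) = ?s *\<^sub>R X \<Psi> + ?c *\<^sub>R Z (?s *\<^sub>R X \<Psi>)"
    by (simp add: Z_simps scaleR_add_right mult.commute)
  also have "\<dots> = A 0 \<Psi> - (?c * ?c) *\<^sub>R A 0 \<Psi>"
    unfolding sin_X_\<Psi> by (simp add: Z_simps ZZ scaleR_diff_right)
  also have "\<dots> = (1 - ?c * ?c) *\<^sub>R A 0 \<Psi>"
    by (simp add: scaleR_diff_left)
  also have "1 - ?c * ?c = ?s * ?s"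
    using sin_squared_eq[of "2 * \<theta>"] by (simp add: power2_eq_square)
  finally show ?thesis
    using sin_2\<theta>_nonzero by (simp flip: scaleR_scaleR)
qed

text \<open>With \<open>A 0 \<Psi>\<close> written through Bob's operators, \<open>A 1\<close>
  passes to the state and becomes \<open>Z\<close>. Anticommutation of \<open>Z\<close> and
  \<open>X\<close> is thereby transferred from Bob to Alice.\<close>

lemma anticommute_\<Psi>: "A 1 (A 0 \<Psi>) = - A 0 (A 1 \<Psi>)"
proof -
  let ?s = "sin (2 * \<theta>)" and ?c = "cos (2 * \<theta>)"
  have "?s *\<^sub>R A 1 (A 0 \<Psi>) = A 1 (?s *\<^sub>R A 0 \<Psi>)"
    by (simp add: A_simps)
  also have "\<dots> = X (Z \<Psi>) + ?c *\<^sub>R Z (X (Z \<Psi>))"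
    unfolding sin_A0_\<Psi> by (simp add: A_simps A_X A_Z A1_\<Psi>)
  also have "\<dots> = - Z (X \<Psi> + ?c *\<^sub>R Z (X \<Psi>))"
    by (simp add: Z_simps Z_X X_simps)
  also have "\<dots> = - (?s *\<^sub>R A 0 (A 1 \<Psi>))"
    by (simp add: A1_\<Psi> A_Z Z_simps flip: sin_A0_\<Psi>)
  finally show ?thesis
    using sin_2\<theta>_nonzero by (simp flip: scaleR_minus_right)
qed

lemma E_simps: "E q (v + w) = E q v + E q w" "E q (a *\<^sub>R v) = a *\<^sub>R E q v"
  and F_simps: "F q (v + w) = F q v + F q w" "F q (a *\<^sub>R v) = a *\<^sub>R F q v"
  by (simp_all add: E_def F_def A_simps X_simps Z_simps algebra_simps)

lemma A_F: "A x (F r v) = F r (A x v)"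
  by (simp add: F_def A_simps A_X A_Z)

lemma op_A_F: "op_or_id A s (F r v) = F r (op_or_id A s v)"
  by (simp add: op_or_id_def A_F split: option.split)

text \<open>The swap map intertwines Alice's observables with their target matrices. This is
  formulated vector by vector because anticommutation is known only for vectors derived from the
  state.\<close>

lemma E_op_A:
  assumes "A 1 (A 0 v) = - A 0 (A 1 v)"
  shows "E q (op_or_id A s v) = alice_matrix s q 0 *\<^sub>R E 0 v + alice_matrix s q 1 *\<^sub>R E 1 v"
proof (cases s)
  case None
  then show ?thesis
    by (cases q) (simp_all add: op_or_id_def alice_matrix_def)
next
  case (Some x)
  have "A 0 (A 1 v) = - A 1 (A 0 v)"
    using assms by simp
  then have "A 1 (A 0 (A 1 v)) = - A 0 v"
    by (simp add: A_simps)
  then show ?thesis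
    using assms Some
    by (cases q; cases x)
      (simp_all add: op_or_id_def alice_matrix_def E_def A_simps sgn_bit_def algebra_simps)
qed

lemma F_op_B:
  assumes v: "Z (Z v) = v"
  shows "F q (op_or_id B s v) = bob_matrix \<phi> s q 0 *\<^sub>R F 0 v + bob_matrix \<phi> s q 1 *\<^sub>R F 1 v"
proof (cases s)
  case None
  then show ?thesis
    by (cases q) (simp_all add: op_or_id_def bob_matrix_def)
next
  case (Some y)
  \<comment> \<open>Under the swap \<open>Z\<close> becomes a sign on the register and
    \<open>X\<close> a flip; in type \<open>bit\<close>, \<open>q + 1\<close> is the other
    bit.\<close>
  have FZ: "F q (Z v) = sgn_bit q *\<^sub>R F q v"
    by (cases q) (simp_all add: F_def v X_simps sgn_bit_def algebra_simps)
  have FX: "F q (X v) = F (q + 1) v"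
    using X_X[OF v] X_X[of "Z v"] v
    by (cases q) (simp_all add: F_def Z_X X_simps algebra_simps)
  have "F q (B y v) = (sgn_bit y * cos \<phi> * sgn_bit q) *\<^sub>R F q v + sin \<phi> *\<^sub>R F (q + 1) v"
    by (subst B_eq) (simp add: F_simps FZ FX)
  moreover have "op_or_id B s v = B y v"
    using Some by (simp add: op_or_id_def)
  ultimately show ?thesis
    using Some by (cases q) (simp_all add: bob_matrix_def)
qed

text \<open>The residual state: the component \<open>E 0 (F 0 \<Psi>)\<close> of the swapped state,
  divided by its amplitude \<open>cos \<theta>\<close>.\<close>

definition \<eta> :: "'a ell2" where
  "\<eta> = (1 / (2 * cos \<theta>)) *\<^sub>R (\<Psi> + Z \<Psi>)"

text \<open>Since \<open>A 1\<close> acts as \<open>Z\<close> on the state, the two registers agree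
  and the mixed components vanish. The amplitude \<open>sin \<theta>\<close> comes from
  \<open>sin_A0_\<Psi>\<close> and
  \<open>1 - cos (2 \<theta>) = 2 sin\<^sup>2 \<theta>\<close>.\<close>

lemma E_F_\<Psi>:
  "E 0 (F 0 \<Psi>) = cos \<theta> *\<^sub>R \<eta>" "E 1 (F 0 \<Psi>) = 0" "E 0 (F 1 \<Psi>) = 0"
  "E 1 (F 1 \<Psi>) = sin \<theta> *\<^sub>R \<eta>"
proof -
  have AF0: "A 1 (F 0 \<Psi>) = F 0 \<Psi>" and AF1: "A 1 (F 1 \<Psi>) = - F 1 \<Psi>"
    by (simp_all add: F_def A_simps A_X A_Z A1_\<Psi> Z_Z_\<Psi> X_simps algebra_simps)
  show "E 0 (F 0 \<Psi>) = cos \<theta> *\<^sub>R \<eta>"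
    using cos_\<theta>_nonzero by (simp add: E_def AF0) (simp add: F_def \<eta>_def)
  show "E 1 (F 0 \<Psi>) = 0" "E 0 (F 1 \<Psi>) = 0"
    by (simp_all add: E_def AF0 AF1 A_simps)
  let ?s = "sin (2 * \<theta>)" and ?c = "cos (2 * \<theta>)"
  have XX: "X (X \<Psi>) = \<Psi>" "X (X (Z \<Psi>)) = Z \<Psi>"
    by (simp_all add: X_X Z_Z_\<Psi>)
  have "?s *\<^sub>R E 1 (F 1 \<Psi>) = F 1 (?s *\<^sub>R A 0 \<Psi>)"
  proof -
    have "E 1 (F 1 \<Psi>) = A 0 (F 1 \<Psi>)"
      by (simp add: E_def AF1 A_simps)
    then show ?thesis
      by (simp add: A_F F_simps)
  qed
  also have "\<dots> = (1 / 2) *\<^sub>R ((1 - ?c) *\<^sub>R (\<Psi> + Z \<Psi>))"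
    unfolding sin_A0_\<Psi>
    by (simp add: F_def Z_simps X_simps Z_X XX Z_Z_\<Psi> algebra_simps)
  also have "1 - ?c = 2 * (sin \<theta>)\<^sup>2"
    using cos_double_sin[of \<theta>] by simp
  finally have "?s *\<^sub>R E 1 (F 1 \<Psi>) = ?s *\<^sub>R (sin \<theta> *\<^sub>R \<eta>)"
    using cos_\<theta>_nonzero by (simp add: \<eta>_def sin_double power2_eq_square)
  then show "E 1 (F 1 \<Psi>) = sin \<theta> *\<^sub>R \<eta>"
    using sin_2\<theta>_nonzero by (metis scaleR_cancel_left)
qed

text \<open>Both swap maps preserve the norm along \<open>\<Psi>\<close>, and the squared amplitudes
  add up to 1.\<close>

lemma norm_\<eta>: "norm \<eta> = norm \<Psi>"
proof -
  have "(norm \<Psi>)\<^sup>2 = (norm (E 0 (F 0 \<Psi>)))\<^sup>2 + (norm (E 1 (F 0 \<Psi>)))\<^sup>2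
      + ((norm (E 0 (F 1 \<Psi>)))\<^sup>2 + (norm (E 1 (F 1 \<Psi>)))\<^sup>2)"
    unfolding norm_E by (rule norm_F[OF Z_Z_\<Psi>, symmetric])
  also have "\<dots> = (norm \<eta>)\<^sup>2"
    by (simp add: E_F_\<Psi> power_mult_distrib flip: distrib_right)
  finally show ?thesis by simp
qed

text \<open>\<open>D\<^sup>2\<close> commutes with each \<open>B y\<close>, although
  \<open>D\<close> itself need not, so \<open>Z\<^sup>2 = 1\<close> persists after Bob's observables
  have acted.\<close>

lemma Z_Z_op_B_\<Psi>: "Z (Z (op_or_id B r \<Psi>)) = op_or_id B r \<Psi>"
proof -
  have "D (D (B y v)) = B y (D (D v))" for y v
    by (cases y) (simp_all add: D_def B_simps)
  then have "Z (Z (B y v)) = B y (Z (Z v))" for y v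
    by (simp add: Z_def D_simps B_simps)
  then show ?thesis
    by (simp add: op_or_id_def Z_Z_\<Psi> split: option.split)
qed

text \<open>Alice's observables commute with Bob's swap, so the two intertwining properties apply
  one after the other and reduce everything to the four components in
  \<open>E_F_\<Psi>\<close>.\<close>

lemma extraction_components:
  "E q (F r (op_or_id A s (op_or_id B t \<Psi>)))
    = (cos \<theta> * alice_matrix s q 0 * bob_matrix \<phi> t r 0
       + sin \<theta> * alice_matrix s q 1 * bob_matrix \<phi> t r 1) *\<^sub>R \<eta>"
proof -
  have anti: "A 1 (A 0 (F k \<Psi>)) = - A 0 (A 1 (F k \<Psi>))" for k
  proof -
    have "F k (- v) = - F k v" for v
      using F_simps(2)[of k "-1" v] by simp
    then show ?thesis
      by (simp add: A_F anticommute_\<Psi>)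
  qed
  have bc: "bounded_clinear (op_or_id A s)"
    by (auto simp: op_or_id_def A split: option.split)
  have "E q (F r (op_or_id A s (op_or_id B t \<Psi>))) = E q (op_or_id A s (F r (op_or_id B t \<Psi>)))"
    by (simp add: op_A_F)
  also have "\<dots> = bob_matrix \<phi> t r 0 *\<^sub>R E q (op_or_id A s (F 0 \<Psi>))
      + bob_matrix \<phi> t r 1 *\<^sub>R E q (op_or_id A s (F 1 \<Psi>))"
    by (simp add: F_op_B[OF Z_Z_\<Psi>] bounded_clinear_simps[OF bc] E_simps)
  also have "\<dots> = bob_matrix \<phi> t r 0 *\<^sub>R alice_matrix s q 0 *\<^sub>R cos \<theta> *\<^sub>R \<eta>
      + bob_matrix \<phi> t r 1 *\<^sub>R alice_matrix s q 1 *\<^sub>R sin \<theta> *\<^sub>R \<eta>"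
    by (simp add: E_op_A[OF anti] E_F_\<Psi>)
  finally show ?thesis
    by (simp add: scaleR_add_left mult_ac)
qed

end


section \<open>Local bounds and the angles\<close>

lemma bit_sum: "(\<Sum>a\<in>{0, 1 :: bit}. f a) = f 0 + f 1"
  by simp

lemma corr_simps:
  "corr_B P x y = P 0 0 x y + P 1 0 x y - P 0 1 x y - P 1 1 x y"
  "corr_AB P x y = P 0 0 x y - P 1 0 x y - P 0 1 x y + P 1 1 x y"
  by (simp_all add: corr_B_def corr_AB_def bit_sum sgn_bit_def)

lemma has_sum_pmf: "(pmf q has_sum 1) UNIV"
proof -
  have "pmf q summable_on UNIV"
    by (rule abs_summable_summable) (simp only: abs_summable_equivalent pmf_abs_summable)
  moreover have "infsum (pmf q) UNIV = 1"
    using infsetsum_pmf_eq_1[of q UNIV] by (simp add: infsetsum_infsum pmf_abs_summable)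
  ultimately show ?thesis
    by (metis has_sum_infsum)
qed

lemma has_sum_diff:
  fixes f g :: "'a \<Rightarrow> real"
  assumes "(f has_sum a) A" "(g has_sum b) A"
  shows "((\<lambda>x. f x - g x) has_sum (a - b)) A"
  using has_sum_add[OF assms(1) has_sum_cmult_right[OF assms(2), of "-1"]] by simp

text \<open>\<open>T\<close> is linear, so its value on a mixture is the average over the hidden
  variable. The bound on \<open>G\<close> makes the sums converge absolutely, which allows the
  exchange.\<close>

lemma T_mixture_le:
  fixes G :: "nat \<Rightarrow> behavior"
  assumes P: "\<And>a b x y. P a b x y = (\<Sum>\<^sub>\<infinity>l. pmf q l * G l a b x y)"
    and G: "\<And>l a b x y. \<bar>G l a b x y\<bar> \<le> 1"
    and le: "\<And>l. T p (G l) \<le> M"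
  shows "T p P \<le> M"
proof -
  have hs: "((\<lambda>l. pmf q l * G l a b x y) has_sum P a b x y) UNIV" for a b x y
  proof -
    have "(\<lambda>l. norm (pmf q l * G l a b x y)) summable_on UNIV"
      by (rule Infinite_Sum.abs_summable_on_comparison_test'[OF has_sum_imp_summable[OF has_sum_pmf[of q]]])
        (use G in \<open>simp add: abs_mult mult_left_le\<close>)
    then show ?thesis
      unfolding P by (rule has_sum_infsum[OF abs_summable_summable])
  qed
  have B: "((\<lambda>l. pmf q l * corr_B (G l) x y) has_sum corr_B P x y) UNIV" for x y
    unfolding corr_simps right_diff_distrib distrib_left
    by (intro has_sum_diff has_sum_add hs)
  have AB: "((\<lambda>l. pmf q l * corr_AB (G l) x y) has_sum corr_AB P x y) UNIV" for x y
    unfolding corr_simps right_diff_distrib distrib_left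
    by (intro has_sum_diff has_sum_add hs)
  have "((\<lambda>l. pmf q l * T p (G l)) has_sum T p P) UNIV"
    unfolding T_def right_diff_distrib distrib_left mult.left_commute[of "pmf q _" "(1 - p) / p"]
    by (intro has_sum_diff has_sum_add has_sum_cmult_right B AB)
  moreover have "((\<lambda>l. pmf q l * M) has_sum M) UNIV"
    using has_sum_cmult_left[OF has_sum_pmf[of q], of M] by simp
  ultimately show ?thesis
    by (rule has_sum_mono) (simp add: le mult_left_mono)
qed

lemma pmf_bit_sum: "pmf q (0 :: bit) + pmf q 1 = 1"
proof -
  have "(\<Sum>b\<in>{0, 1}. pmf q b) = 1"
    by (rule sum_pmf_eq_1) (auto intro: bit.exhaust)
  then show ?thesis
    by (simp add: bit_sum)
qed

lemma pmf_bit_one: "pmf q (1 :: bit) = 1 - pmf q 0"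
  using pmf_bit_sum[of q] by simp

text \<open>The number \<open>\<bar>1 - c\<bar> + c\<close> is at least 1 and bounds the
  coefficients of both \<open>b 0 + b 1\<close> and \<open>b 0 - b 1\<close>, whose absolute values
  add up to at most 2.\<close>

lemma local_T_le:
  fixes a b :: "bit \<Rightarrow> real"
  assumes a: "\<And>x. \<bar>a x\<bar> \<le> 1" and b: "\<And>y. \<bar>b y\<bar> \<le> 1" and "0 \<le> c"
  shows "b 1 - b 0 + c * (b 0 - b 1) + a 0 * b 0 + a 0 * b 1 + c * (a 1 * b 0 - a 1 * b 1)
    \<le> 2 * (\<bar>1 - c\<bar> + c)"
proof -
  let ?k = "\<bar>1 - c\<bar> + c"
  have "a 0 * (b 0 + b 1) \<le> \<bar>a 0\<bar> * \<bar>b 0 + b 1\<bar>"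
    by (metis abs_ge_self abs_mult)
  also have "\<dots> \<le> 1 * \<bar>b 0 + b 1\<bar>"
    by (intro mult_right_mono a) simp
  also have "\<dots> \<le> ?k * \<bar>b 0 + b 1\<bar>"
    by (intro mult_right_mono) auto
  finally have 1: "a 0 * (b 0 + b 1) \<le> ?k * \<bar>b 0 + b 1\<bar>" .
  have "(b 0 - b 1) * (c * a 1 - (1 - c)) \<le> \<bar>c * a 1 - (1 - c)\<bar> * \<bar>b 0 - b 1\<bar>"
    by (metis abs_ge_self abs_mult mult.commute)
  also have "\<bar>c * a 1 - (1 - c)\<bar> \<le> \<bar>c * a 1\<bar> + \<bar>1 - c\<bar>"
    by linarith
  also have "\<bar>c * a 1\<bar> \<le> c * 1"
    unfolding abs_mult using a[of 1] \<open>0 \<le> c\<close> by (simp add: mult_left_le)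
  finally have 2: "(b 0 - b 1) * (c * a 1 - (1 - c)) \<le> ?k * \<bar>b 0 - b 1\<bar>"
    by (simp add: add.commute mult_right_mono)
  have "\<bar>b 0 + b 1\<bar> + \<bar>b 0 - b 1\<bar> \<le> 2"
    using b[of 0] b[of 1] by linarith
  then have "?k * (\<bar>b 0 + b 1\<bar> + \<bar>b 0 - b 1\<bar>) \<le> ?k * 2"
    using \<open>0 \<le> c\<close> by (intro mult_left_mono) auto
  then show ?thesis
    using 1 2 by (simp add: algebra_simps)
qed

lemma local_bound:
  assumes "0 < p" "p \<le> 1" "P \<in> local_behaviors"
  shows "T p P \<le> 2 * (\<bar>2 * p - 1\<bar> + 1 - p) / p"
proof -
  obtain pL :: "nat pmf" and pA pB :: "bit \<Rightarrow> nat \<Rightarrow> bit pmf" where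
    P: "\<And>a b x y. P a b x y = (\<Sum>\<^sub>\<infinity>l. pmf pL l * (pmf (pA x l) a * pmf (pB y l) b))"
    using assms(3) by (auto simp: local_behaviors_def mult.assoc)
  show ?thesis
  proof (rule T_mixture_le[OF P])
    show "\<bar>pmf (pA x l) a * pmf (pB y l) b\<bar> \<le> 1" for l a b x y
      by (simp add: abs_mult mult_le_one pmf_le_1)
    fix l
    let ?a = "\<lambda>x. 2 * pmf (pA x l) 0 - 1" and ?b = "\<lambda>y. 2 * pmf (pB y l) 0 - 1"
    have "\<bar>2 * pmf q (0 :: bit) - 1\<bar> \<le> 1" for q
      using pmf_le_1[of q 0] pmf_nonneg[of q 0] by linarith
    then have "T p (\<lambda>a b x y. pmf (pA x l) a * pmf (pB y l) b) \<le> 2 * (\<bar>1 - (1 - p) / p\<bar> + (1 - p) / p)"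
      using local_T_le[of ?a ?b "(1 - p) / p"] assms
      by (simp add: T_def corr_simps pmf_bit_one) (simp add: algebra_simps)
    also have "\<bar>1 - (1 - p) / p\<bar> = \<bar>2 * p - 1\<bar> / p"
    proof -
      have "1 - (1 - p) / p = (2 * p - 1) / p"
        using assms by (simp add: field_simps)
      then show ?thesis
        using assms by simp
    qed
    also have "2 * (\<bar>2 * p - 1\<bar> / p + (1 - p) / p) = 2 * (\<bar>2 * p - 1\<bar> + 1 - p) / p"
      by (simp add: add_divide_distrib diff_divide_distrib)
    finally show "T p (\<lambda>a b x y. pmf (pA x l) a * pmf (pB y l) b)
        \<le> 2 * (\<bar>2 * p - 1\<bar> + 1 - p) / p" .
  qed
qed

text \<open>The expression is affine in \<open>a 0\<close> and in \<open>a 1\<close>, so its values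
  at 1 and -1 decide. At \<open>a 1 = -1\<close> the term \<open>e\<close> cancels and the value is
  at most 2; at \<open>a 1 = 1\<close> the coefficients of the \<open>b\<close> terms have absolute
  values \<open>2 * \<bar>p - x\<bar>\<close>, \<open>2 * x\<close> and
  \<open>2 * (1 - p)\<close>.\<close>

lemma signaling_T_le:
  fixes a :: "bit \<Rightarrow> real" and b B :: "bit \<Rightarrow> bit \<Rightarrow> real"
  assumes a: "\<And>x. \<bar>a x\<bar> \<le> 1" and b: "\<And>x y. \<bar>b x y\<bar> \<le> 1" and p: "0 < p" "p \<le> 1"
    and B: "\<And>y. B 0 y = p * b 0 y + (1 - p) * b 1 y" "\<And>y. B 1 y = (1 - p) * b 0 y + p * b 1 y"
  shows "B 0 1 - B 0 0 + (1 - p) / p * (B 1 0 - B 1 1)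
      + a 0 * B 0 0 + a 0 * B 0 1 + (1 - p) / p * (a 1 * B 1 0 - a 1 * B 1 1)
    \<le> 2 * max p \<bar>- p + 2 * ((1 - p)\<^sup>2 / p)\<bar> + 2 * (1 - p)"
proof -
  define x where "x = (1 - p)\<^sup>2 / p"
  define M where "M = 2 * max p \<bar>- p + 2 * x\<bar> + 2 * (1 - p)"
  define e where "e = (1 - p) / p * (B 1 0 - B 1 1)"
  have e: "e = x * (b 0 0 - b 0 1) + (1 - p) * (b 1 0 - b 1 1)"
    using p by (simp add: e_def B x_def power2_eq_square field_simps)
  have "0 \<le> x"
    using p by (simp add: x_def)
  have mult_le: "r * b i j \<le> \<bar>r\<bar>" "- (r * b i j) \<le> \<bar>r\<bar>" for r i j
  proof -
    have "\<bar>r * b i j\<bar> \<le> \<bar>r\<bar> * 1"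
      unfolding abs_mult by (intro mult_left_mono b) simp
    then show "r * b i j \<le> \<bar>r\<bar>" "- (r * b i j) \<le> \<bar>r\<bar>"
      by linarith+
  qed
  \<comment> \<open>In fact an equality here: both sides are \<open>p\<close> if
    \<open>x \<le> p\<close> and \<open>2 * x - p\<close> otherwise.\<close>
  have m: "\<bar>p - x\<bar> + x \<le> max p \<bar>- p + 2 * x\<bar>"
    by linarith
  have le1: "2 * B 0 1 + 2 * e \<le> M"
  proof -
    have "2 * B 0 1 + 2 * e = 2 * ((p - x) * b 0 1) + 2 * (x * b 0 0) + 2 * ((1 - p) * b 1 0)"
      by (simp add: B e algebra_simps)
    also have "\<dots> \<le> 2 * \<bar>p - x\<bar> + 2 * x + 2 * (1 - p)"
      using mult_le(1)[of "p - x" 0 1] mult_le(1)[of x 0 0] mult_le(1)[of "1 - p" 1 0] p \<open>0 \<le> x\<close>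
      by simp
    finally show ?thesis
      using m by (simp add: M_def)
  qed
  have le2: "- 2 * B 0 0 + 2 * e \<le> M"
  proof -
    have "- 2 * B 0 0 + 2 * e = 2 * (- ((p - x) * b 0 0)) + 2 * (- (x * b 0 1)) + 2 * (- ((1 - p) * b 1 1))"
      by (simp add: B e algebra_simps)
    also have "\<dots> \<le> 2 * \<bar>p - x\<bar> + 2 * x + 2 * (1 - p)"
      using mult_le(2)[of "p - x" 0 0] mult_le(2)[of x 0 1] mult_le(2)[of "1 - p" 1 1] p \<open>0 \<le> x\<close>
      by simp
    finally show ?thesis
      using m by (simp add: M_def)
  qed
  have "2 \<le> M"
    by (simp add: M_def)
  have B_le: "B 0 y \<le> 1" "- B 0 y \<le> 1" for y
    using mult_le(1)[of p 0 y] mult_le(1)[of "1 - p" 1 y] mult_le(2)[of p 0 y]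
      mult_le(2)[of "1 - p" 1 y] p unfolding B by linarith+
  \<comment> \<open>The weights of the value 1 when \<open>a 1\<close> and \<open>a 0\<close> are
    written as mixtures of 1 and -1.\<close>
  define u w where "u = (1 + a 1) / 2" and "w = (1 + a 0) / 2"
  have uw: "0 \<le> u" "u \<le> 1" "0 \<le> w" "w \<le> 1"
    using a[of 0] a[of 1] by (simp_all add: u_def w_def abs_le_iff)
  have convex: "s * t1 + (1 - s) * t2 \<le> M" if "t1 \<le> M" "t2 \<le> M" "0 \<le> s" "s \<le> 1" for s t1 t2
    using convex_bound_le[of t1 M t2 s "1 - s"] that by simp
  have "w * (u * (2 * B 0 1 + 2 * e) + (1 - u) * (2 * B 0 1))
      + (1 - w) * (u * (- 2 * B 0 0 + 2 * e) + (1 - u) * (- 2 * B 0 0)) \<le> M"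
    using B_le[of 0] B_le[of 1] \<open>2 \<le> M\<close> uw by (intro convex le1 le2) linarith+
  also have "w * (u * (2 * B 0 1 + 2 * e) + (1 - u) * (2 * B 0 1))
      + (1 - w) * (u * (- 2 * B 0 0 + 2 * e) + (1 - u) * (- 2 * B 0 0))
      = B 0 1 - B 0 0 + e + a 0 * B 0 0 + a 0 * B 0 1 + a 1 * e"
    by (simp add: u_def w_def field_simps)
  also have "a 1 * e = (1 - p) / p * (a 1 * B 1 0 - a 1 * B 1 1)"
    by (simp add: e_def algebra_simps)
  finally show ?thesis
    by (simp add: e_def M_def x_def)
qed

text \<open>With \<open>r = s = 1/2\<close> the bit that reaches Alice is independent of Bob's
  input, so her response averages to a function of \<open>x\<close> alone, and for each hidden
  variable the correlator factors.\<close>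

lemma signaling_bound:
  assumes p: "0 < p" "p \<le> 1" and P: "P \<in> signaling_local_behaviors (p, p) (1 / 2, 1 / 2)"
  shows "T p P \<le> 2 * max p \<bar>- p + 2 * ((1 - p)\<^sup>2 / p)\<bar> + 2 * (1 - p)"
proof -
  obtain pL :: "nat pmf" and pA pB :: "bit \<Rightarrow> bit \<Rightarrow> nat \<Rightarrow> bit pmf" where
    P: "\<And>a b x y. P a b x y = (\<Sum>\<^sub>\<infinity>l. pmf pL l * (\<Sum>x'\<in>{0,1}. \<Sum>y'\<in>{0,1}.
      channel (1 / 2) (1 / 2) y' y * channel p p x' x * pmf (pA x y' l) a * pmf (pB x' y l) b))"
    using P by (auto simp: signaling_local_behaviors_def)
  define G where "G l a b x y = (\<Sum>x'\<in>{0,1}. \<Sum>y'\<in>{0,1}.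
      channel (1 / 2) (1 / 2) y' y * channel p p x' x * pmf (pA x y' l) a * pmf (pB x' y l) b)"
    for l a b x y
  have G: "G l a b x y = (pmf (pA x 0 l) a + pmf (pA x 1 l) a) / 2
      * (channel p p 0 x * pmf (pB 0 y l) b + channel p p 1 x * pmf (pB 1 y l) b)" for l a b x y
    by (simp add: G_def bit_sum channel_def[of "1 / 2"] field_simps)
  show ?thesis
  proof (rule T_mixture_le[OF P[folded G_def]])
    show "\<bar>G l a b x y\<bar> \<le> 1" for l a b x y
    proof -
      have "channel p p 0 x * pmf (pB 0 y l) b + channel p p 1 x * pmf (pB 1 y l) b \<le> 1"
        using p by (intro convex_bound_le pmf_le_1) (auto simp: channel_def)
      moreover have "0 \<le> channel p p 0 x * pmf (pB 0 y l) b + channel p p 1 x * pmf (pB 1 y l) b"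
        using p by (intro add_nonneg_nonneg mult_nonneg_nonneg) (auto simp: channel_def)
      moreover have "(pmf (pA x 0 l) a + pmf (pA x 1 l) a) / 2 \<le> 1"
        using pmf_le_1[of "pA x 0 l" a] pmf_le_1[of "pA x 1 l" a] by simp
      ultimately show ?thesis
        unfolding G abs_mult by (intro mult_le_one) auto
    qed
    fix l
    let ?a = "\<lambda>x. pmf (pA x 0 l) 0 + pmf (pA x 1 l) 0 - 1"
    let ?b = "\<lambda>x y. 2 * pmf (pB x y l) 0 - 1"
    let ?B = "\<lambda>x y. channel p p 0 x * ?b 0 y + channel p p 1 x * ?b 1 y"
    have "\<bar>?a x\<bar> \<le> 1" for x
      using pmf_le_1[of "pA x 0 l" 0] pmf_nonneg[of "pA x 0 l" 0]
        pmf_le_1[of "pA x 1 l" 0] pmf_nonneg[of "pA x 1 l" 0] by linarith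
    moreover have "\<bar>?b x y\<bar> \<le> 1" for x y
      using pmf_le_1[of "pB x y l" 0] pmf_nonneg[of "pB x y l" 0] by linarith
    moreover have "corr_B (G l) x y = ?B x y" and "corr_AB (G l) x y = ?a x * ?B x y" for x y
      unfolding corr_simps G pmf_bit_one
      by (cases x; simp add: channel_def field_simps)+
    ultimately show "T p (G l) \<le> 2 * max p \<bar>- p + 2 * ((1 - p)\<^sup>2 / p)\<bar> + 2 * (1 - p)"
      using signaling_T_le[of ?a ?b p ?B] p by (simp add: T_def channel_def)
  qed
qed

section \<open>Closed forms of the angles and the identities in \<open>p\<close> behind the quantum
  part\<close>

lemma phi_eq:
  assumes "2 / 5 < p"
  shows "phi p = arctan (- sqrt ((5 * p - 2) / p))"
proof (cases "p = 1 / 2")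
  case True
  have "(5 * p - 2) / p = 1"
    by (simp add: True)
  then show ?thesis
    by (simp add: phi_def True arctan_minus arctan_one)
next
  case False
  have "f2 p / g2 p = - sqrt ((5 * p - 2) / p)"
    using assms by (simp add: f2_def g2_def flip: real_sqrt_divide)
  then show ?thesis
    using False by (simp add: phi_def)
qed

lemma phi_values:
  assumes "2 / 5 < p"
  shows "cos (phi p) = sqrt (p / (6 * p - 2))" "sin (phi p) = - sqrt ((5 * p - 2) / (6 * p - 2))"
proof -
  have "sqrt (1 + (- sqrt ((5 * p - 2) / p))\<^sup>2) = sqrt ((6 * p - 2) / p)"
    using assms by (simp add: field_simps)
  then show "cos (phi p) = sqrt (p / (6 * p - 2))" "sin (phi p) = - sqrt ((5 * p - 2) / (6 * p - 2))"
    using assms unfolding phi_eq[OF assms] cos_arctan sin_arctan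
    by (simp_all add: real_sqrt_divide)
qed

text \<open>On the branch with values in \<open>(0, \<pi>)\<close> the sine is positive and the
  cosine carries the sign of \<open>t\<close>, so one formula covers both cases of the
  definition.\<close>

lemma arctan_pos_values:
  assumes "t \<noteq> 0"
  shows "cos (arctan_pos t) = sgn t / sqrt (1 + t\<^sup>2)" "sin (arctan_pos t) = \<bar>t\<bar> / sqrt (1 + t\<^sup>2)"
  using assms by (auto simp: arctan_pos_def cos_arctan sin_arctan)

lemma theta_values:
  assumes "2 / 5 < p"
  shows "cos (2 * theta p) = - (2 * p - 1) / (3 * p - 1)"
    "sin (2 * theta p) = - sqrt (p * (5 * p - 2)) / (3 * p - 1)"
proof -
  have "cos (2 * theta p) = - (2 * p - 1) / (3 * p - 1)
    \<and> sin (2 * theta p) = - sqrt (p * (5 * p - 2)) / (3 * p - 1)"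
  proof (cases "p = 1 / 2")
    case True
    have "sqrt (1 / 4) = 1 / (2 :: real)"
      by (simp add: real_sqrt_divide)
    then show ?thesis
      by (simp add: theta_def True)
  next
    case False
    define t where "t = sqrt (p * (5 * p - 2)) / (2 * p - 1)"
    have pos: "0 < p * (5 * p - 2)" "0 < 3 * p - 1"
      using assms by auto
    have "f1 p / g1 p = t"
    proof -
      have "sqrt (p * (5 * p - 2)) / - d / (- e / d) = sqrt (p * (5 * p - 2)) / e" if "d \<noteq> 0" for d e
        using that by simp
      from this[of "3 * p - 1" "2 * p - 1"] show ?thesis
        using pos(2) by (simp add: f1_def g1_def t_def add.commute)
    qed
    then have 2: "2 * theta p = arctan_pos t - pi"
      using False by (simp add: theta_def)
    have "t \<noteq> 0"
      using assms False by (simp add: t_def)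
    \<comment> \<open>From \<open>p (5 p - 2) + (2 p - 1)\<^sup>2 = (3 p - 1)\<^sup>2\<close>, a
      perfect square that removes the root.\<close>
    have "1 + t\<^sup>2 = ((3 * p - 1) / (2 * p - 1))\<^sup>2"
      using pos False by (simp add: t_def power_divide divide_simps) (simp add: power2_eq_square algebra_simps)
    then have "sqrt (1 + t\<^sup>2) = (3 * p - 1) / \<bar>2 * p - 1\<bar>"
      using pos by simp
    moreover have "sgn t = sgn (2 * p - 1)"
      using pos by (simp add: t_def sgn_divide)
    moreover have "\<bar>t\<bar> = sqrt (p * (5 * p - 2)) / \<bar>2 * p - 1\<bar>"
      using pos by (simp add: t_def)
    ultimately have eqs: "sgn t / sqrt (1 + t\<^sup>2) = sgn (2 * p - 1) * \<bar>2 * p - 1\<bar> / (3 * p - 1)"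
      "\<bar>t\<bar> / sqrt (1 + t\<^sup>2) = sqrt (p * (5 * p - 2)) / (3 * p - 1)"
      using False by simp_all
    have "cos (2 * theta p) = - (sgn t / sqrt (1 + t\<^sup>2))"
      "sin (2 * theta p) = - (\<bar>t\<bar> / sqrt (1 + t\<^sup>2))"
      unfolding 2 cos_diff sin_diff arctan_pos_values[OF \<open>t \<noteq> 0\<close>] by simp_all
    then show ?thesis
      by (simp only: eqs sgn_mult_abs minus_divide_left)
  qed
  then show "cos (2 * theta p) = - (2 * p - 1) / (3 * p - 1)"
    "sin (2 * theta p) = - sqrt (p * (5 * p - 2)) / (3 * p - 1)"
    by auto
qed

text \<open>All that the operator algebra has to know about \<open>p\<close>: the numerical
  assumptions of \<open>bell_value_saturated\<close>, \<open>bob_frame\<close> and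
  \<open>saturated\<close>, and the value of \<open>2 / R\<close>.\<close>

lemma parameters:
  fixes p :: real
  assumes "2 / 5 < p" "p < 1"
  defines "R \<equiv> sqrt ((3 * p - 1) / (2 * p))" and "c \<equiv> (1 - p) / p"
  shows "0 < R" "R < 1" "c = 2 - 2 * R\<^sup>2" "2 * R * cos (phi p) = 1" "sin (phi p) \<noteq> 0"
    "cos (2 * theta p) = - (1 - c) * cos (phi p) / R" "sin (2 * theta p) = sin (phi p) / R"
    "2 / R = 2 * sqrt 2 * sqrt (p / (3 * p - 1))"
proof -
  have pos: "0 < p" "0 < 3 * p - 1" "0 < 5 * p - 2"
    using assms by auto
  have R2: "R\<^sup>2 = (3 * p - 1) / (2 * p)"
    using pos by (simp add: R_def)
  show "0 < R" "R < 1"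
    using pos assms(2) by (simp_all add: R_def)
  show "c = 2 - 2 * R\<^sup>2"
    unfolding R2 c_def using pos by (simp add: field_simps)
  have cos: "cos (phi p) = 1 / (2 * R)"
  proof -
    have "cos (phi p) = sqrt ((1 / (2 * R))\<^sup>2)"
      unfolding phi_values(1)[OF assms(1)] power_divide power_mult_distrib R2
      using pos by (simp add: field_simps)
    then show ?thesis
      using \<open>0 < R\<close> by simp
  qed
  then show "2 * R * cos (phi p) = 1"
    using \<open>0 < R\<close> by simp
  show "sin (phi p) \<noteq> 0"
    using pos by (simp add: phi_values[OF assms(1)])
  have "- (1 - c) * cos (phi p) / R = - (1 - c) / (2 * R\<^sup>2)"
    by (simp add: cos power2_eq_square)
  also have "\<dots> = - (2 * p - 1) / (3 * p - 1)"
    unfolding R2 c_def using pos by (simp add: field_simps)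
  finally show "cos (2 * theta p) = - (1 - c) * cos (phi p) / R"
    by (simp add: theta_values[OF assms(1)])
  have "sin (phi p) / R = - sqrt ((5 * p - 2) / (6 * p - 2) / ((3 * p - 1) / (2 * p)))"
    by (simp only: phi_values[OF assms(1)] R_def real_sqrt_divide minus_divide_left)
  also have "(5 * p - 2) / (6 * p - 2) / ((3 * p - 1) / (2 * p)) = p * (5 * p - 2) / (3 * p - 1)\<^sup>2"
    using pos by (simp add: divide_simps power2_eq_square)
  also have "- sqrt \<dots> = - sqrt (p * (5 * p - 2)) / (3 * p - 1)"
    using pos by (simp add: real_sqrt_divide)
  finally show "sin (2 * theta p) = sin (phi p) / R"
    by (simp add: theta_values[OF assms(1)])
  show "2 / R = 2 * sqrt 2 * sqrt (p / (3 * p - 1))"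
    using pos by (simp add: R_def real_sqrt_divide real_sqrt_mult)
qed


section \<open>Observables on a tripartite vector\<close>

definition tensor3 :: "('a ell2 \<Rightarrow> 'c ell2) \<Rightarrow> ('b ell2 \<Rightarrow> 'd ell2) \<Rightarrow>
    (('a \<times> 'b) \<times> 'e) ell2 \<Rightarrow> (('c \<times> 'd) \<times> 'e) ell2" where
  "tensor3 S R = (S \<otimes>\<^sub>o R) \<otimes>\<^sub>o id"

lemma tensor3:
  assumes "bounded_clinear S" "bounded_clinear R"
  shows bounded_clinear_tensor3: "bounded_clinear (tensor3 S R)"
    and tensor3_tensor: "tensor3 S R ((x \<otimes>\<^sub>v y) \<otimes>\<^sub>v z) = (S x \<otimes>\<^sub>v R y) \<otimes>\<^sub>v z"
  using assms by (simp_all add: tensor3_def tensor_op)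

lemma tensor3_eqI:
  assumes "bounded_clinear S" "bounded_clinear R" "bounded_clinear U"
    and "\<And>x y z. U ((x \<otimes>\<^sub>v y) \<otimes>\<^sub>v z) = (S x \<otimes>\<^sub>v R y) \<otimes>\<^sub>v z"
  shows "tensor3 S R h = U h"
proof -
  have "tensor3 S R = U"
    by (rule bounded_clinear_eqI_tensor2) (use assms in \<open>simp_all add: tensor3\<close>)
  then show ?thesis by simp
qed

lemma tensor3_id: "tensor3 id id h = h"
  by (simp add: tensor3_def tensor_op_id)

lemma tensor3_compose:
  assumes "bounded_clinear S" "bounded_clinear R" "bounded_clinear S'" "bounded_clinear R'"
  shows "tensor3 S R (tensor3 S' R' h) = tensor3 (\<lambda>x. S (S' x)) (\<lambda>y. R (R' y)) h"
  by (rule tensor3_eqI[symmetric])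
    (use assms in \<open>simp_all add: bounded_clinear_compose tensor3\<close>)

lemma tensor3_add_left:
  assumes "bounded_clinear S" "bounded_clinear S'" "bounded_clinear R"
  shows "tensor3 (\<lambda>x. S x + S' x) R h = tensor3 S R h + tensor3 S' R h"
  by (rule tensor3_eqI) (use assms in \<open>simp_all add: bounded_clinear_add tensor3 tensor_simps\<close>)

lemma tensor3_diff_left:
  assumes "bounded_clinear S" "bounded_clinear S'" "bounded_clinear R"
  shows "tensor3 (\<lambda>x. S x - S' x) R h = tensor3 S R h - tensor3 S' R h"
  by (rule tensor3_eqI) (use assms in \<open>simp_all add: bounded_clinear_diff tensor3 tensor_simps\<close>)

lemma tensor3_scaleR_left:
  assumes "bounded_clinear S" "bounded_clinear R"
  shows "tensor3 (\<lambda>x. r *\<^sub>R S x) R h = r *\<^sub>R tensor3 S R h"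
  by (rule tensor3_eqI) (use assms in \<open>simp_all add: bounded_clinear_scaleR tensor3 tensor_simps\<close>)

lemma tensor3_add_right:
  assumes "bounded_clinear S" "bounded_clinear R" "bounded_clinear R'"
  shows "tensor3 S (\<lambda>x. R x + R' x) h = tensor3 S R h + tensor3 S R' h"
  by (rule tensor3_eqI) (use assms in \<open>simp_all add: bounded_clinear_add tensor3 tensor_simps\<close>)

lemma tensor3_diff_right:
  assumes "bounded_clinear S" "bounded_clinear R" "bounded_clinear R'"
  shows "tensor3 S (\<lambda>x. R x - R' x) h = tensor3 S R h - tensor3 S R' h"
  by (rule tensor3_eqI) (use assms in \<open>simp_all add: bounded_clinear_diff tensor3 tensor_simps\<close>)

lemma tensor3_scaleR_right:
  assumes "bounded_clinear S" "bounded_clinear R"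
  shows "tensor3 S (\<lambda>x. r *\<^sub>R R x) h = r *\<^sub>R tensor3 S R h"
  by (rule tensor3_eqI) (use assms in \<open>simp_all add: bounded_clinear_scaleR tensor3 tensor_simps\<close>)

lemma tensor3_self_adjoint:
  assumes "bounded_clinear S" "bounded_clinear R"
    and "\<And>x y. cinner x (S y) = cinner (S x) y" "\<And>x y. cinner x (R y) = cinner (R x) y"
  shows "cinner x (tensor3 S R y) = cinner (tensor3 S R x) y"
  unfolding tensor3_def
  by (intro tensor_op_self_adjoint bounded_clinear_tensor_op assms bounded_clinear_id) simp

lemma norm_tensor3:
  assumes "bounded_clinear S" "bounded_clinear R"
    and S: "\<And>x y. cinner (S x) (S y) = cinner x y" and R: "\<And>x y. cinner (R x) (R y) = cinner x y"
  shows "norm (tensor3 S R h) = norm h"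
proof -
  have "cinner (tensor3 S R h) (tensor3 S R h) = cinner h h"
  proof (rule cinner_eqI[of _ _ "\<lambda>x. x" "\<lambda>x. x"])
    show "cinner (tensor3 S R (ket i)) (tensor3 S R (ket j)) = cinner (ket i) (ket j)" for i j
    proof (cases i, cases j)
      fix ab cd e f
      assume ij: "i = (ab, e)" "j = (cd, f)"
      show ?thesis
        unfolding ij by (cases ab; cases cd) (simp add: assms tensor3 cinner_tensor flip: ket_tensor)
    qed
  qed (simp_all add: assms tensor3)
  then show ?thesis
    by (simp add: norm_ell2_def)
qed

section \<open>Operators of a single party on the tripartite space\<close>

definition on_A :: "('a ell2 \<Rightarrow> 'a ell2) \<Rightarrow> (('a \<times> 'b) \<times> 'e) ell2 \<Rightarrow> (('a \<times> 'b) \<times> 'e) ell2" where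
  "on_A S = tensor3 S id"

definition on_B :: "('b ell2 \<Rightarrow> 'b ell2) \<Rightarrow> (('a \<times> 'b) \<times> 'e) ell2 \<Rightarrow> (('a \<times> 'b) \<times> 'e) ell2" where
  "on_B R = tensor3 id R"

lemma on_A_on_B:
  assumes "bounded_clinear S" "bounded_clinear R"
  shows "on_A S (on_B R h) = tensor3 S R h" "on_B R (on_A S h) = tensor3 S R h"
  using assms by (simp_all add: on_A_def on_B_def tensor3_compose)

lemma on_A_simps:
  assumes "bounded_clinear S" "bounded_clinear R"
  shows "on_A (\<lambda>x. S x + R x) h = on_A S h + on_A R h"
    "on_A (\<lambda>x. S x - R x) h = on_A S h - on_A R h"
  using assms by (simp_all add: on_A_def tensor3_add_left tensor3_diff_left)

lemma on_A_scaleR: "bounded_clinear S \<Longrightarrow> on_A (\<lambda>x. r *\<^sub>R S x) h = r *\<^sub>R on_A S h"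
  by (simp add: on_A_def tensor3_scaleR_left)

lemma on_A_compose:
  "bounded_clinear S \<Longrightarrow> bounded_clinear R \<Longrightarrow> on_A (\<lambda>x. S (R x)) h = on_A S (on_A R h)"
  by (simp add: on_A_def tensor3_compose id_def)

lemma on_B_simps:
  assumes "bounded_clinear S" "bounded_clinear R"
  shows "on_B (\<lambda>x. S x + R x) h = on_B S h + on_B R h"
    "on_B (\<lambda>x. S x - R x) h = on_B S h - on_B R h"
  using assms by (simp_all add: on_B_def tensor3_add_right tensor3_diff_right)

lemma on_B_scaleR: "bounded_clinear S \<Longrightarrow> on_B (\<lambda>x. r *\<^sub>R S x) h = r *\<^sub>R on_B S h"
  by (simp add: on_B_def tensor3_scaleR_right)

lemma on_B_compose:
  "bounded_clinear S \<Longrightarrow> bounded_clinear R \<Longrightarrow> on_B (\<lambda>x. S (R x)) h = on_B S (on_B R h)"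
  by (simp add: on_B_def tensor3_compose id_def)

lemma on_A_id: "on_A id h = h" "on_A (\<lambda>x. x) h = h" and on_B_id: "on_B id h = h" "on_B (\<lambda>x. x) h = h"
  using tensor3_id[of h] by (simp_all add: on_A_def on_B_def id_def)

lemma bounded_clinear_on_A: "bounded_clinear S \<Longrightarrow> bounded_clinear (on_A S)"
  and bounded_clinear_on_B: "bounded_clinear S \<Longrightarrow> bounded_clinear (on_B S)"
  by (simp_all add: on_A_def on_B_def tensor3)

text \<open>\<open>on_B w h = 0\<close> means that every vector obtained from \<open>h\<close> by
  fixing basis indices of Alice and of the environment lies in the kernel of \<open>w\<close>.
  \<open>P\<close> fixes each of these vectors and hence \<open>h\<close>.\<close>

lemma on_B_fixed_of_kernel:
  fixes w P :: "'b ell2 \<Rightarrow> 'b ell2" and h :: "(('a \<times> 'b) \<times> 'e) ell2"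
  assumes w: "bounded_clinear w" and P: "bounded_clinear P"
    and fixed: "\<And>x. w x = 0 \<Longrightarrow> P x = x" and h: "on_B w h = 0"
  shows "on_B P h = h"
proof (rule slice_eqI)
  fix e
  \<comment> \<open>\<open>slice\<close> contracts the second factor, so Alice's index has to be
    moved there.\<close>
  let ?swap = "reindex prod.swap :: ('a \<times> 'b) ell2 \<Rightarrow> ('b \<times> 'a) ell2"
  have bij: "bij (prod.swap :: 'b \<times> 'a \<Rightarrow> 'a \<times> 'b)"
    by simp
  have sw: "slice (?swap ((id \<otimes>\<^sub>o R) g)) i = R (slice (?swap g) i)"
    if R: "bounded_clinear R" for R :: "'b ell2 \<Rightarrow> 'b ell2" and g i
  proof -
    have "(\<lambda>g. slice (?swap ((id \<otimes>\<^sub>o R) g)) i) = (\<lambda>g. R (slice (?swap g) i))"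
      using R bounded_clinear_reindex[OF bij]
      by (intro bounded_clinear_eqI_tensor bounded_clinear_compose[OF bounded_clinear_slice]
          bounded_clinear_compose[OF R] bounded_clinear_compose[OF bounded_clinear_reindex[OF bij]])
        (simp_all add: tensor_op tensor_swap slice_tensor bounded_clinear_simps[OF R]
          bounded_clinear_compose[OF bounded_clinear_slice])
    then show ?thesis by meson
  qed
  have on_B: "slice (on_B R h) e = (id \<otimes>\<^sub>o R) (slice h e)" if "bounded_clinear R" for R
    using that by (simp add: on_B_def tensor3_def slice_tensor_op tensor_op)
  let ?g = "slice h e"
  have "(id \<otimes>\<^sub>o w) ?g = 0"
    using on_B[OF w] h by (simp add: bounded_clinear_simps[OF bounded_clinear_slice])
  then have "w (slice (?swap ?g) i) = 0" for i
    using sw[OF w, of ?g i]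
    by (simp add: bounded_clinear_simps[OF bounded_clinear_slice]
        bounded_clinear_simps[OF bounded_clinear_reindex[OF bij]])
  then have "slice (?swap ((id \<otimes>\<^sub>o P) ?g)) i = slice (?swap ?g) i" for i
    by (simp add: sw[OF P] fixed)
  then have "?swap ((id \<otimes>\<^sub>o P) ?g) = ?swap ?g"
    by (rule slice_eqI)
  then have "(id \<otimes>\<^sub>o P) ?g = ?g"
    using coord_reindex[OF bij] by (intro coord_eqI) (metis prod.swap_def surj_pair swap_swap)
  then show "slice (on_B P h) e = ?g"
    by (simp add: on_B[OF P])
qed

lemma projective_measurement_observable:
  assumes "projective_measurement M"
  shows "bounded_clinear (M a)" "bounded_clinear (observable M)"
    "observable M (observable M v) = v"
    "cinner x (M a y) = cinner (M a x) y"
    "cinner x (observable M y) = cinner (observable M x) y"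
proof -
  have M: "bounded_clinear (M a)" "M a (M a x) = M a x" "cinner x (M a y) = cinner (M a x) y"
    and M1: "M 1 x = x - M 0 x" for a x y
    using assms by (auto simp: projective_measurement_def projector_def algebra_simps)
  show "bounded_clinear (M a)" "cinner x (M a y) = cinner (M a x) y"
    by (fact M)+
  show "bounded_clinear (observable M)"
    unfolding observable_def[abs_def] by (intro bounded_clinear_diff M)
  show "observable M (observable M v) = v"
    by (simp add: observable_def M1 M bounded_clinear_simps[OF M(1)])
  show "cinner x (observable M y) = cinner (observable M x) y"
    by (simp add: observable_def cinner_simps M)
qed

lemma commuting_observables_strategy:
  assumes "\<And>x. projective_measurement (M x)" "\<And>y. projective_measurement (N y)"
  shows "commuting_observables (\<lambda>x. on_A (observable (M x)) :: (('a \<times> 'b) \<times> 'e) ell2 \<Rightarrow> _)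
    (\<lambda>y. on_B (observable (N y)))"
proof
  note M = projective_measurement_observable[OF assms(1)]
  note N = projective_measurement_observable[OF assms(2)]
  fix x y and u v :: "(('a \<times> 'b) \<times> 'e) ell2"
  show "bounded_clinear (on_A (observable (M x)) :: (('a \<times> 'b) \<times> 'e) ell2 \<Rightarrow> _)"
    "bounded_clinear (on_B (observable (N y)) :: (('a \<times> 'b) \<times> 'e) ell2 \<Rightarrow> _)"
    by (simp_all add: bounded_clinear_on_A bounded_clinear_on_B M N)
  show "on_A (observable (M x)) (on_A (observable (M x)) v) = v"
    by (simp add: M on_A_id flip: on_A_compose)
  show "on_B (observable (N y)) (on_B (observable (N y)) v) = v"
    by (simp add: N on_B_id flip: on_B_compose)
  show "inner u (on_A (observable (M x)) v) = inner (on_A (observable (M x)) u) v"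
    unfolding inner_ell2_def on_A_def by (subst tensor3_self_adjoint) (simp_all add: M)
  show "inner u (on_B (observable (N y)) v) = inner (on_B (observable (N y)) u) v"
    unfolding inner_ell2_def on_B_def by (subst tensor3_self_adjoint) (simp_all add: N)
  show "on_A (observable (M x)) (on_B (observable (N y)) v)
      = on_B (observable (N y)) (on_A (observable (M x)) v)"
    by (simp add: on_A_on_B M N)
qed

text \<open>Purification turns every probability into an expectation value on \<open>\<Psi>\<close>.
  In \<open>corr_B\<close>, completeness of Alice's measurement removes the dependence on
  \<open>x\<close>; this is where non-signaling enters.\<close>

lemma T_quantum_behavior:
  fixes \<Psi> :: "(('a \<times> 'b) \<times> 'e) ell2"
  assumes "quantum_strategy \<rho> M N" and pur: "purification \<Psi> \<rho>"
  shows "T p (quantum_behavior \<rho> M N)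
    = commuting_observables.bell_value (\<lambda>x. on_A (observable (M x))) (\<lambda>y. on_B (observable (N y)))
        ((1 - p) / p) \<Psi>"
proof -
  have pm: "\<And>x. projective_measurement (M x)" "\<And>y. projective_measurement (N y)"
    using assms(1) by (simp_all add: quantum_strategy_def)
  note M = projective_measurement_observable[OF pm(1)]
  note N = projective_measurement_observable[OF pm(2)]
  interpret commuting_observables "\<lambda>x. on_A (observable (M x)) :: (('a \<times> 'b) \<times> 'e) ell2 \<Rightarrow> _"
    "\<lambda>y. on_B (observable (N y))"
    by (rule commuting_observables_strategy[OF pm])
  have beh: "quantum_behavior \<rho> M N a b x y = inner \<Psi> (on_A (M x a) (on_B (N y b) \<Psi>))" for a b x y
  proof -
    have "trace ((M x a \<otimes>\<^sub>o N y b) \<circ> \<rho>) = cinner \<Psi> (((M x a \<otimes>\<^sub>o N y b) \<otimes>\<^sub>o id) \<Psi>)"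
      by (intro trace_purification[OF _ _ pur] tensor_op tensor_op_self_adjoint M N)
    then show ?thesis
      by (simp add: quantum_behavior_def inner_ell2_def on_A_on_B M N tensor3_def)
  qed
  have M1: "on_A (M x 1) h = h - on_A (M x 0) h" for x and h :: "(('a \<times> 'b) \<times> 'e) ell2"
  proof -
    have "M x 1 = (\<lambda>v. v - M x 0 v)"
      using pm(1)[of x] by (auto simp: projective_measurement_def fun_eq_iff algebra_simps)
    then show ?thesis
      by (simp add: on_A_simps M on_A_id)
  qed
  have O_A: "on_A (observable (M x)) h = on_A (M x 0) h - on_A (M x 1) h"
    for x and h :: "(('a \<times> 'b) \<times> 'e) ell2"
    unfolding observable_def by (simp add: on_A_simps M)
  have O_B: "on_B (observable (N y)) h = on_B (N y 0) h - on_B (N y 1) h"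
    for y and h :: "(('a \<times> 'b) \<times> 'e) ell2"
    unfolding observable_def by (simp add: on_B_simps N)
  note lin = bounded_clinear_simps[OF bounded_clinear_on_A[OF M(1)]]
  have B: "corr_B (quantum_behavior \<rho> M N) x y = inner \<Psi> (on_B (observable (N y)) \<Psi>)" for x y
    by (simp add: corr_simps beh M1 O_B inner_simps)
  have AB: "corr_AB (quantum_behavior \<rho> M N) x y
      = inner \<Psi> (on_A (observable (M x)) (on_B (observable (N y)) \<Psi>))" for x y
    by (simp add: corr_simps beh O_A O_B lin inner_simps)
  show ?thesis
    unfolding T_def B AB bell_value_def S_def D_def
    by (simp add: A_simps inner_simps algebra_simps)
qed

lemma quantum_bound:
  fixes \<rho> :: "('a \<times> 'b) ell2 \<Rightarrow> ('a \<times> 'b) ell2"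
  assumes "2 / 5 < p" "p < 1" and qs: "quantum_strategy \<rho> M N"
  shows "T p (quantum_behavior \<rho> M N) \<le> 2 * sqrt 2 * sqrt (p / (3 * p - 1))"
proof -
  have pm: "\<And>x. projective_measurement (M x)" "\<And>y. projective_measurement (N y)"
    and dens: "density_operator \<rho>"
    using qs by (simp_all add: quantum_strategy_def)
  obtain \<Psi> :: "(('a \<times> 'b) \<times> nat) ell2" where \<Psi>: "purification \<Psi> \<rho>"
    using purification_exists[OF dens] by blast
  note par = parameters[OF assms(1,2)]
  show ?thesis
    using commuting_observables.bell_value_le[OF commuting_observables_strategy[OF pm] par(1-3), where v = \<Psi>]
    by (simp only: T_quantum_behavior[OF qs \<Psi>] norm_purification[OF dens \<Psi>] par(8)) simp
qed


section \<open>The two-qubit strategy\<close>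

lemma bij_reorder_map: "bij (\<lambda>(((q, i), (r, j)), e). ((q, r), ((i, j), e)))"
  by (rule o_bij[of "\<lambda>((q, r), ((i, j), e)). (((q, i), (r, j)), e)"]) (auto simp: fun_eq_iff)

lemma bounded_clinear_reorder: "bounded_clinear reorder"
  unfolding reorder_def by (rule bounded_clinear_reindex[OF bij_reorder_map])

lemma reorder_tensor:
  "reorder ((x \<otimes>\<^sub>v y) \<otimes>\<^sub>v ((a \<otimes>\<^sub>v b) \<otimes>\<^sub>v c)) = ((x \<otimes>\<^sub>v a) \<otimes>\<^sub>v (y \<otimes>\<^sub>v b)) \<otimes>\<^sub>v c"
  by (rule coord_eqI)
    (auto simp: reorder_def coord_reindex[OF bij_reorder_map] mult_ac split: prod.splits)

lemma bit_pair_expansion: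
  fixes x :: "(bit \<times> bit) ell2"
  shows "x = coord x (0, 0) *\<^sub>C (ket 0 \<otimes>\<^sub>v ket 0) + coord x (0, 1) *\<^sub>C (ket 0 \<otimes>\<^sub>v ket 1)
    + coord x (1, 0) *\<^sub>C (ket 1 \<otimes>\<^sub>v ket 0) + coord x (1, 1) *\<^sub>C (ket 1 \<otimes>\<^sub>v ket 1)"
proof (rule coord_eqI)
  fix i :: "bit \<times> bit"
  obtain q r where "i = (q, r)" by (cases i)
  then show "coord x i = coord (coord x (0, 0) *\<^sub>C (ket 0 \<otimes>\<^sub>v ket 0)
    + coord x (0, 1) *\<^sub>C (ket 0 \<otimes>\<^sub>v ket 1) + coord x (1, 0) *\<^sub>C (ket 1 \<otimes>\<^sub>v ket 0)
    + coord x (1, 1) *\<^sub>C (ket 1 \<otimes>\<^sub>v ket 1)) i"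
    by (cases q; cases r) (simp_all add: coord_ket)
qed

lemma bit_coord_eqI: "coord x 0 = coord y 0 \<Longrightarrow> coord x 1 = coord y 1 \<Longrightarrow> x = y"
  for x y :: "bit ell2"
  by (rule coord_eqI) (metis bit.exhaust)

lemma bounded_clinear_sigma: "bounded_clinear sigma_X" "bounded_clinear sigma_Z"
  unfolding sigma_X_def[abs_def] sigma_Z_def[abs_def] by (intro bounded_clinear_intros)+

lemma bounded_clinear_obs_A: "bounded_clinear (obs_A x)"
  and bounded_clinear_obs_B: "bounded_clinear (obs_B \<phi> y)"
  by (simp_all add: obs_A_def obs_B_def bounded_clinear_sigma bounded_clinear_add bounded_clinear_scaleR)

lemma coord_sigma:
  "coord (sigma_X v) q = coord v (q + 1)" "coord (sigma_Z v) q = sgn_bit q * coord v q"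
  by (cases q; simp add: sigma_X_def sigma_Z_def coord_ket sgn_bit_def)+

lemma coord_obs_A: "coord (obs_A x v) q
    = (if x = 0 then coord v (q + 1) else sgn_bit q * coord v q)"
  by (simp add: obs_A_def coord_sigma)

lemma coord_obs_B: "coord (obs_B \<phi> y v) q
    = complex_of_real (sgn_bit y * cos \<phi> * sgn_bit q) * coord v q
      + complex_of_real (sin \<phi>) * coord v (q + 1)"
  by (simp add: obs_B_def coord_sigma sgn_bit_def scaleR_conv_of_real)

lemma bit_add_self [simp]: "(b :: bit) + 1 + 1 = b"
  by (cases b) simp_all

lemma obs_involution:
  "obs_A x (obs_A x v) = v" "obs_B \<phi> y (obs_B \<phi> y v) = v"
proof -
  show "obs_A x (obs_A x v) = v"
    by (rule coord_eqI) (auto simp: coord_obs_A sgn_bit_def)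
  show "obs_B \<phi> y (obs_B \<phi> y v) = v"
  proof (rule coord_eqI)
    fix q
    have "complex_of_real (cos \<phi>) * complex_of_real (cos \<phi>)
        + complex_of_real (sin \<phi>) * complex_of_real (sin \<phi>) = 1"
      by (metis of_real_1 of_real_add of_real_mult power2_eq_square sin_cos_squared_add2)
    then have cs: "complex_of_real (cos \<phi>) * (complex_of_real (cos \<phi>) * z)
        + complex_of_real (sin \<phi>) * (complex_of_real (sin \<phi>) * z) = z" for z
      by (simp flip: mult.assoc distrib_right)
    show "coord (obs_B \<phi> y (obs_B \<phi> y v)) q = coord v q"
      using cs[of "coord v q"] by (cases q; cases y) (simp_all add: coord_obs_B sgn_bit_def algebra_simps)
  qed
qed

lemma cinner_bit: "cinner x y = cnj (coord x 0) * coord y 0 + cnj (coord x 1) * coord y (1 :: bit)"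
proof -
  have UNIV_bit: "(UNIV :: bit set) = {0, 1}"
    by (auto intro: bit.exhaust)
  show ?thesis
    unfolding cinner_def UNIV_bit by simp
qed

lemma obs_symmetric:
  "cinner x (obs_A s y) = cinner (obs_A s x) y" "cinner x (obs_B \<phi> s y) = cinner (obs_B \<phi> s x) y"
  by (simp_all add: cinner_bit coord_obs_A coord_obs_B sgn_bit_def algebra_simps)

definition spectral_projector :: "('a ell2 \<Rightarrow> 'a ell2) \<Rightarrow> bit \<Rightarrow> 'a ell2 \<Rightarrow> 'a ell2" where
  "spectral_projector U a v = (1 / 2) *\<^sub>R (v + sgn_bit a *\<^sub>R U v)"

lemma spectral_projector:
  assumes "bounded_clinear U" "\<And>v. U (U v) = v" "\<And>x y. cinner x (U y) = cinner (U x) y"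
  shows "projective_measurement (spectral_projector U)" "observable (spectral_projector U) = U"
proof -
  note U = bounded_clinear_simps[OF assms(1)]
  show "observable (spectral_projector U) = U"
    by (rule ext) (simp add: observable_def spectral_projector_def sgn_bit_def flip: scaleR_diff_right)
  have "bounded_clinear (spectral_projector U a)" for a
    unfolding spectral_projector_def[abs_def] by (intro bounded_clinear_intros assms(1))
  moreover have "spectral_projector U a (spectral_projector U a v) = spectral_projector U a v" for a v
    by (rule coord_eqI)
      (simp add: spectral_projector_def U assms(2) sgn_bit_def scaleR_conv_of_real field_simps)
  moreover have "cinner x (spectral_projector U a y) = cinner (spectral_projector U a x) y" for a x y
    by (simp add: spectral_projector_def cinner_simps assms(3))
  moreover have "spectral_projector U 0 v + spectral_projector U 1 v = v" for v
    by (simp add: spectral_projector_def sgn_bit_def flip: scaleR_add_right)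
  ultimately show "projective_measurement (spectral_projector U)"
    by (simp add: projective_measurement_def projector_def)
qed

lemma norm_psi_theta: "norm (psi_theta \<theta>) = 1"
proof -
  have "complex_of_real ((norm (psi_theta \<theta>))\<^sup>2)
      = complex_of_real (cos \<theta> * cos \<theta> + sin \<theta> * sin \<theta>)"
    unfolding cinner_self_norm[symmetric] of_real_add of_real_mult
    by (simp add: psi_theta_def cinner_simps cinner_tensor cinner_ket_left coord_ket)
  then have "(norm (psi_theta \<theta>))\<^sup>2 = 1"
    by (simp only: of_real_eq_iff) simp
  then show ?thesis
    by (simp add: power2_eq_1_iff) (metis norm_ge_zero not_one_le_zero neg_0_le_iff_le)
qed

lemma density_operator_ketbra:
  assumes "norm x = 1"
  shows "density_operator (ketbra x)"
proof -
  have "bounded_clinear (ketbra x)"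
    unfolding ketbra_def[abs_def] by (rule bounded_clinear_cinner_scaleC)
  moreover have "cinner y (ketbra x y) = complex_of_real ((cmod (cinner x y))\<^sup>2)" for y
    unfolding ketbra_def cinner_scaleC_right complex_norm_square by (metis cinner_commute)
  then have "cinner y (ketbra x y) \<in> \<real>\<^sub>\<ge>\<^sub>0" for y
    by (simp only: nonneg_Reals_of_real_iff zero_le_power2)
  moreover have "trace (ketbra x) = cinner x x"
    unfolding trace_def cinner_def[of x x]
    by (simp add: ketbra_def cinner_scaleC_right cinner_ket_left cinner_ket_right mult.commute)
  then have "trace (ketbra x) = 1"
    using assms by (simp add: cinner_self_norm)
  ultimately show ?thesis
    by (simp add: density_operator_def)
qed

lemma purification_ketbra: "purification (x \<otimes>\<^sub>v ket ()) (ketbra x)"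
  by (simp add: purification_def ketbra_def cinner_scaleC_right cinner_tensor cinner_ket_left
      coord_ket UNIV_unit)

text \<open>The value is not computed from probabilities: both squares in \<open>bell_sos\<close>
  vanish on the state, which leaves \<open>2 / R\<close>.\<close>

lemma two_qubit_strategy:
  assumes "2 / 5 < p" "p < 1"
  defines "M \<equiv> \<lambda>x. spectral_projector (obs_A x)" and "N \<equiv> \<lambda>y. spectral_projector (obs_B (phi p) y)"
  shows "quantum_strategy (ketbra (psi_theta (theta p))) M N"
    "observable (M x) = obs_A x" "observable (N y) = obs_B (phi p) y"
    "T p (quantum_behavior (ketbra (psi_theta (theta p))) M N) = 2 * sqrt 2 * sqrt (p / (3 * p - 1))"
proof -
  note A = spectral_projector[OF bounded_clinear_obs_A obs_involution(1) obs_symmetric(1)]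
  note B = spectral_projector[OF bounded_clinear_obs_B obs_involution(2) obs_symmetric(2)]
  have obs: "observable (M x) = obs_A x" "observable (N y) = obs_B (phi p) y" for x y
    by (simp_all add: M_def N_def A B)
  then show "observable (M x) = obs_A x" "observable (N y) = obs_B (phi p) y"
    by auto
  show qs: "quantum_strategy (ketbra (psi_theta (theta p))) M N"
    by (simp add: quantum_strategy_def density_operator_ketbra norm_psi_theta M_def N_def A B)
  define R c \<phi> \<theta> where "R = sqrt ((3 * p - 1) / (2 * p))" and "c = (1 - p) / p"
    and "\<phi> = phi p" and "\<theta> = theta p"
  note par = parameters[OF assms(1,2), folded R_def c_def \<phi>_def \<theta>_def]
  let ?\<Psi> = "psi_theta \<theta> \<otimes>\<^sub>v ket ()"
  interpret commuting_observables "\<lambda>x. on_A (observable (M x)) :: ((bit \<times> bit) \<times> unit) ell2 \<Rightarrow> _"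
    "\<lambda>y. on_B (observable (N y))"
    by (rule commuting_observables_strategy) (simp_all add: M_def N_def A B)
  have ketA: "obs_A 0 (ket 0) = ket 1" "obs_A 0 (ket 1) = ket 0"
    "obs_A 1 (ket 0) = ket 0" "obs_A 1 (ket 1) = - ket 1"
    by (rule bit_coord_eqI; simp add: coord_obs_A coord_ket sgn_bit_def)+
  have ketB: "obs_B \<phi> y (ket 0) = (sgn_bit y * cos \<phi>) *\<^sub>R ket 0 + sin \<phi> *\<^sub>R ket 1"
    "obs_B \<phi> y (ket 1) = - (sgn_bit y * cos \<phi>) *\<^sub>R ket 1 + sin \<phi> *\<^sub>R ket 0" for y
    by (rule bit_coord_eqI; simp add: coord_obs_B coord_ket sgn_bit_def scaleR_conv_of_real)+
  have opA: "on_A (obs_A x) ((u \<otimes>\<^sub>v v) \<otimes>\<^sub>v w) = (obs_A x u \<otimes>\<^sub>v v) \<otimes>\<^sub>v w"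
    and opB: "on_B (obs_B \<phi> x) ((u \<otimes>\<^sub>v v) \<otimes>\<^sub>v w) = (u \<otimes>\<^sub>v obs_B \<phi> x v) \<otimes>\<^sub>v w" for x u v w
    by (simp_all add: on_A_def on_B_def tensor3 bounded_clinear_obs_A bounded_clinear_obs_B)
  \<comment> \<open>In this basis \<open>S\<close> flips Bob's bit and \<open>D\<close> is diagonal,
    so the saturation relations become identities between the coefficients of \<open>k 0 0\<close>
    and \<open>k 1 1\<close>.\<close>
  define k where "k q r = (ket q \<otimes>\<^sub>v ket r) \<otimes>\<^sub>v ket ()" for q r :: bit
  have \<Psi>: "?\<Psi> = cos \<theta> *\<^sub>R k 0 0 + sin \<theta> *\<^sub>R k 1 1"
    by (simp add: psi_theta_def k_def tensor_simps)
  have kA: "on_A (observable (M 0)) (k q r) = k (q + 1) r" "on_A (observable (M 1)) (k q r) = sgn_bit q *\<^sub>R k q r"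
    and kS: "S (k q r) = (2 * sin \<phi>) *\<^sub>R k q (r + 1)" and kD: "D (k q r) = (2 * cos \<phi> * sgn_bit r) *\<^sub>R k q r"
    for q r
    unfolding S_def D_def unfolding obs \<phi>_def[symmetric] k_def opA opB
    by (cases q; cases r;
        simp add: ketA ketB tensor_simps sgn_bit_def algebra_simps flip: scaleR_2; fail)+
  have sin2: "sin \<phi> = 2 * R * sin \<theta> * cos \<theta>"
    using par(1,7) unfolding sin_double by (simp add: field_simps)
  have cos2: "(1 - c) * (2 * cos \<phi>) = - 2 * R * cos (2 * \<theta>)"
    using par(1,6) by (simp add: field_simps)
  have cosR: "2 * cos \<phi> = 1 / R"
    using par(1,4) by (simp add: field_simps)
  have 1: "on_A (observable (M 1)) ?\<Psi> = R *\<^sub>R D ?\<Psi>"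
    using par(1) unfolding \<Psi> A_simps D_simps kA kD cosR by (simp add: sgn_bit_def scaleR_add_right scaleR_diff_right)
  have 2: "on_A (observable (M 0)) (S ?\<Psi>) = (2 * R) *\<^sub>R ?\<Psi> + (1 - c) *\<^sub>R D ?\<Psi>"
  proof -
    have "on_A (observable (M 0)) (S ?\<Psi>)
        = (2 * sin \<phi> * cos \<theta>) *\<^sub>R k 1 1 + (2 * sin \<phi> * sin \<theta>) *\<^sub>R k 0 0"
      unfolding \<Psi> A_simps S_simps kA kS by (simp add: mult_ac)
    also have "2 * sin \<phi> * cos \<theta> = (2 * R - (1 - c) * (2 * cos \<phi>)) * sin \<theta>"
      unfolding cos2 cos_double_cos sin2 by (simp add: power2_eq_square algebra_simps)
    also have "2 * sin \<phi> * sin \<theta> = (2 * R + (1 - c) * (2 * cos \<phi>)) * cos \<theta>"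
      unfolding cos2 cos_double_sin sin2 by (simp add: power2_eq_square algebra_simps)
    finally show ?thesis
      unfolding \<Psi> A_simps D_simps kD by (simp add: sgn_bit_def algebra_simps)
  qed
  have "bell_value c ?\<Psi> = 2 / R * (norm ?\<Psi>)\<^sup>2"
    using bell_sos[OF par(1,3), of ?\<Psi>] by (simp add: 1 2)
  then have "bell_value c ?\<Psi> = 2 / R"
    by (simp add: norm_tensor norm_psi_theta)
  moreover have "T p (quantum_behavior (ketbra (psi_theta \<theta>)) M N) = bell_value c ?\<Psi>"
    using T_quantum_behavior[OF qs purification_ketbra] by (simp add: c_def \<theta>_def)
  ultimately show "T p (quantum_behavior (ketbra (psi_theta (theta p))) M N)
      = 2 * sqrt 2 * sqrt (p / (3 * p - 1))"
    by (simp add: par(8) \<theta>_def)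
qed

lemma coord_target:
  "coord ((op_or_id obs_A s \<otimes>\<^sub>o op_or_id (obs_B \<phi>) t) (psi_theta \<theta>)) (q, r)
    = complex_of_real (cos \<theta> * alice_matrix s q 0 * bob_matrix \<phi> t r 0
       + sin \<theta> * alice_matrix s q 1 * bob_matrix \<phi> t r 1)"
proof -
  have A: "bounded_clinear (op_or_id obs_A s)" and B: "bounded_clinear (op_or_id (obs_B \<phi>) t)"
    by (simp_all add: op_or_id_def bounded_clinear_obs_A bounded_clinear_obs_B split: option.split)
  have "coord (op_or_id obs_A s (ket q')) q = complex_of_real (alice_matrix s q q')" for q'
    by (cases q; cases q')
      (simp_all add: op_or_id_def alice_matrix_def coord_obs_A coord_ket sgn_bit_def split: option.split)
  moreover have "coord (op_or_id (obs_B \<phi>) t (ket r')) r = complex_of_real (bob_matrix \<phi> t r r')" for r'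
    by (cases r; cases r')
      (simp_all add: op_or_id_def bob_matrix_def coord_obs_B coord_ket sgn_bit_def split: option.split)
  ultimately show ?thesis
    by (simp add: psi_theta_def bounded_clinear_simps[OF bounded_clinear_tensor_op[OF A B]]
        tensor_op_tensor[OF A B] scaleR_conv_of_real mult.assoc)
qed

text \<open>The three terms lie in orthogonal sectors, labelled by the extracted qubit and the flag,
  so squared norms add.\<close>

lemma isometry_ancilla:
  fixes W0 W1 W2 :: "'a ell2 \<Rightarrow> 'a ell2"
  assumes W: "bounded_clinear W0" "bounded_clinear W1" "bounded_clinear W2"
    and norm: "\<And>v. (norm (W0 v))\<^sup>2 + (norm (W1 v))\<^sup>2 + (norm (W2 v))\<^sup>2 = (norm v)\<^sup>2"
  shows "isometry (\<lambda>v. ket (0 :: bit) \<otimes>\<^sub>v ket (0 :: bit) \<otimes>\<^sub>v W0 v + ket 1 \<otimes>\<^sub>v ket 0 \<otimes>\<^sub>v W1 v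
    + ket 0 \<otimes>\<^sub>v ket 1 \<otimes>\<^sub>v W2 v)"
    (is "isometry ?V")
proof -
  have "norm (?V v) = norm v" for v
  proof -
    have "cinner (?V v) (?V v) = cinner (W0 v) (W0 v) + cinner (W1 v) (W1 v) + cinner (W2 v) (W2 v)"
      by (simp add: cinner_simps cinner_tensor cinner_ket_left coord_ket)
    then have "complex_of_real ((norm (?V v))\<^sup>2)
        = complex_of_real ((norm (W0 v))\<^sup>2 + (norm (W1 v))\<^sup>2 + (norm (W2 v))\<^sup>2)"
      by (simp only: cinner_self_norm of_real_add)
    then have "(norm (?V v))\<^sup>2 = (norm v)\<^sup>2"
      by (simp only: of_real_eq_iff norm)
    then show ?thesis by simp
  qed
  moreover have "bounded_clinear ?V"
    by (intro bounded_clinear_add bounded_clinear_tensor_right W)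
  ultimately show ?thesis
    by (simp add: isometry_def)
qed

lemma projector_pythagoras:
  assumes "projector P"
  shows "(norm (P v))\<^sup>2 + (norm (v - P v))\<^sup>2 = (norm v)\<^sup>2"
proof -
  have "inner (P v) (P v) = inner v (P v)" "inner (P v) v = inner v (P v)"
    using assms by (auto simp: projector_def inner_ell2_def)
  then show ?thesis
    by (simp add: power2_norm_eq_inner inner_simps)
qed


section \<open>Self-testing\<close>

text \<open>Sets the flag to 0, the sector of the auxiliary space that carries the residual
  state.\<close>

definition ancilla :: "'a ell2 \<Rightarrow> (bit \<times> 'a) ell2" where
  "ancilla v = ket 0 \<otimes>\<^sub>v v"

lemma ancilla: "bounded_clinear ancilla" "cinner (ancilla x) (ancilla y) = cinner x y"
  unfolding ancilla_def[abs_def]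
  by (simp_all add: bounded_clinear_tensor_right cinner_tensor cinner_ket_left coord_ket)

lemma tensor3_ket_ancilla:
  "tensor3 (\<lambda>v. ket q \<otimes>\<^sub>v ancilla v) (\<lambda>v. ket r \<otimes>\<^sub>v ancilla v) h
    = reorder ((ket q \<otimes>\<^sub>v ket r) \<otimes>\<^sub>v tensor3 ancilla ancilla h)"
  by (rule tensor3_eqI)
    (simp_all add: bounded_clinear_tensor_right ancilla tensor3 reorder_tensor
      bounded_clinear_compose[OF bounded_clinear_reorder])

lemma self_test:
  fixes \<rho> :: "('a \<times> 'b) ell2 \<Rightarrow> ('a \<times> 'b) ell2" and \<Psi> :: "(('a \<times> 'b) \<times> 'e) ell2"
  assumes p: "2 / 5 < p" "p < 1" and qs: "quantum_strategy \<rho> M N"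
    and T: "T p (quantum_behavior \<rho> M N) = 2 * sqrt 2 * sqrt (p / (3 * p - 1))"
    and \<Psi>: "purification \<Psi> \<rho>"
  shows "self_test_extraction \<Psi> (\<lambda>x. observable (M x)) (\<lambda>y. observable (N y))
    (psi_theta (theta p)) obs_A (obs_B (phi p))"
proof -
  define R c \<phi> \<theta> where "R = sqrt ((3 * p - 1) / (2 * p))" and "c = (1 - p) / p"
    and "\<phi> = phi p" and "\<theta> = theta p"
  note par = parameters[OF p, folded R_def c_def \<phi>_def \<theta>_def]
  have pm: "\<And>x. projective_measurement (M x)" "\<And>y. projective_measurement (N y)"
    and dens: "density_operator \<rho>"
    using qs by (simp_all add: quantum_strategy_def)
  define OA OB where "OA x = observable (M x)" and "OB y = observable (N y)" for x y
  note OM = projective_measurement_observable[OF pm(1), folded OA_def]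
  note ON = projective_measurement_observable[OF pm(2), folded OB_def]
  have norm_\<Psi>: "norm \<Psi> = 1"
    by (rule norm_purification[OF dens \<Psi>])
  interpret CO: commuting_observables "\<lambda>x. on_A (OA x) :: (('a \<times> 'b) \<times> 'e) ell2 \<Rightarrow> _" "\<lambda>y. on_B (OB y)"
    using commuting_observables_strategy[OF pm] by (simp only: OA_def OB_def)
  have "CO.bell_value c \<Psi> = 2 / R * (norm \<Psi>)\<^sup>2"
    using T by (simp add: T_quantum_behavior[OF qs \<Psi>] norm_\<Psi> par(8) OA_def OB_def c_def)
  note sat = CO.bell_value_saturated[OF par(1-3) this]
  interpret G: saturated "\<lambda>x. on_A (OA x)" "\<lambda>y. on_B (OB y)" R \<phi> c \<theta> \<Psi>
    by unfold_locales (use par sat in simp_all)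
  \<comment> \<open>One-party copies of the same construction, with the identity for the other
    party; their maps, extended by the identity, are the global ones.\<close>
  interpret LA: commuting_observables OA "\<lambda>_. id"
    by unfold_locales (simp_all add: OM inner_ell2_def)
  interpret LB: bob_frame "\<lambda>_. id" OB R \<phi>
    by unfold_locales (use par in \<open>simp_all add: ON inner_ell2_def\<close>)

  have E: "on_A (LA.E q) h = CO.E q h" for q and h :: "(('a \<times> 'b) \<times> 'e) ell2"
    unfolding LA.E_def[abs_def] CO.E_def
    by (cases q) (simp_all add: on_A_simps on_A_scaleR on_A_compose[OF OM(2) bounded_clinear_diff[OF bounded_clinear_ident OM(2)]] bounded_clinear_intros
        OM bounded_clinear_compose[OF OM(2)] on_A_id)
  have Z: "on_B LB.Z h = G.Z h" and X: "on_B LB.X h = G.X h" for h :: "(('a \<times> 'b) \<times> 'e) ell2"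
    unfolding LB.Z_def[abs_def] LB.X_def[abs_def] G.Z_def G.X_def LB.D_def LB.S_def CO.D_def CO.S_def
    by (simp_all add: on_B_simps on_B_scaleR bounded_clinear_intros ON)
  have F: "on_B (LB.F r) h = G.F r h" for r and h :: "(('a \<times> 'b) \<times> 'e) ell2"
    unfolding LB.F_def[abs_def] G.F_def
    by (cases r) (simp_all add: on_B_simps on_B_scaleR on_B_compose[OF LB.X bounded_clinear_diff[OF bounded_clinear_ident LB.Z]] bounded_clinear_intros
        LB.Z LB.X Z X bounded_clinear_compose[OF LB.X] on_B_id)

  define w where "w v = LB.Z (LB.Z v) - v" for v
  have w: "bounded_clinear w"
    unfolding w_def[abs_def] by (intro bounded_clinear_diff bounded_clinear_compose[OF LB.Z LB.Z] bounded_clinear_ident)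
  have Z_sa: "cinner x (LB.Z y) = cinner (LB.Z x) y" for x y
    by (simp add: LB.Z_def LB.D_def cinner_simps ON)
  have "cinner x (w y) = cinner (w x) y" for x y
    by (simp add: w_def cinner_simps Z_sa)
  then obtain P where P: "projector P" and wP: "\<And>x. w (P x) = 0" and Pw: "\<And>x. w x = 0 \<Longrightarrow> P x = x"
    using kernel_projector_exists[OF w] by blast
  have P_bc: "bounded_clinear P"
    using P by (simp add: projector_def)

  txt \<open>\<open>F\<close> is isometric on the range of \<open>P\<close>. The complement goes to the sector of the auxiliary
    space with flag 1, which the state does not reach. Alice needs no flag, hence her zero term.\<close>
  define VA where "VA v = ket (0 :: bit) \<otimes>\<^sub>v ket (0 :: bit) \<otimes>\<^sub>v LA.E 0 v
    + ket 1 \<otimes>\<^sub>v ket 0 \<otimes>\<^sub>v LA.E 1 v + ket 0 \<otimes>\<^sub>v ket 1 \<otimes>\<^sub>v 0" for v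
  define VB where "VB v = ket (0 :: bit) \<otimes>\<^sub>v ket (0 :: bit) \<otimes>\<^sub>v LB.F 0 (P v)
    + ket 1 \<otimes>\<^sub>v ket 0 \<otimes>\<^sub>v LB.F 1 (P v) + ket 0 \<otimes>\<^sub>v ket 1 \<otimes>\<^sub>v (v - P v)" for v
  have iso_A: "isometry VA"
    unfolding VA_def[abs_def] by (rule isometry_ancilla) (simp_all add: LA.E LA.norm_E)
  have iso_B: "isometry VB"
    unfolding VB_def[abs_def]
  proof (rule isometry_ancilla)
    fix v
    have "LB.Z (LB.Z (P v)) = P v"
      using wP[of v] by (simp add: w_def)
    then show "(norm (LB.F 0 (P v)))\<^sup>2 + (norm (LB.F 1 (P v)))\<^sup>2 + (norm (v - P v))\<^sup>2 = (norm v)\<^sup>2"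
      by (simp add: LB.norm_F projector_pythagoras[OF P])
  qed (simp_all add: bounded_clinear_compose[OF LB.F P_bc] bounded_clinear_diff P_bc)

  define \<xi> where "\<xi> = tensor3 ancilla ancilla G.\<eta>"
  have "norm \<xi> = 1"
    unfolding \<xi>_def by (simp add: norm_tensor3 ancilla G.norm_\<eta> norm_\<Psi>)

  have "tensor3 VA VB (tensor3 (op_or_id OA s) (op_or_id OB t) \<Psi>)
      = reorder (((op_or_id obs_A s \<otimes>\<^sub>o op_or_id (obs_B \<phi>) t) (psi_theta \<theta>)) \<otimes>\<^sub>v \<xi>)" for s t
  proof -
    let ?\<Phi> = "tensor3 (op_or_id OA s) (op_or_id OB t) \<Psi>"
    let ?x = "(op_or_id obs_A s \<otimes>\<^sub>o op_or_id (obs_B \<phi>) t) (psi_theta \<theta>)"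
    let ?J = "\<lambda>q v. ket (q :: bit) \<otimes>\<^sub>v ancilla v"
    let ?u = "\<lambda>v. ket (0 :: bit) \<otimes>\<^sub>v ket (1 :: bit) \<otimes>\<^sub>v v"
    have op: "on_A (op_or_id OA s) h = op_or_id (\<lambda>x. on_A (OA x)) s h"
      "on_B (op_or_id OB t) h = op_or_id (\<lambda>y. on_B (OB y)) t h" for h :: "(('a \<times> 'b) \<times> 'e) ell2"
      by (auto simp: op_or_id_def on_A_id on_B_id split: option.split)
    have op_bc: "bounded_clinear (op_or_id OA s)" "bounded_clinear (op_or_id OB t)"
      by (auto simp: op_or_id_def OM ON split: option.split)
    have \<Phi>: "?\<Phi> = op_or_id (\<lambda>x. on_A (OA x)) s (op_or_id (\<lambda>y. on_B (OB y)) t \<Psi>)"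
      by (simp add: op op_bc flip: on_A_on_B)
    \<comment> \<open>The state stays in the kernel of \<open>w\<close> after the observables have
      acted, so \<open>P\<close> leaves it fixed and the flag 1 term of \<open>VB\<close>
      contributes nothing.\<close>
    have "on_B w ?\<Phi> = G.Z (G.Z ?\<Phi>) - ?\<Phi>"
      unfolding w_def[abs_def]
      by (simp add: on_B_simps on_B_compose[OF LB.Z LB.Z] LB.Z bounded_clinear_compose[OF LB.Z LB.Z] on_B_id Z)
    also have "G.Z (G.Z ?\<Phi>) = ?\<Phi>"
      unfolding \<Phi>
      by (cases s) (simp_all add: op_or_id_def G.Z_Z_op_B_\<Psi>[unfolded op_or_id_def] flip: G.A_Z)
    finally have "on_B w ?\<Phi> = 0"
      by simp
    then have P\<Phi>: "on_B P ?\<Phi> = ?\<Phi>"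
      using on_B_fixed_of_kernel[OF w P_bc Pw] by blast
    let ?c = "\<lambda>q r. cos \<theta> * alice_matrix s q 0 * bob_matrix \<phi> t r 0
        + sin \<theta> * alice_matrix s q 1 * bob_matrix \<phi> t r 1"
    have EF: "tensor3 (LA.E q) (\<lambda>v. LB.F r (P v)) ?\<Phi> = ?c q r *\<^sub>R G.\<eta>" for q r
    proof -
      have "tensor3 (LA.E q) (\<lambda>v. LB.F r (P v)) ?\<Phi> = on_A (LA.E q) (on_B (LB.F r) (on_B P ?\<Phi>))"
        by (simp add: on_A_on_B LA.E LB.F P_bc bounded_clinear_compose[OF LB.F P_bc] flip: on_B_compose)
      also have "\<dots> = CO.E q (G.F r ?\<Phi>)"
        by (simp only: P\<Phi> E F)
      finally show ?thesis
        unfolding \<Phi> G.extraction_components .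
    qed
    have E0: "tensor3 (LA.E q) (\<lambda>v. v - P v) ?\<Phi> = 0" for q
    proof -
      have "tensor3 (LA.E q) (\<lambda>v. v - P v) ?\<Phi> = on_A (LA.E q) (on_B (\<lambda>v. v - P v) ?\<Phi>)"
        by (simp add: on_A_on_B LA.E P_bc bounded_clinear_diff)
      also have "on_B (\<lambda>v. v - P v) ?\<Phi> = 0"
        by (simp add: on_B_simps P_bc on_B_id P\<Phi>)
      finally show ?thesis
        by (simp add: bounded_clinear_simps[OF bounded_clinear_on_A[OF LA.E]])
    qed
    have J: "bounded_clinear (?J q)" for q
      by (intro bounded_clinear_tensor_right ancilla)
    have u: "bounded_clinear ?u"
      by (intro bounded_clinear_tensor_right bounded_clinear_ident)
    have JE: "bounded_clinear (\<lambda>v. ?J q (LA.E k v))" and JF: "bounded_clinear (\<lambda>v. ?J q (LB.F k (P v)))"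
      and uG: "bounded_clinear (\<lambda>v. ?u (v - P v))" for q k
      by (intro bounded_clinear_tensor_right bounded_clinear_compose[OF ancilla(1)]
          bounded_clinear_compose[OF LB.F P_bc] bounded_clinear_diff bounded_clinear_ident P_bc LA.E)+
    have VA: "VA = (\<lambda>v. ?J 0 (LA.E 0 v) + ?J 1 (LA.E 1 v))"
      by (simp add: VA_def fun_eq_iff ancilla_def tensor_simps)
    have VB: "VB = (\<lambda>v. ?J 0 (LB.F 0 (P v)) + ?J 1 (LB.F 1 (P v)) + ?u (v - P v))"
      by (simp add: VB_def fun_eq_iff ancilla_def)
    have JJ: "tensor3 (\<lambda>v. ?J q (LA.E q v)) (\<lambda>v. ?J r (LB.F r (P v))) ?\<Phi>
        = ?c q r *\<^sub>R reorder ((ket q \<otimes>\<^sub>v ket r) \<otimes>\<^sub>v \<xi>)" for q r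
    proof -
      have "tensor3 (\<lambda>v. ?J q (LA.E q v)) (\<lambda>v. ?J r (LB.F r (P v))) ?\<Phi>
          = tensor3 (?J q) (?J r) (tensor3 (LA.E q) (\<lambda>v. LB.F r (P v)) ?\<Phi>)"
        by (simp add: tensor3_compose J LA.E bounded_clinear_compose[OF LB.F P_bc])
      also have "\<dots> = ?c q r *\<^sub>R tensor3 (?J q) (?J r) G.\<eta>"
        unfolding EF by (rule bounded_clinear_simps(6)[OF bounded_clinear_tensor3[OF J J]])
      finally show ?thesis
        unfolding tensor3_ket_ancilla \<xi>_def .
    qed
    have Ju: "tensor3 (\<lambda>v. ?J q (LA.E q v)) (\<lambda>v. ?u (v - P v)) ?\<Phi> = 0" for q
    proof -
      have "tensor3 (\<lambda>v. ?J q (LA.E q v)) (\<lambda>v. ?u (v - P v)) ?\<Phi>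
          = tensor3 (?J q) ?u (tensor3 (LA.E q) (\<lambda>v. v - P v) ?\<Phi>)"
        by (simp add: tensor3_compose J u LA.E bounded_clinear_diff P_bc)
      then show ?thesis
        unfolding E0 bounded_clinear_simps[OF bounded_clinear_tensor3[OF J u]] .
    qed
    have "tensor3 VA VB ?\<Phi> = ?c 0 0 *\<^sub>R reorder ((ket 0 \<otimes>\<^sub>v ket 0) \<otimes>\<^sub>v \<xi>)
        + ?c 0 1 *\<^sub>R reorder ((ket 0 \<otimes>\<^sub>v ket 1) \<otimes>\<^sub>v \<xi>)
        + ?c 1 0 *\<^sub>R reorder ((ket 1 \<otimes>\<^sub>v ket 0) \<otimes>\<^sub>v \<xi>)
        + ?c 1 1 *\<^sub>R reorder ((ket 1 \<otimes>\<^sub>v ket 1) \<otimes>\<^sub>v \<xi>)"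
      unfolding VA VB
      by (simp add: tensor3_add_left tensor3_add_right JE JF uG bounded_clinear_add JJ Ju)
    also have "\<dots> = reorder (?x \<otimes>\<^sub>v \<xi>)"
      by (subst bit_pair_expansion[of ?x])
        (simp only: coord_target tensor_simps bounded_clinear_simps[OF bounded_clinear_reorder] scaleR_scaleC)
    finally show ?thesis .
  qed
  then show ?thesis
    unfolding self_test_extraction_def OA_def[symmetric, abs_def] OB_def[symmetric, abs_def]
      \<phi>_def[symmetric] \<theta>_def[symmetric] tensor3_def
    using iso_A iso_B \<open>norm \<xi> = 1\<close> by (intro exI[of _ VA] exI[of _ VB] exI[of _ \<xi>]) auto
qed


theorem proposition1:
  fixes p :: real
  assumes "2 / 5 < p" and "p < 1"
  shows "(\<forall>P \<in> local_behaviors. T p P \<le> 2 * (\<bar>2 * p - 1\<bar> + 1 - p) / p)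
    \<and> (\<forall>P \<in> signaling_local_behaviors (p, p) (1 / 2, 1 / 2).
        T p P \<le> 2 * max p \<bar>- p + 2 * ((1 - p)\<^sup>2 / p)\<bar> + 2 * (1 - p))
    \<and> (\<forall>(\<rho> :: ('a \<times> 'b) ell2 \<Rightarrow> ('a \<times> 'b) ell2) M N. quantum_strategy \<rho> M N \<longrightarrow>
        T p (quantum_behavior \<rho> M N) \<le> 2 * sqrt 2 * sqrt (p / (3 * p - 1)))
    \<and> (\<exists>M N. quantum_strategy (ketbra (psi_theta (theta p))) M N
        \<and> (\<forall>x. observable (M x) = obs_A x) \<and> (\<forall>y. observable (N y) = obs_B (phi p) y)
        \<and> T p (quantum_behavior (ketbra (psi_theta (theta p))) M N)
            = 2 * sqrt 2 * sqrt (p / (3 * p - 1)))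
    \<and> (\<forall>(\<rho> :: ('a \<times> 'b) ell2 \<Rightarrow> ('a \<times> 'b) ell2) M N (\<Psi> :: (('a \<times> 'b) \<times> 'e) ell2).
        quantum_strategy \<rho> M N
        \<and> T p (quantum_behavior \<rho> M N) = 2 * sqrt 2 * sqrt (p / (3 * p - 1))
        \<and> purification \<Psi> \<rho> \<longrightarrow>
        self_test_extraction \<Psi> (\<lambda>x. observable (M x)) (\<lambda>y. observable (N y))
          (psi_theta (theta p)) obs_A (obs_B (phi p)))"
proof (intro conjI ballI allI impI)
  have p: "0 < p" "p \<le> 1"
    using assms by simp_all
  show "T p P \<le> 2 * (\<bar>2 * p - 1\<bar> + 1 - p) / p" if "P \<in> local_behaviors" for P
    by (rule local_bound[OF p that])
  show "T p P \<le> 2 * max p \<bar>- p + 2 * ((1 - p)\<^sup>2 / p)\<bar> + 2 * (1 - p)"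
    if "P \<in> signaling_local_behaviors (p, p) (1 / 2, 1 / 2)" for P
    by (rule signaling_bound[OF p that])
  show "T p (quantum_behavior \<rho> M N) \<le> 2 * sqrt 2 * sqrt (p / (3 * p - 1))"
    if "quantum_strategy \<rho> M N" for \<rho> :: "('a \<times> 'b) ell2 \<Rightarrow> ('a \<times> 'b) ell2" and M N
    by (rule quantum_bound[OF assms that])
  show "\<exists>M N. quantum_strategy (ketbra (psi_theta (theta p))) M N
      \<and> (\<forall>x. observable (M x) = obs_A x) \<and> (\<forall>y. observable (N y) = obs_B (phi p) y)
      \<and> T p (quantum_behavior (ketbra (psi_theta (theta p))) M N) = 2 * sqrt 2 * sqrt (p / (3 * p - 1))"
    using two_qubit_strategy[OF assms] by blast
  show "self_test_extraction \<Psi> (\<lambda>x. observable (M x)) (\<lambda>y. observable (N y))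
      (psi_theta (theta p)) obs_A (obs_B (phi p))"
    if "quantum_strategy \<rho> M N
        \<and> T p (quantum_behavior \<rho> M N) = 2 * sqrt 2 * sqrt (p / (3 * p - 1))
        \<and> purification \<Psi> \<rho>"
    for \<rho> :: "('a \<times> 'b) ell2 \<Rightarrow> ('a \<times> 'b) ell2" and M N and \<Psi> :: "(('a \<times> 'b) \<times> 'e) ell2"
    using that self_test[OF assms] by blast
qed

end
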